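(* Let $u\in K$ be the primal solution (the unique minimizer of $I$) and let $\mu\in(\mathrm{ba}(\Omega))^d$ be a dual solution (a maximizer of $D$). For $v\in K$ and $\nu\in K^*$ define the primal-dual total error $$\rho_{\mathrm{tot}}^2(v,\nu):=\big(I(v)-I(u)\big)+\big(-D(\nu)+D(\mu)\big)$$ and the primal-dual gap estimator $\eta_{\mathrm{gap}}^2(v,\nu):=I(v)-D(\nu)$. Then, for every $v\in K$ and $\nu\in K^*$, $$\rho_{\mathrm{tot}}^2(v,\nu)=\eta_{\mathrm{gap}}^2(v,\nu).$$
   Context: Let $\Omega\subseteq\mathbb{R}^d$, $d\in\mathbb{N}$, be a bounded simplicial Lipschitz domain (polyhedral, i.e. exactly decomposable into simplices) whose boundary is divided into two disjoint relatively open parts $\Gamma_D$ with $|\Gamma_D|>0$ (surface measure) and $\Gamma_N$, $\partial\Omega=\overline\Gamma_D\cup\overline\Gamma_N$. Write $(v,w)_\omega=\int_\omega v\cdot w$, $\|\cdot\|_{p,\omega}$ for the $L^p(\omega)$-norm (Euclidean norm for vectors). Traces are not denoted explicitly. $W^{1,\infty}_D(\Omega)=\{v\in W^{1,\infty}(\Omega): v=0\text{ a.e. on }\Gamma_D\}$. $W^{-1,1}(\Gamma_N)$ denotes the dual of $W^{1,\infty}(\Gamma_N)$ and $\langle\cdot,\cdot\rangle_{\Gamma_N}$ the duality pairing. Data: $f\in L^1(\Omega)$, $g\in W^{-1,1}(\Gamma_N)$, $\zeta\in L^\infty(\Omega)$ with $\operatorname{ess\,inf}_\Omega\zeta>0$,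 $u_D\in W^{1,\infty}(\Gamma_D)$ such that there is a (fixed) $\widehat u_D\in W^{1,\infty}(\Omega)$ with $\widehat u_D=u_D$ on $\Gamma_D$ and $\|\nabla\widehat u_D/\zeta\|_{\infty,\Omega}<1$. For a.e. $x\in\Omega$ and $s\in\mathbb{R}^d$: $\phi^*(x,s)=\frac12|s|^2$ if $|s|\le\zeta(x)$ and $\phi^*(x,s)=\zeta(x)|s|-\frac12\zeta(x)^2$ if $|s|>\zeta(x)$. Primal problem: $K=\{v\in W^{1,\infty}(\Omega): |\nabla v|\le\zeta\text{ a.e. in }\Omega,\ v=u_D\text{ a.e. on }\Gamma_D\}$, and $I:W^{1,\infty}(\Omega)\to\mathbb{R}\cup\{+\infty\}$, $I(v)=\frac12\|\nabla v\|_{2,\Omega}^2-(f,v)_\Omega-\langle g,v\rangle_{\Gamma_N}$ if $v\in K$, $I(v)=+\infty$ otherwise. $I$ has a unique minimizer $u\in K$ (standing fact). Finitely additive measures: $(\mathrm{ba}(\Omega))^d$ is the space of finitely additive $\mathbb{R}^d$-valued set functions $\nu$ on the Lebesgue measurable subsets of $\Omega$ that vanish on Lebesgue null sets and have finite total variation $|\nu|(\Omega)=\sup\sum_i|\nu(A_i)|$ (supremum over countable measurable partitions $(A_i)$ of $\Omega$). It is isometrically isomorphic to $((L^\infty(\Omega))^d)^*$ via $\langle\nu,y\rangle_{(L^\infty(\Omega))^d}=\int_\Omega y\cdot\mathrm{d}\nu$. For $y\in(L^1(\Omega))^d$, $y\otimes\mathrm{d}x$ is the element $\widehat y\mapsto\int_\Omega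 y\cdot\widehat y\,\mathrm{d}x$. Every $\nu\in(\mathrm{ba}(\Omega))^d$ decomposes uniquely as $\nu=y\otimes\mathrm{d}x+\nu^s$ with $y\in(L^1(\Omega))^d$ and $\nu^s\in(\mathrm{ba}(\Omega))^d$ singular (Lebesgue/Yosida–Hewitt decomposition: there are decreasing measurable sets $E_n$ with $|E_n|\to0$ and $|\nu^s|(\Omega\setminus E_n)=0$ for all $n$). $\zeta\nu^s\in(\mathrm{ba}(\Omega))^d$ is $(\zeta\nu^s)(A)=\int_A\zeta\,\mathrm{d}\nu^s$. Dual functional: $K^*=\{\nu\in(\mathrm{ba}(\Omega))^d:\langle\nu,\nabla v\rangle_{(L^\infty(\Omega))^d}=(f,v)_\Omega+\langle g,v\rangle_{\Gamma_N}\ \forall v\in W^{1,\infty}_D(\Omega)\}$, and for $\nu=y\otimes\mathrm{d}x+\nu^s$, $D(\nu)=-\int_\Omega\phi^*(\cdot,y)\,\mathrm{d}x-|\zeta\nu^s|(\Omega)+\langle\nu,\nabla\widehat u_D\rangle_{(L^\infty(\Omega))^d}-(f,\widehat u_D)_\Omega-\langle g,\widehat u_D\rangle_{\Gamma_N}$ if $\nu\in K^*$, and $D(\nu)=-\infty$ otherwise. $D$ is the Fenchel dual functional of $I$. *)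

theory Defs
  imports "HOL-Analysis.Analysis" "HOL-Probability.Essential_Supremum"
begin

section \<open>Domains and surface measure\<close>

text \<open>Near every boundary point, in a direction \<open>e\<close>, the domain is the strict epigraph of a Lipschitz
  function \<open>\<gamma>\<close> of the coordinates orthogonal to \<open>e\<close>.\<close>

definition lipschitz_domain :: "'a::euclidean_space set \<Rightarrow> bool" where
  "lipschitz_domain \<Omega> \<longleftrightarrow> open \<Omega> \<and> connected \<Omega> \<and> bounded \<Omega> \<and> \<Omega> \<noteq> {} \<and>
     (\<forall>z\<in>frontier \<Omega>. \<exists>e r L. \<exists>\<gamma> :: 'a \<Rightarrow> real. norm e = 1 \<and> r > 0 \<and> L-lipschitz_on UNIV \<gamma> \<and>
        (\<forall>x\<in>ball z r. x \<in> \<Omega> \<longleftrightarrow> \<gamma> (x - (x \<bullet> e) *\<^sub>R e) < x \<bullet> e))"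

definition simplicial_lipschitz_domain :: "'a::euclidean_space set \<Rightarrow> bool" where
  "simplicial_lipschitz_domain \<Omega> \<longleftrightarrow> lipschitz_domain \<Omega> \<and>
     (\<exists>\<T>. triangulation \<T> \<and> (\<forall>T\<in>\<T>. int DIM('a) simplex T) \<and> closure \<Omega> = \<Union>\<T>)"

text \<open>The surface measure is the Hausdorff (outer) measure of dimension \<open>DIM('a) - 1\<close>. The empty
  set is treated separately because \<open>0 ^ 0 = 1\<close>; for \<open>DIM('a) = 1\<close> this gives the counting measure.\<close>

definition hausdorff_gauge :: "'a::euclidean_space set \<Rightarrow> ennreal" where
  "hausdorff_gauge U = (if U = {} then 0
     else ennreal (unit_ball_vol (real (DIM('a) - 1)) * (diameter U / 2) ^ (DIM('a) - 1)))"

definition surface_measure :: "'a::euclidean_space set \<Rightarrow> ennreal" where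
  "surface_measure A = (SUP \<delta>\<in>{0<..}.
     INF U\<in>{U :: nat \<Rightarrow> 'a set. A \<subseteq> (\<Union>i. U i) \<and> (\<forall>i. bounded (U i) \<and> diameter (U i) \<le> \<delta>)}.
       \<Sum>i. hausdorff_gauge (U i))"

definition surface_AE :: "'a::euclidean_space set \<Rightarrow> ('a \<Rightarrow> bool) \<Rightarrow> bool" where
  "surface_AE \<Gamma> P \<longleftrightarrow> surface_measure {x\<in>\<Gamma>. \<not> P x} = 0"

definition boundary_partition :: "'a::euclidean_space set \<Rightarrow> 'a set \<Rightarrow> 'a set \<Rightarrow> bool" where
  "boundary_partition \<Omega> \<Gamma>D \<Gamma>N \<longleftrightarrow>
     openin (top_of_set (frontier \<Omega>)) \<Gamma>D \<and> openin (top_of_set (frontier \<Omega>)) \<Gamma>N \<and>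
     \<Gamma>D \<inter> \<Gamma>N = {} \<and> frontier \<Omega> = closure \<Gamma>D \<union> closure \<Gamma>N"

section \<open>Lebesgue and Sobolev spaces\<close>

text \<open>Elements of function spaces are represented by functions on the whole space, of which only the
  values on \<open>\<Omega>\<close> (up to null sets) matter.\<close>

definition Linf_norm :: "'a::euclidean_space set \<Rightarrow> ('a \<Rightarrow> 'b::euclidean_space) \<Rightarrow> ereal" where
  "Linf_norm \<Omega> y = esssup (lebesgue_on \<Omega>) (\<lambda>x. ereal (norm (y x)))"

definition Linf :: "'a::euclidean_space set \<Rightarrow> ('a \<Rightarrow> 'b::euclidean_space) set" where
  "Linf \<Omega> = {y. y \<in> borel_measurable (lebesgue_on \<Omega>) \<and> Linf_norm \<Omega> y < \<infinity>}"

text \<open>\<open>D [b\<^sub>1, \<dots>, b\<^sub>k]\<close> is the iterated partial derivative in the directions \<open>b\<^sub>1, \<dots>, b\<^sub>k\<close>.\<close>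

definition smooth :: "('a::euclidean_space \<Rightarrow> real) \<Rightarrow> bool" where
  "smooth \<phi> \<longleftrightarrow> (\<exists>D :: 'a list \<Rightarrow> 'a \<Rightarrow> real. D [] = \<phi> \<and>
     (\<forall>bs x. (D bs has_derivative (\<lambda>h. \<Sum>b\<in>Basis. (h \<bullet> b) * D (bs @ [b]) x)) (at x)))"

definition test_functions :: "'a::euclidean_space set \<Rightarrow> ('a \<Rightarrow> real) set" where
  "test_functions \<Omega> = {\<phi>. smooth \<phi> \<and> compact (closure {x. \<phi> x \<noteq> 0}) \<and> closure {x. \<phi> x \<noteq> 0} \<subseteq> \<Omega>}"

definition weak_gradient :: "'a::euclidean_space set \<Rightarrow> ('a \<Rightarrow> real) \<Rightarrow> ('a \<Rightarrow> 'a) \<Rightarrow> bool" where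
  "weak_gradient \<Omega> v G \<longleftrightarrow> (\<forall>\<phi>\<in>test_functions \<Omega>. \<forall>b\<in>Basis.
     (LINT x|lebesgue_on \<Omega>. v x * frechet_derivative \<phi> (at x) b) =
     - (LINT x|lebesgue_on \<Omega>. (G x \<bullet> b) * \<phi> x))"

definition W1inf :: "'a::euclidean_space set \<Rightarrow> ('a \<Rightarrow> real) set" where
  "W1inf \<Omega> = {v. v \<in> Linf \<Omega> \<and> (\<exists>G\<in>Linf \<Omega>. weak_gradient \<Omega> v G)}"

definition grad :: "'a::euclidean_space set \<Rightarrow> ('a \<Rightarrow> real) \<Rightarrow> 'a \<Rightarrow> 'a" where
  "grad \<Omega> v = (SOME G. G \<in> Linf \<Omega> \<and> weak_gradient \<Omega> v G)"

definition W1inf_norm :: "'a::euclidean_space set \<Rightarrow> ('a \<Rightarrow> real) \<Rightarrow> ereal" where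
  "W1inf_norm \<Omega> v = Linf_norm \<Omega> v + Linf_norm \<Omega> (grad \<Omega> v)"

text \<open>On a bounded Lipschitz domain every \<open>v\<close> in \<open>W1inf \<Omega>\<close> has a representative that is continuous
  on \<open>closure \<Omega>\<close>; its boundary values are the trace of \<open>v\<close>.\<close>

definition continuous_rep :: "'a::euclidean_space set \<Rightarrow> ('a \<Rightarrow> real) \<Rightarrow> ('a \<Rightarrow> real) \<Rightarrow> bool" where
  "continuous_rep \<Omega> v V \<longleftrightarrow> continuous_on (closure \<Omega>) V \<and> (AE x in lebesgue_on \<Omega>. V x = v x)"

definition trace :: "'a::euclidean_space set \<Rightarrow> ('a \<Rightarrow> real) \<Rightarrow> 'a \<Rightarrow> real" where
  "trace \<Omega> v = (SOME V. continuous_rep \<Omega> v V)"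

definition trace_eq_on :: "'a::euclidean_space set \<Rightarrow> 'a set \<Rightarrow> ('a \<Rightarrow> real) \<Rightarrow> ('a \<Rightarrow> real) \<Rightarrow> bool" where
  "trace_eq_on \<Omega> \<Gamma> v w \<longleftrightarrow> (\<exists>V. continuous_rep \<Omega> v V \<and> surface_AE \<Gamma> (\<lambda>x. V x = w x))"

definition W1inf_D :: "'a::euclidean_space set \<Rightarrow> 'a set \<Rightarrow> ('a \<Rightarrow> real) set" where
  "W1inf_D \<Omega> \<Gamma>D = {v\<in>W1inf \<Omega>. trace_eq_on \<Omega> \<Gamma>D v (\<lambda>x. 0)}"

text \<open>The boundary space \<open>W\<^sup>1\<^sup>,\<^sup>\<infinity>(\<Gamma>)\<close> is the trace space (the range of the trace operator restricted to
  \<open>\<Gamma>\<close>) with its quotient norm. Functions that agree almost everywhere on \<open>\<Gamma>\<close> have distance zero,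
  so bounded linear functionals automatically respect almost-everywhere equality.\<close>

definition W1inf_bdry :: "'a::euclidean_space set \<Rightarrow> 'a set \<Rightarrow> ('a \<Rightarrow> real) set" where
  "W1inf_bdry \<Omega> \<Gamma> = {w. \<exists>v\<in>W1inf \<Omega>. trace_eq_on \<Omega> \<Gamma> v w}"

definition W1inf_bdry_norm :: "'a::euclidean_space set \<Rightarrow> 'a set \<Rightarrow> ('a \<Rightarrow> real) \<Rightarrow> ereal" where
  "W1inf_bdry_norm \<Omega> \<Gamma> w = (INF v\<in>{v\<in>W1inf \<Omega>. trace_eq_on \<Omega> \<Gamma> v w}. W1inf_norm \<Omega> v)"

definition W1inf_bdry_dual :: "'a::euclidean_space set \<Rightarrow> 'a set \<Rightarrow> (('a \<Rightarrow> real) \<Rightarrow> real) set" where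
  "W1inf_bdry_dual \<Omega> \<Gamma> = {g.
     (\<forall>w1\<in>W1inf_bdry \<Omega> \<Gamma>. \<forall>w2\<in>W1inf_bdry \<Omega> \<Gamma>. g (\<lambda>x. w1 x + w2 x) = g w1 + g w2) \<and>
     (\<forall>c. \<forall>w\<in>W1inf_bdry \<Omega> \<Gamma>. g (\<lambda>x. c * w x) = c * g w) \<and>
     (\<exists>C. \<forall>w\<in>W1inf_bdry \<Omega> \<Gamma>. ereal \<bar>g w\<bar> \<le> ereal C * W1inf_bdry_norm \<Omega> \<Gamma> w)}"

section \<open>Finitely additive vector measures\<close>

definition total_variation ::
  "'a::euclidean_space set \<Rightarrow> ('a set \<Rightarrow> 'a) \<Rightarrow> 'a set \<Rightarrow> ennreal" where
  "total_variation \<Omega> \<nu> B =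
     (SUP A\<in>{A :: nat \<Rightarrow> 'a set. range A \<subseteq> sets (lebesgue_on \<Omega>) \<and> disjoint_family A \<and> (\<Union>i. A i) = B}.
        \<Sum>i. ennreal (norm (\<nu> (A i))))"

definition ba :: "'a::euclidean_space set \<Rightarrow> ('a set \<Rightarrow> 'a) set" where
  "ba \<Omega> = {\<nu>.
     (\<forall>A\<in>sets (lebesgue_on \<Omega>). \<forall>B\<in>sets (lebesgue_on \<Omega>). A \<inter> B = {} \<longrightarrow> \<nu> (A \<union> B) = \<nu> A + \<nu> B) \<and>
     (\<forall>A\<in>null_sets (lebesgue_on \<Omega>). \<nu> A = 0) \<and>
     total_variation \<Omega> \<nu> \<Omega> < \<infinity>}"

definition ba_simple_integral ::
  "'a::euclidean_space set \<Rightarrow> ('a set \<Rightarrow> 'a) \<Rightarrow> ('a \<Rightarrow> 'a) \<Rightarrow> real" where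
  "ba_simple_integral \<Omega> \<nu> s = (\<Sum>c\<in>s ` \<Omega>. c \<bullet> \<nu> (s -` {c} \<inter> \<Omega>))"

definition has_ba_integral ::
  "'a::euclidean_space set \<Rightarrow> ('a set \<Rightarrow> 'a) \<Rightarrow> ('a \<Rightarrow> 'a) \<Rightarrow> real \<Rightarrow> bool" where
  "has_ba_integral \<Omega> \<nu> y I \<longleftrightarrow> (\<exists>s. (\<forall>n. simple_function (lebesgue_on \<Omega>) (s n)) \<and>
     (\<lambda>n. Linf_norm \<Omega> (\<lambda>x. s n x - y x)) \<longlonglongrightarrow> 0 \<and>
     (\<lambda>n. ba_simple_integral \<Omega> \<nu> (s n)) \<longlonglongrightarrow> I)"

definition ba_integral ::
  "'a::euclidean_space set \<Rightarrow> ('a set \<Rightarrow> 'a) \<Rightarrow> ('a \<Rightarrow> 'a) \<Rightarrow> real" where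
  "ba_integral \<Omega> \<nu> y = (THE I. has_ba_integral \<Omega> \<nu> y I)"

text \<open>The vector-valued integral \<open>\<integral>\<^sub>A \<zeta> d\<nu>\<close>, computed componentwise.\<close>

definition ba_density ::
  "'a::euclidean_space set \<Rightarrow> ('a \<Rightarrow> real) \<Rightarrow> ('a set \<Rightarrow> 'a) \<Rightarrow> 'a set \<Rightarrow> 'a" where
  "ba_density \<Omega> \<zeta> \<nu> A = (\<Sum>b\<in>Basis. ba_integral \<Omega> \<nu> (\<lambda>x. (indicator A x * \<zeta> x) *\<^sub>R b) *\<^sub>R b)"

definition ba_singular :: "'a::euclidean_space set \<Rightarrow> ('a set \<Rightarrow> 'a) \<Rightarrow> bool" where
  "ba_singular \<Omega> \<nu> \<longleftrightarrow> (\<exists>E :: nat \<Rightarrow> 'a set. range E \<subseteq> sets (lebesgue_on \<Omega>) \<and> decseq E \<and>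
     (\<lambda>n. emeasure (lebesgue_on \<Omega>) (E n)) \<longlonglongrightarrow> 0 \<and> (\<forall>n. total_variation \<Omega> \<nu> (\<Omega> - E n) = 0))"

definition yosida_hewitt ::
  "'a::euclidean_space set \<Rightarrow> ('a set \<Rightarrow> 'a) \<Rightarrow> ('a \<Rightarrow> 'a) \<Rightarrow> ('a set \<Rightarrow> 'a) \<Rightarrow> bool" where
  "yosida_hewitt \<Omega> \<nu> y \<nu>s \<longleftrightarrow> integrable (lebesgue_on \<Omega>) y \<and> \<nu>s \<in> ba \<Omega> \<and> ba_singular \<Omega> \<nu>s \<and>
     (\<forall>A\<in>sets (lebesgue_on \<Omega>). \<nu> A = (LINT x:A|lebesgue_on \<Omega>. y x) + \<nu>s A)"

definition ac_part :: "'a::euclidean_space set \<Rightarrow> ('a set \<Rightarrow> 'a) \<Rightarrow> 'a \<Rightarrow> 'a" where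
  "ac_part \<Omega> \<nu> = (SOME y. \<exists>\<nu>s. yosida_hewitt \<Omega> \<nu> y \<nu>s)"

definition sing_part :: "'a::euclidean_space set \<Rightarrow> ('a set \<Rightarrow> 'a) \<Rightarrow> 'a set \<Rightarrow> 'a" where
  "sing_part \<Omega> \<nu> = (SOME \<nu>s. yosida_hewitt \<Omega> \<nu> (ac_part \<Omega> \<nu>) \<nu>s)"

section \<open>Primal and dual problem\<close>

text \<open>The load \<open>(f, v)\<^sub>\<Omega> + \<langle>g, v\<rangle>\<^sub>\<Gamma>\<^sub>N\<close>.\<close>

definition load ::
  "'a::euclidean_space set \<Rightarrow> ('a \<Rightarrow> real) \<Rightarrow> (('a \<Rightarrow> real) \<Rightarrow> real) \<Rightarrow> ('a \<Rightarrow> real) \<Rightarrow> real" where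
  "load \<Omega> f g v = (LINT x|lebesgue_on \<Omega>. f x * v x) + g (trace \<Omega> v)"

definition primal_set ::
  "'a::euclidean_space set \<Rightarrow> 'a set \<Rightarrow> ('a \<Rightarrow> real) \<Rightarrow> ('a \<Rightarrow> real) \<Rightarrow> ('a \<Rightarrow> real) set" where
  "primal_set \<Omega> \<Gamma>D \<zeta> uD =
     {v\<in>W1inf \<Omega>. (AE x in lebesgue_on \<Omega>. norm (grad \<Omega> v x) \<le> \<zeta> x) \<and> trace_eq_on \<Omega> \<Gamma>D v uD}"

definition primal_energy ::
  "'a::euclidean_space set \<Rightarrow> 'a set \<Rightarrow> ('a \<Rightarrow> real) \<Rightarrow> ('a \<Rightarrow> real) \<Rightarrow> ('a \<Rightarrow> real) \<Rightarrow>
   (('a \<Rightarrow> real) \<Rightarrow> real) \<Rightarrow> ('a \<Rightarrow> real) \<Rightarrow> ereal" where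
  "primal_energy \<Omega> \<Gamma>D \<zeta> uD f g v =
     (if v \<in> primal_set \<Omega> \<Gamma>D \<zeta> uD
      then ereal (1/2 * (LINT x|lebesgue_on \<Omega>. (norm (grad \<Omega> v x))\<^sup>2) - load \<Omega> f g v)
      else \<infinity>)"

definition phi_star :: "('a \<Rightarrow> real) \<Rightarrow> 'a \<Rightarrow> 'a::euclidean_space \<Rightarrow> real" where
  "phi_star \<zeta> x s = (if norm s \<le> \<zeta> x then 1/2 * (norm s)\<^sup>2 else \<zeta> x * norm s - 1/2 * (\<zeta> x)\<^sup>2)"

definition dual_set ::
  "'a::euclidean_space set \<Rightarrow> 'a set \<Rightarrow> ('a \<Rightarrow> real) \<Rightarrow> (('a \<Rightarrow> real) \<Rightarrow> real) \<Rightarrow> ('a set \<Rightarrow> 'a) set" where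
  "dual_set \<Omega> \<Gamma>D f g = {\<nu>\<in>ba \<Omega>. \<forall>v\<in>W1inf_D \<Omega> \<Gamma>D. ba_integral \<Omega> \<nu> (grad \<Omega> v) = load \<Omega> f g v}"

text \<open>Here \<open>uh\<close> is the fixed lift of the Dirichlet data.\<close>

definition dual_energy ::
  "'a::euclidean_space set \<Rightarrow> 'a set \<Rightarrow> ('a \<Rightarrow> real) \<Rightarrow> ('a \<Rightarrow> real) \<Rightarrow> ('a \<Rightarrow> real) \<Rightarrow>
   (('a \<Rightarrow> real) \<Rightarrow> real) \<Rightarrow> ('a set \<Rightarrow> 'a) \<Rightarrow> ereal" where
  "dual_energy \<Omega> \<Gamma>D \<zeta> uh f g \<nu> =
     (if \<nu> \<in> dual_set \<Omega> \<Gamma>D f g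
      then - ereal (LINT x|lebesgue_on \<Omega>. phi_star \<zeta> x (ac_part \<Omega> \<nu> x))
           - enn2ereal (total_variation \<Omega> (ba_density \<Omega> \<zeta> (sing_part \<Omega> \<nu>)) \<Omega>)
           + ereal (ba_integral \<Omega> \<nu> (grad \<Omega> uh) - load \<Omega> f g uh)
      else - \<infinity>)"

definition total_error ::
  "('v \<Rightarrow> ereal) \<Rightarrow> ('w \<Rightarrow> ereal) \<Rightarrow> 'v \<Rightarrow> 'w \<Rightarrow> 'v \<Rightarrow> 'w \<Rightarrow> ereal" where
  "total_error I D u \<mu> v \<nu> = (I v - I u) + (- D \<nu> + D \<mu>)"

definition gap_estimator :: "('v \<Rightarrow> ereal) \<Rightarrow> ('w \<Rightarrow> ereal) \<Rightarrow> 'v \<Rightarrow> 'w \<Rightarrow> ereal" where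
  "gap_estimator I D v \<nu> = I v - D \<nu>"

end

theory Submission
  imports Defs
begin

text \<open>The claim is equivalent to strong duality \<open>I u = D \<mu>\<close>. Weak duality is Fenchel's inequality for the
  pointwise conjugate. For the converse let \<open>L w = load w - (\<nabla>u, \<nabla>w)\<close>; minimality of \<open>u\<close> says that \<open>u\<close>
  maximises the linear functional \<open>L\<close> over \<open>K\<close>. Because \<open>uh\<close> is strictly feasible, Hahn--Banach extends \<open>L\<close>
  from gradients of functions vanishing on \<open>\<Gamma>D\<close> to a bounded functional \<open>T\<close> on \<open>L\<^sup>\<infinity>\<close> whose maximum over
  \<open>{|q| \<le> \<zeta>}\<close> is attained at \<open>\<nabla>u\<close>. The finitely additive measure representing \<open>\<nabla>u \<otimes> dx + T\<close> is then
  dual feasible, and testing with fields that follow the pointwise maximiser for the density off the sets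
  \<open>E n\<close> and a near-optimal partition for \<open>\<zeta>\<nu>\<^sup>s\<close> on them shows that its dual energy is at least \<open>I u\<close>.\<close>

section \<open>Smooth bump functions\<close>

text \<open>Once \<open>I u = D \<mu>\<close>, the terms \<open>- I u\<close> and
  \<open>D \<mu>\<close> cancel, provided the extended-real values involved are finite. Gradients,
  traces and the Yosida--Hewitt parts are all fixed by Hilbert choice. Computing with them takes
  uniqueness of weak gradients up to null sets (the purpose of the bump functions), uniqueness of
  continuous representatives, and existence of the decomposition. Strict feasibility of
  \<open>uh\<close> is used quantitatively: from \<open>\<zeta> \<ge> z0 > 0\<close> and
  \<open>norm (grad uh) \<le> \<theta> * \<zeta>\<close> with \<open>\<theta> < 1\<close>, any field
  of size \<open>(1 - \<theta>) * z0\<close> may be added to the gradient of \<open>uh\<close>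
  without leaving the ball of radius \<open>\<zeta>\<close>. This room yields the norm bound of the
  multiplier. Hahn--Banach is run on a cone of inequalities \<open>T q \<le> r\<close>, so that
  boundedness, the values on gradients and maximality at the gradient of \<open>u\<close> are
  imposed at once. The one consistency condition, that \<open>T 0 \<le> r\<close> occurs only with
  \<open>r \<ge> 0\<close>, is a rescaled form of the first-order optimality condition.\<close>

definition flat_fun :: "real poly \<Rightarrow> real \<Rightarrow> real" where
  "flat_fun p t = (if t > 0 then poly p (1 / t) * exp (- (1 / t)) else 0)"

lemma poly_times_exp_minus_tendsto_0: "((\<lambda>x. poly p x * exp (- x)) \<longlongrightarrow> (0::real)) at_top"
proof -
  have "((\<lambda>x. \<Sum>i\<le>degree p. coeff p i * (x ^ i / exp x)) \<longlongrightarrow> (\<Sum>i\<le>degree p. coeff p i * 0)) at_top"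
    by (intro tendsto_sum tendsto_mult tendsto_const tendsto_power_div_exp_0)
  then show ?thesis
    by (simp add: poly_altdef sum_distrib_left exp_minus divide_inverse mult_ac)
qed

text \<open>The chain rule at \<open>t > 0\<close> gives the polynomial
  \<open>X^2 * (p - p')\<close> in \<open>X = 1 / t\<close>. The polynomial factor in
  \<open>flat_fun\<close> thus makes the family closed under differentiation.\<close>

lemma flat_fun_has_derivative:
  "(flat_fun p has_real_derivative flat_fun ([:0, 0, 1:] * (p - pderiv p)) t) (at t)"
proof -
  consider "t > 0" | "t < 0" | "t = 0" by linarith
  then show ?thesis
  proof cases
    case 1
    have "((\<lambda>t. poly p (1 / t) * exp (- (1 / t))) has_real_derivative
        flat_fun ([:0, 0, 1:] * (p - pderiv p)) t) (at t)"
      using 1 by (auto intro!: derivative_eq_intros DERIV_chain2[OF poly_DERIV] 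
          simp: flat_fun_def field_simps power2_eq_square)
    moreover have "\<forall>\<^sub>F x in nhds t. poly p (1 / x) * exp (- (1 / x)) = flat_fun p x"
      using eventually_nhds_in_open[of "{0<..}" t] 1 by (auto elim!: eventually_mono simp: flat_fun_def)
    ultimately show ?thesis
      by (rule iffD1[OF DERIV_cong_ev[OF refl _ refl], rotated])
  next
    case 2
    have "((\<lambda>t. 0) has_real_derivative flat_fun ([:0, 0, 1:] * (p - pderiv p)) t) (at t)"
      using 2 by (simp add: flat_fun_def)
    moreover have "\<forall>\<^sub>F x in nhds t. 0 = flat_fun p x"
      using eventually_nhds_in_open[of "{..<0}" t] 2 by (auto elim!: eventually_mono simp: flat_fun_def)
    ultimately show ?thesis
      by (rule iffD1[OF DERIV_cong_ev[OF refl _ refl], rotated])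
  next
    case 3
    \<comment> \<open>The difference quotient at 0 divides by \<open>h\<close>, which in
      \<open>X = 1 / h\<close> is one more factor \<open>X\<close>, hence
      \<open>[:0, 1:]\<close>.\<close>
    have "((\<lambda>h. poly ([:0, 1:] * p) (inverse h) * exp (- inverse h)) \<longlongrightarrow> 0) (at_right 0)"
      using poly_times_exp_minus_tendsto_0 filterlim_inverse_at_top_right by (rule filterlim_compose)
    then have R: "((\<lambda>h. flat_fun p h / h) \<longlongrightarrow> 0) (at_right 0)"
      by (rule Lim_transform_eventually)
         (auto simp: eventually_at_right_field flat_fun_def field_simps intro!: exI[of _ 1])
    have L: "((\<lambda>h. flat_fun p h / h) \<longlongrightarrow> 0) (at_left 0)"
      by (rule Lim_transform_eventually[OF tendsto_const])
         (auto simp: eventually_at_left_field flat_fun_def intro!: exI[of _ "-1"])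
    have "((\<lambda>h. flat_fun p h / h) \<longlongrightarrow> 0) (at 0)"
      using L R by (simp add: filterlim_split_at)
    then show ?thesis
      using 3 by (simp add: has_field_derivative_iff flat_fun_def)
  qed
qed

text \<open>The product rule turns one product of flat functions into a sum of such products, so it
  is their linear span that is stable under differentiation. This makes smoothness of
  \<open>bump\<close> a single induction on the order.\<close>

inductive_set bump_span :: "real \<Rightarrow> real \<Rightarrow> real \<Rightarrow> (real \<Rightarrow> real) set" for k a b :: real where
  base: "(\<lambda>t. flat_fun p (k * (t - a)) * flat_fun q (k * (b - t))) \<in> bump_span k a b"
| add: "f \<in> bump_span k a b \<Longrightarrow> g \<in> bump_span k a b \<Longrightarrow> (\<lambda>t. f t + g t) \<in> bump_span k a b"
| scale: "f \<in> bump_span k a b \<Longrightarrow> (\<lambda>t. c * f t) \<in> bump_span k a b"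

lemma bump_span_has_derivative:
  assumes "f \<in> bump_span k a b"
  shows "\<exists>f'\<in>bump_span k a b. \<forall>t. (f has_real_derivative f' t) (at t)"
  using assms
proof induction
  case (base p q)
  let ?d = "\<lambda>p. [:0, 0, 1:] * (p - pderiv p)"
  let ?f = "\<lambda>t. k * (flat_fun (?d p) (k * (t - a)) * flat_fun q (k * (b - t))) +
     (- k) * (flat_fun p (k * (t - a)) * flat_fun (?d q) (k * (b - t)))"
  have "((\<lambda>t. flat_fun p (k * (t - a)) * flat_fun q (k * (b - t))) has_real_derivative ?f t) (at t)" for t
    by (rule derivative_eq_intros DERIV_chain2[OF flat_fun_has_derivative] refl)+ (simp add: algebra_simps)
  moreover have "?f \<in> bump_span k a b"
    by (intro bump_span.intros)
  ultimately show ?case by (intro bexI[of _ ?f]) auto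
next
  case (add f g)
  then obtain f' g' where "f' \<in> bump_span k a b" "g' \<in> bump_span k a b"
    "\<forall>t. (f has_real_derivative f' t) (at t)" "\<forall>t. (g has_real_derivative g' t) (at t)" by blast
  then show ?case
    by (intro bexI[of _ "\<lambda>t. f' t + g' t"]) (auto intro: DERIV_add bump_span.intros)
next
  case (scale f c)
  then obtain f' where "f' \<in> bump_span k a b" "\<forall>t. (f has_real_derivative f' t) (at t)" by blast
  then show ?case
    by (intro bexI[of _ "\<lambda>t. c * f' t"]) (auto intro: DERIV_cmult bump_span.intros)
qed

text \<open>Inside the interval this is \<open>exp\<close> of
  \<open>- 1 / (k * (t - a)) - 1 / (k * (b - t))\<close>. A larger \<open>k\<close> pushes the
  values towards 1 without moving the support.\<close>

definition bump :: "real \<Rightarrow> real \<Rightarrow> real \<Rightarrow> real \<Rightarrow> real" where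
  "bump k a b t = flat_fun 1 (k * (t - a)) * flat_fun 1 (k * (b - t))"

lemma bump_all_derivatives:
  "((deriv ^^ n) (bump k a b) has_real_derivative (deriv ^^ Suc n) (bump k a b) t) (at t)"
proof -
  have step: "(f has_real_derivative deriv f t) (at t) \<and> deriv f \<in> bump_span k a b"
    if "f \<in> bump_span k a b" for f t
  proof -
    obtain f' where f': "f' \<in> bump_span k a b" "\<forall>t. (f has_real_derivative f' t) (at t)"
      using bump_span_has_derivative \<open>f \<in> bump_span k a b\<close> by blast
    then have "deriv f = f'"
      by (auto intro: DERIV_imp_deriv)
    then show ?thesis using f' by simp
  qed
  have "(deriv ^^ n) (bump k a b) \<in> bump_span k a b" for n
  proof (induction n)
    case 0
    show ?case using bump_span.base[of 1 k a 1 b] by (simp add: bump_def[abs_def])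
  next
    case (Suc n)
    then show ?case using step by simp
  qed
  then show ?thesis using step by simp
qed

lemma bump_bounds: "0 \<le> bump k a b t" "bump k a b t \<le> 1"
  by (auto simp: bump_def flat_fun_def intro!: mult_le_one)

lemma bump_eq_0_iff: "k > 0 \<Longrightarrow> bump k a b t = 0 \<longleftrightarrow> \<not> (a < t \<and> t < b)"
  by (auto simp: bump_def flat_fun_def zero_less_mult_iff not_less)

lemma bump_tendsto_indicator:
  "(\<lambda>n. bump (real (Suc n)) a b t) \<longlonglongrightarrow> indicator {a<..<b} t"
proof (cases "a < t \<and> t < b")
  case True
  have *: "(\<lambda>n. exp (- (1 / (real (Suc n) * s)))) \<longlonglongrightarrow> 1" for s :: real
  proof -
    have "(\<lambda>n. exp (- (inverse (real (Suc n)) * inverse s))) \<longlonglongrightarrow> exp (- (0 * inverse s))"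
      by (intro tendsto_intros LIMSEQ_inverse_real_of_nat)
    then show ?thesis by (simp add: divide_simps)
  qed
  have "(\<lambda>n. exp (- (1 / (real (Suc n) * (t - a)))) * exp (- (1 / (real (Suc n) * (b - t))))) \<longlonglongrightarrow> 1 * 1"
    by (intro tendsto_mult *)
  then show ?thesis
    using True by (simp add: bump_def flat_fun_def del: of_nat_Suc)
next
  case False
  then have "bump (real (Suc n)) a b t = 0" for n
    by (subst bump_eq_0_iff) auto
  then show ?thesis using False by simp
qed

definition box_bump :: "real \<Rightarrow> 'a::euclidean_space \<Rightarrow> 'a \<Rightarrow> 'a \<Rightarrow> real" where
  "box_bump k a b x = (\<Prod>i\<in>Basis. bump k (a \<bullet> i) (b \<bullet> i) (x \<bullet> i))"

text \<open>Partial derivatives of a product of one-variable functions commute and act factor by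
  factor. The witness therefore differentiates factor \<open>i\<close> as often as \<open>i\<close>
  occurs in the list of directions, whatever the order.\<close>

lemma smooth_box_bump: "smooth (box_bump k a b)"
proof -
  define d where "d i n = (deriv ^^ n) (bump k (a \<bullet> i) (b \<bullet> i))" for i n
  have d: "(d i n has_real_derivative d i (Suc n) t) (at t)" for i n t
    unfolding d_def by (rule bump_all_derivatives)
  define D where "D bs x = (\<Prod>i\<in>Basis. d i (count_list bs i) (x \<bullet> i))" for bs :: "'a list" and x
  have "(D bs has_derivative (\<lambda>h. \<Sum>i\<in>Basis. (h \<bullet> i) * D (bs @ [i]) x)) (at x)" for bs x
  proof -
    have "((\<lambda>x. d i n (x \<bullet> i)) has_derivative (\<lambda>h. d i (Suc n) (x \<bullet> i) * (h \<bullet> i))) (at x)" for i n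
      using has_derivative_compose[OF has_derivative_inner_left[OF has_derivative_ident]
          d[unfolded has_field_derivative_def]] .
    then have "((\<lambda>x. \<Prod>i\<in>Basis. d i (count_list bs i) (x \<bullet> i)) has_derivative
       (\<lambda>h. \<Sum>i\<in>Basis. (d i (Suc (count_list bs i)) (x \<bullet> i) * (h \<bullet> i)) *
          (\<Prod>j\<in>Basis - {i}. d j (count_list bs j) (x \<bullet> j)))) (at x)"
      by (intro has_derivative_prod)
    moreover have "D (bs @ [i]) x = d i (Suc (count_list bs i)) (x \<bullet> i) *
          (\<Prod>j\<in>Basis - {i}. d j (count_list bs j) (x \<bullet> j))" if "i \<in> Basis" for i
      unfolding D_def using that
      by (subst prod.remove[of _ i]) (auto intro!: prod.cong split: if_split_asm)
    ultimately show ?thesis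
      unfolding D_def[abs_def] by (simp add: mult_ac cong: sum.cong)
  qed
  moreover have "D [] = box_bump k a b"
    by (auto simp: D_def box_bump_def d_def)
  ultimately show ?thesis
    unfolding smooth_def by blast
qed

lemma box_bump_nonzero: "k > 0 \<Longrightarrow> {x. box_bump k a b x \<noteq> 0} = box a b"
  by (auto simp: box_bump_def bump_eq_0_iff mem_box)

lemma box_bump_bounds: "0 \<le> box_bump k a b x" "box_bump k a b x \<le> 1"
  by (auto simp: box_bump_def intro!: prod_nonneg prod_le_1 bump_bounds)

lemma box_bump_test_function:
  assumes "cbox a b \<subseteq> \<Omega>" "k > 0"
  shows "box_bump k a b \<in> test_functions \<Omega>"
proof -
  have "closure (box a b) \<subseteq> cbox a b"
    by (intro closure_minimal box_subset_cbox closed_cbox)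
  then show ?thesis
    using assms by (auto simp: test_functions_def smooth_box_bump box_bump_nonzero bounded_box)
qed

lemma box_bump_tendsto_indicator: "(\<lambda>n. box_bump (real (Suc n)) a b x) \<longlonglongrightarrow> indicator (box a b) x"
proof -
  have "(\<lambda>n. box_bump (real (Suc n)) a b x) \<longlonglongrightarrow> (\<Prod>i\<in>Basis. indicator {a \<bullet> i<..<b \<bullet> i} (x \<bullet> i))"
    unfolding box_bump_def by (intro tendsto_prod bump_tendsto_indicator)
  also have "(\<Prod>i\<in>Basis. indicator {a \<bullet> i<..<b \<bullet> i} (x \<bullet> i)) = (indicator (box a b) x :: real)"
  proof (cases "x \<in> box a b")
    case True
    then show ?thesis by (auto simp: mem_box)
  next
    case False
    then obtain i where i: "i \<in> Basis" "\<not> (a \<bullet> i < x \<bullet> i \<and> x \<bullet> i < b \<bullet> i)" by (auto simp: mem_box)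
    then have "indicator {a \<bullet> i<..<b \<bullet> i} (x \<bullet> i) = (0::real)" by auto
    then have "(\<Prod>i\<in>Basis. indicator {a \<bullet> i<..<b \<bullet> i} (x \<bullet> i)) = (0::real)"
      using i(1) by (intro prod_zero) auto
    then show ?thesis using False by simp
  qed
  finally show ?thesis .
qed

section \<open>Essentially bounded functions\<close>

text \<open>The bridge from \<open>esssup\<close> to explicit almost-everywhere bounds, in which the
  estimates on bounded fields are carried out.\<close>

lemma Linf_norm_le_iff:
  assumes "y \<in> borel_measurable (lebesgue_on \<Omega>)"
  shows "Linf_norm \<Omega> y \<le> ereal c \<longleftrightarrow> (AE x in lebesgue_on \<Omega>. norm (y x) \<le> c)"
proof
  assume *: "Linf_norm \<Omega> y \<le> ereal c"
  have "AE x in lebesgue_on \<Omega>. ereal (norm (y x)) \<le> Linf_norm \<Omega> y"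
    unfolding Linf_norm_def by (rule esssup_AE)
  then show "AE x in lebesgue_on \<Omega>. norm (y x) \<le> c"
  proof eventually_elim
    case (elim x)
    then have "ereal (norm (y x)) \<le> ereal c" using * by (rule order_trans)
    then show ?case by simp
  qed
next
  assume "AE x in lebesgue_on \<Omega>. norm (y x) \<le> c"
  then show "Linf_norm \<Omega> y \<le> ereal c"
    unfolding Linf_norm_def using assms by (intro esssup_I) auto
qed

lemma Linf_iff:
  "y \<in> Linf \<Omega> \<longleftrightarrow> y \<in> borel_measurable (lebesgue_on \<Omega>) \<and> (\<exists>c. AE x in lebesgue_on \<Omega>. norm (y x) \<le> c)"
proof -
  have "(\<exists>c. AE x in lebesgue_on \<Omega>. norm (y x) \<le> c) \<longleftrightarrow> Linf_norm \<Omega> y < \<infinity>"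
    if y: "y \<in> borel_measurable (lebesgue_on \<Omega>)"
  proof -
    have "Linf_norm \<Omega> y < \<infinity> \<longleftrightarrow> (\<exists>c. Linf_norm \<Omega> y \<le> ereal c)"
      by (cases "Linf_norm \<Omega> y") auto
    then show ?thesis using Linf_norm_le_iff[OF y] by simp
  qed
  then show ?thesis unfolding Linf_def by blast
qed

lemma LinfI:
  "y \<in> borel_measurable (lebesgue_on \<Omega>) \<Longrightarrow> AE x in lebesgue_on \<Omega>. norm (y x) \<le> c \<Longrightarrow> y \<in> Linf \<Omega>"
  by (auto simp: Linf_iff)

lemma Linf_measurable: "y \<in> Linf \<Omega> \<Longrightarrow> y \<in> borel_measurable (lebesgue_on \<Omega>)"
  by (simp add: Linf_iff)

lemma LinfE:
  assumes "y \<in> Linf \<Omega>"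
  obtains c where "c \<ge> 0" "AE x in lebesgue_on \<Omega>. norm (y x) \<le> c"
proof -
  obtain c where c: "AE x in lebesgue_on \<Omega>. norm (y x) \<le> c"
    using assms by (auto simp: Linf_iff)
  then have "AE x in lebesgue_on \<Omega>. norm (y x) \<le> max c 0"
    by eventually_elim auto
  then show thesis by (intro that[of "max c 0"]) auto
qed

lemma Linf_add:
  assumes "y \<in> Linf \<Omega>" "z \<in> Linf \<Omega>"
  shows "(\<lambda>x. y x + z x) \<in> Linf \<Omega>"
proof -
  obtain c where c: "AE x in lebesgue_on \<Omega>. norm (y x) \<le> c"
    using assms(1) by (rule LinfE)
  obtain d where d: "AE x in lebesgue_on \<Omega>. norm (z x) \<le> d"
    using assms(2) by (rule LinfE)
  have "AE x in lebesgue_on \<Omega>. norm (y x + z x) \<le> c + d"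
    using c d by eventually_elim (rule norm_triangle_mono)
  then show ?thesis
    using assms by (auto intro!: LinfI borel_measurable_add dest: Linf_measurable)
qed

lemma Linf_scaleR_fun:
  assumes "h \<in> Linf \<Omega>" "y \<in> Linf \<Omega>"
  shows "(\<lambda>x. h x *\<^sub>R y x) \<in> Linf \<Omega>"
proof -
  obtain c where c: "c \<ge> 0" "AE x in lebesgue_on \<Omega>. norm (h x) \<le> c"
    using assms(1) by (rule LinfE)
  obtain d where d: "d \<ge> 0" "AE x in lebesgue_on \<Omega>. norm (y x) \<le> d"
    using assms(2) by (rule LinfE)
  have "AE x in lebesgue_on \<Omega>. norm (h x *\<^sub>R y x) \<le> c * d"
    using c(2) d(2) by eventually_elim (auto intro!: mult_mono c d)
  then show ?thesis
    using assms by (auto intro!: LinfI borel_measurable_scaleR dest: Linf_measurable)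
qed

lemma Linf_const [simp]: "(\<lambda>x. c) \<in> Linf \<Omega>"
  by (rule LinfI[where c = "norm c"]) auto

lemma Linf_scaleR: "y \<in> Linf \<Omega> \<Longrightarrow> (\<lambda>x. c *\<^sub>R y x) \<in> Linf \<Omega>"
  by (rule Linf_scaleR_fun) auto

lemma Linf_cmult: "y \<in> Linf \<Omega> \<Longrightarrow> (\<lambda>x. c * y x :: real) \<in> Linf \<Omega>"
  using Linf_scaleR[of y \<Omega> c] by simp

lemma Linf_diff: "y \<in> Linf \<Omega> \<Longrightarrow> z \<in> Linf \<Omega> \<Longrightarrow> (\<lambda>x. y x - z x) \<in> Linf \<Omega>"
  using Linf_add[of y \<Omega> "\<lambda>x. (-1) *\<^sub>R z x"] Linf_scaleR[of z \<Omega> "-1"] by simp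

lemma Linf_inner:
  assumes "y \<in> Linf \<Omega>" "z \<in> Linf \<Omega>"
  shows "(\<lambda>x. y x \<bullet> z x) \<in> Linf \<Omega>"
proof -
  obtain c where c: "c \<ge> 0" "AE x in lebesgue_on \<Omega>. norm (y x) \<le> c"
    using assms(1) by (rule LinfE)
  obtain d where d: "d \<ge> 0" "AE x in lebesgue_on \<Omega>. norm (z x) \<le> d"
    using assms(2) by (rule LinfE)
  have "AE x in lebesgue_on \<Omega>. norm (y x \<bullet> z x) \<le> c * d"
    using c(2) d(2)
  proof eventually_elim
    case (elim x)
    have "\<bar>y x \<bullet> z x\<bar> \<le> norm (y x) * norm (z x)" by (rule Cauchy_Schwarz_ineq2)
    also have "\<dots> \<le> c * d" using elim c(1) by (intro mult_mono) auto
    finally show ?case by simp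
  qed
  then show ?thesis
    using assms by (auto intro!: LinfI borel_measurable_inner dest: Linf_measurable)
qed

lemma Linf_indicator: "A \<in> sets (lebesgue_on \<Omega>) \<Longrightarrow> (indicator A :: 'a::euclidean_space \<Rightarrow> real) \<in> Linf \<Omega>"
  by (rule LinfI[where c = 1]) (auto simp: indicator_def)

lemma integrable_inner_Linf:
  assumes "integrable (lebesgue_on \<Omega>) y" "z \<in> Linf \<Omega>"
  shows "integrable (lebesgue_on \<Omega>) (\<lambda>x. y x \<bullet> z x)"
proof -
  obtain c where c: "c \<ge> 0" "AE x in lebesgue_on \<Omega>. norm (z x) \<le> c"
    using assms(2) by (rule LinfE)
  have "AE x in lebesgue_on \<Omega>. norm (y x \<bullet> z x) \<le> norm (c *\<^sub>R y x)"
    using c(2)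
  proof eventually_elim
    case (elim x)
    have "\<bar>y x \<bullet> z x\<bar> \<le> norm (y x) * norm (z x)" by (rule Cauchy_Schwarz_ineq2)
    also have "\<dots> \<le> norm (y x) * c" using elim by (intro mult_left_mono) auto
    finally show ?case using c(1) by (simp add: mult.commute)
  qed
  moreover have "(\<lambda>x. y x \<bullet> z x) \<in> borel_measurable (lebesgue_on \<Omega>)"
    using assms by (intro borel_measurable_inner) (auto simp: Linf_measurable)
  ultimately show ?thesis
    using assms(1) by (intro Bochner_Integration.integrable_bound[OF integrable_scaleR_right[of c, OF assms(1)]])
qed

text \<open>Boundedness makes \<open>M\<close> a finite measure, so bounded fields are integrable.
  Openness supplies balls and boxes for test functions, and together with nonemptiness it gives
  positive measure.\<close>

locale bounded_open =
  fixes \<Omega> :: "'a::euclidean_space set"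
  assumes open_dom: "open \<Omega>" and bounded_dom: "bounded \<Omega>" and nonempty_dom: "\<Omega> \<noteq> {}"
begin

abbreviation "M \<equiv> lebesgue_on \<Omega>"

lemma dom_lebesgue [simp, measurable]: "\<Omega> \<in> sets lebesgue"
  using open_dom by auto

lemma space_M [simp]: "space M = \<Omega>"
  by (simp add: space_restrict_space)

lemma sets_M: "A \<in> sets M \<longleftrightarrow> A \<in> sets lebesgue \<and> A \<subseteq> \<Omega>"
  by (auto simp: sets_restrict_space_iff)

lemma dom_sets [simp]: "\<Omega> \<in> sets M"
  by (simp add: sets_M)

sublocale finite_measure M
proof
  have "emeasure lebesgue \<Omega> < \<infinity>"
    using emeasure_bounded_finite[OF bounded_dom] open_dom by simp
  then show "emeasure M (space M) \<noteq> \<infinity>"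
    by (simp add: emeasure_restrict_space)
qed

lemma emeasure_dom_pos: "emeasure M \<Omega> > 0"
proof -
  obtain z r where "r > 0" "ball z r \<subseteq> \<Omega>"
    using open_dom nonempty_dom by (meson ex_in_conv open_contains_ball)
  then have "emeasure lebesgue (ball z r) \<le> emeasure lebesgue \<Omega>"
    by (intro emeasure_mono) auto
  moreover have "emeasure lebesgue (ball z r) \<noteq> 0"
    using content_ball_pos[OF \<open>r > 0\<close>, of z] by (auto simp: measure_def)
  ultimately have "emeasure lebesgue \<Omega> \<noteq> 0" by auto
  then show ?thesis by (simp add: emeasure_restrict_space zero_less_iff_neq_zero)
qed

lemma AE_const_iff: "(AE x in M. P) \<longleftrightarrow> P"
proof (cases P)
  case False
  then show ?thesis using emeasure_dom_pos by (simp add: AE_iff_measurable[OF dom_sets])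
qed simp

text \<open>On a null domain every bound would hold almost everywhere and the essential supremum
  would be minus infinity; positive measure excludes this.\<close>

lemma Linf_norm_nonneg: "0 \<le> Linf_norm \<Omega> y"
proof (rule ccontr)
  assume neg: "\<not> 0 \<le> Linf_norm \<Omega> y"
  have "AE x in M. ereal (norm (y x)) \<le> Linf_norm \<Omega> y"
    unfolding Linf_norm_def by (rule esssup_AE)
  then have "AE x in M. False"
  proof eventually_elim
    case (elim x)
    have "0 \<le> ereal (norm (y x))" by simp
    with elim neg show ?case using order_trans by blast
  qed
  then show False by (simp only: AE_const_iff)
qed

lemma integrable_Linf: "y \<in> Linf \<Omega> \<Longrightarrow> integrable M y"
  by (auto simp: Linf_iff intro: integrable_const_bound)

end


text \<open>Open boxes form an intersection-stable generator of the Borel sets, so Dynkin's argument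
  extends the vanishing of the integrals to all Borel sets. Uniqueness of densities then gives
  \<open>H = 0\<close>.\<close>

lemma AE_eq_0_if_box_integrals_eq_0:
  fixes H :: "'a::euclidean_space \<Rightarrow> real"
  assumes H: "integrable lborel H"
    and boxes: "\<And>a b. (LINT x|lborel. indicator (box a b) x * H x) = 0"
  shows "AE x in lborel. H x = 0"
proof -
  have intA: "integrable lborel (\<lambda>x. indicator A x * H x)" if "A \<in> sets borel" for A
    using integrable_mult_indicator[OF _ H, of A] that by simp
  define B where "B n = box (- (real n *\<^sub>R One)) (real n *\<^sub>R One :: 'a)" for n
  \<comment> \<open>The complement step of the Dynkin induction needs the integral over the whole
    space, obtained by exhausting it with boxes.\<close>
  have univ: "(LINT x|lborel. H x) = 0"
  proof -
    have "(\<lambda>n. LINT x|lborel. indicator (B n) x * H x) \<longlonglongrightarrow> (LINT x|lborel. H x)"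
    proof (rule integral_dominated_convergence[where w = "\<lambda>x. norm (H x)"])
      show "AE x in lborel. (\<lambda>n. indicator (B n) x * H x) \<longlonglongrightarrow> H x"
      proof (rule AE_I2)
        fix x :: 'a
        obtain N where N: "x \<in> B N"
          using UN_box_eq_UNIV[where 'a = 'a] unfolding B_def by blast
        have "\<forall>\<^sub>F n in sequentially. H x = indicator (B n) x * H x"
          using eventually_ge_at_top[of N]
        proof eventually_elim
          case (elim n)
          have "x \<in> B n"
            using N elim unfolding B_def mem_box
          proof safe
            fix i :: 'a assume i: "i \<in> Basis" and N: "\<forall>i\<in>Basis. - (real N *\<^sub>R One) \<bullet> i < x \<bullet> i \<and> x \<bullet> i < real N *\<^sub>R One \<bullet> i"
              and "N \<le> n"
            then have "real N \<le> real n" by simp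
            then show "- (real n *\<^sub>R One) \<bullet> i < x \<bullet> i" "x \<bullet> i < real n *\<^sub>R One \<bullet> i"
              using N i by fastforce+
          qed
          then show ?case by simp
        qed
        then show "(\<lambda>n. indicator (B n) x * H x) \<longlonglongrightarrow> H x"
          by (rule Lim_transform_eventually[OF tendsto_const])
      qed
      show "(\<lambda>x. indicator (B n) x * H x) \<in> borel_measurable lborel" for n
        using intA[of "B n"] by (simp add: B_def)
      show "AE x in lborel. norm (indicator (B n) x * H x) \<le> norm (H x)" for n
        by (simp add: indicator_def)
    qed (use H in auto)
    moreover have "(LINT x|lborel. indicator (B n) x * H x) = 0" for n
      unfolding B_def by (rule boxes)
    ultimately show ?thesis by (simp add: LIMSEQ_const_iff)
  qed
  have "(LINT x|lborel. indicator A x * H x) = 0" if "A \<in> sets borel" for A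
  proof -
    have "Int_stable (range (\<lambda>(a, b). box a b :: 'a set))"
      by (auto simp: Int_stable_def box_Int_box)
    moreover have "range (\<lambda>(a, b). box a b) \<subseteq> Pow (UNIV :: 'a set)" by simp
    moreover have "A \<in> sigma_sets UNIV (range (\<lambda>(a, b). box a b))"
      using that by (simp add: borel_eq_box)
    ultimately show ?thesis
    proof (induction rule: sigma_sets_induct_disjoint)
      case (basic A)
      then show ?case using boxes by auto
    next
      case empty
      then show ?case by simp
    next
      case (compl A)
      then have "A \<in> sets borel" by (simp add: borel_eq_box)
      have "(LINT x|lborel. indicator (UNIV - A) x * H x) = (LINT x|lborel. H x - indicator A x * H x)"
        by (intro Bochner_Integration.integral_cong) (auto simp: indicator_def)
      also have "\<dots> = 0"
        using compl univ H intA[OF \<open>A \<in> sets borel\<close>] by simp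
      finally show ?case .
    next
      case (union A)
      then have A: "A i \<in> sets borel" for i by (auto simp: borel_eq_box)
      have "(LINT x:(\<Union>i. A i)|lborel. H x) = (\<Sum>i. LINT x:(A i)|lborel. H x)"
      proof (rule lebesgue_integral_countable_add)
        show "A i \<inter> A j = {}" if "i \<noteq> j" for i j
          using union(1) that by (auto simp: disjoint_family_on_def)
        show "set_integrable lborel (\<Union>i. A i) H"
          unfolding set_integrable_def using H A by (intro integrable_mult_indicator) auto
      qed (use A in auto)
      then show ?case
        using union(3) by (simp add: set_lebesgue_integral_def)
    qed
  qed
  then show ?thesis
    using density_unique_real[of lborel H "\<lambda>x. 0"] H by (simp add: set_lebesgue_integral_def)
qed

section \<open>The fundamental lemma of the calculus of variations\<close>

context bounded_open
begin

text \<open>Bumps on a box converge boundedly to its indicator, so \<open>h\<close> integrates to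
  zero over every box whose closed box lies in the domain. The problem thereby becomes the one for
  boxes, one closed box at a time, and countably many closed boxes fill the domain.\<close>

lemma AE_eq_0_if_test_integrals_eq_0:
  fixes h :: "'a \<Rightarrow> real"
  assumes h: "h \<in> Linf \<Omega>" and test: "\<And>\<phi>. \<phi> \<in> test_functions \<Omega> \<Longrightarrow> (LINT x|M. h x * \<phi> x) = 0"
  shows "AE x in M. h x = 0"
proof -
  have box_zero: "(LINT x|M. h x * indicator (box a b) x) = 0" if "cbox a b \<subseteq> \<Omega>" for a b
  proof -
    have meas: "(\<lambda>x. box_bump k a b x) \<in> borel_measurable M" for k
    proof -
      obtain D where D: "D [] = box_bump k a b" "\<And>bs x. (D bs has_derivative (\<lambda>h. \<Sum>i\<in>Basis. (h \<bullet> i) * D (bs @ [i]) x)) (at x)"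
        using smooth_box_bump[of k a b] unfolding smooth_def by blast
      have "continuous_on UNIV (box_bump k a b)"
        using has_derivative_continuous[OF D(2)[of "[]"]] unfolding D(1)
        by (simp add: continuous_at_imp_continuous_on)
      then have "box_bump k a b \<in> borel_measurable lborel"
        by (simp add: borel_measurable_continuous_onI)
      then show ?thesis
        by (intro measurable_restrict_space1 measurable_completion)
    qed
    have "(\<lambda>n. LINT x|M. h x * box_bump (real (Suc n)) a b x) \<longlonglongrightarrow> (LINT x|M. h x * indicator (box a b) x)"
    proof (rule integral_dominated_convergence[where w = "\<lambda>x. norm (h x)"])
      show "AE x in M. (\<lambda>n. h x * box_bump (real (Suc n)) a b x) \<longlonglongrightarrow> h x * indicator (box a b) x"
        by (intro AE_I2 tendsto_mult tendsto_const box_bump_tendsto_indicator)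
      show "AE x in M. norm (h x * box_bump (real (Suc n)) a b x) \<le> norm (h x)" for n
        by (auto simp: abs_mult box_bump_bounds mult_left_le)
      show "(\<lambda>x. h x * indicator (box a b) x) \<in> borel_measurable M"
      proof (intro borel_measurable_times borel_measurable_indicator Linf_measurable h)
        have "box a b \<subseteq> \<Omega>" using that box_subset_cbox by blast
        then show "box a b \<in> sets M" by (simp add: sets_M)
      qed
      show "(\<lambda>x. h x * box_bump (real (Suc n)) a b x) \<in> borel_measurable M" for n
        by (intro borel_measurable_times Linf_measurable[OF h] meas)
      show "integrable M (\<lambda>x. norm (h x))"
        by (intro integrable_norm integrable_Linf h)
    qed
    moreover have "(LINT x|M. h x * box_bump (real (Suc n)) a b x) = 0" for n
      using that by (intro test box_bump_test_function) auto
    ultimately show ?thesis by (simp add: LIMSEQ_const_iff)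
  qed
  have box_AE: "AE x in lebesgue. x \<in> cbox a b \<longrightarrow> h x = 0" if ab: "cbox a b \<subseteq> \<Omega>" for a b
  proof -
    have sub: "box a b \<subseteq> \<Omega>" using ab box_subset_cbox by blast
    define H where "H x = indicator (box a b) x * h x" for x
    have H_eq: "H x = indicator \<Omega> x *\<^sub>R (indicator (box a b) x * h x)" for x
      using sub by (auto simp: H_def indicator_def)
    have "integrable M (\<lambda>x. indicator (box a b) x *\<^sub>R h x)"
      by (rule integrable_mult_indicator) (use sub h in \<open>auto simp: sets_M integrable_Linf\<close>)
    then have H: "integrable lebesgue H"
      unfolding H_eq[abs_def] by (subst (asm) integrable_restrict_space) (auto simp: )
    have int0: "(LINT x|lebesgue. indicator (box c d) x * H x) = 0" for c d
    proof -
      \<comment> \<open>An arbitrary box may leave the domain, where no bump is available; its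
        intersection with \<open>box a b\<close> is again a box and stays inside.\<close>
      define c' where "c' = (\<Sum>i\<in>Basis. max (c \<bullet> i) (a \<bullet> i) *\<^sub>R i)"
      define d' where "d' = (\<Sum>i\<in>Basis. min (d \<bullet> i) (b \<bullet> i) *\<^sub>R i)"
      have I: "box c d \<inter> box a b = box c' d'"
        unfolding c'_def d'_def by (rule box_Int_box)
      have "cbox c' d' \<subseteq> cbox a b"
        by (auto simp: c'_def d'_def mem_box)
      then have "cbox c' d' \<subseteq> \<Omega>" "box c' d' \<subseteq> \<Omega>"
        using ab box_subset_cbox by blast+
      moreover have "indicator (box c d) x * H x = indicator \<Omega> x *\<^sub>R (h x * indicator (box c' d') x)" for x
        using \<open>box c' d' \<subseteq> \<Omega>\<close> unfolding I[symmetric] H_def by (auto simp: indicator_def)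
      ultimately show ?thesis
        using box_zero[of c' d'] by (simp add: integral_restrict_space)
    qed
    \<comment> \<open>The box criterion lives on \<open>lborel\<close>, so the Lebesgue measurable
      \<open>H\<close> is replaced by a Borel version that agrees with it almost everywhere.\<close>
    obtain H' where H': "H' \<in> borel_measurable lborel" "AE x in lborel. H x = H' x"
      using completion_ex_borel_measurable_real[of H lborel] H by auto
    then have ae: "AE x in lebesgue. H x = H' x" by (intro AE_completion)
    have "integrable lebesgue H'"
    proof (rule integrable_cong_AE_imp[OF H])
      show "H' \<in> borel_measurable lebesgue" using H'(1) by (rule measurable_completion)
    qed (use ae in \<open>auto elim: eventually_mono\<close>)
    then have "integrable lborel H'" using H'(1) by (simp add: integrable_completion)
    moreover have "(LINT x|lborel. indicator (box c d) x * H' x) = 0" for c d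
    proof -
      have "(LINT x|lborel. indicator (box c d) x * H' x) = (LINT x|lebesgue. indicator (box c d) x * H' x)"
        using H'(1) by (intro integral_completion[symmetric] borel_measurable_times) auto
      also have "\<dots> = (LINT x|lebesgue. indicator (box c d) x * H x)"
      proof (rule integral_cong_AE)
        show "(\<lambda>x. indicator (box c d) x * H' x) \<in> borel_measurable lebesgue"
          using H'(1) by (intro measurable_completion borel_measurable_times) auto
        show "(\<lambda>x. indicator (box c d) x * H x) \<in> borel_measurable lebesgue"
          using borel_measurable_integrable[OF H] by (intro borel_measurable_times borel_measurable_indicator) auto
        show "AE x in lebesgue. indicator (box c d) x * H' x = indicator (box c d) x * H x"
          using ae by eventually_elim simp
      qed
      finally show ?thesis using int0 by simp
    qed
    ultimately have "AE x in lborel. H' x = 0" by (rule AE_eq_0_if_box_integrals_eq_0)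
    then have "AE x in lebesgue. H' x = 0" by (rule AE_completion)
    \<comment> \<open>The bumps only see the open box, while the countable cover below consists of
      closed ones. The faces between the two are null.\<close>
    moreover have "AE x in lebesgue. x \<notin> cbox a b - box a b"
      using negligible_frontier_interval[of a b] by (intro AE_not_in) (simp add: negligible_iff_null_sets)
    ultimately show ?thesis
      using ae by eventually_elim (auto simp: H_def)
  qed
  obtain \<D> where D: "countable \<D>" "\<D> \<subseteq> Pow \<Omega>" "\<And>X. X \<in> \<D> \<Longrightarrow> \<exists>a b. X = cbox a b" "\<Union>\<D> = \<Omega>"
    using open_countable_Union_open_cbox[OF open_dom] by blast
  have "AE x in lebesgue. \<forall>X\<in>\<D>. x \<in> X \<longrightarrow> h x = 0"
    using D(1)
  proof (subst AE_ball_countable, safe)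
    fix X assume "X \<in> \<D>"
    then obtain a b where "X = cbox a b" "X \<subseteq> \<Omega>" using D by blast
    then show "AE x in lebesgue. x \<in> X \<longrightarrow> h x = 0" using box_AE by blast
  qed
  then have "AE x in lebesgue. x \<in> \<Omega> \<longrightarrow> h x = 0"
    by eventually_elim (use D(4) in blast)
  then show ?thesis
    by (simp add: AE_restrict_space_iff)
qed

end

section \<open>Gradients, traces and the load functional\<close>

lemma surface_measure_mono: "A \<subseteq> B \<Longrightarrow> surface_measure A \<le> surface_measure B"
  unfolding surface_measure_def
  by (intro SUP_mono' INF_superset_mono) auto

lemma surface_measure_empty [simp]: "surface_measure ({} :: 'a::euclidean_space set) = 0"
proof -
  have "(INF U\<in>{U :: nat \<Rightarrow> 'a set. {} \<subseteq> (\<Union>i. U i) \<and> (\<forall>i. bounded (U i) \<and> diameter (U i) \<le> \<delta>)}.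
       \<Sum>i. hausdorff_gauge (U i)) \<le> 0" if "\<delta> > 0" for \<delta>
    by (rule INF_lower2[of "\<lambda>i. {}"]) (use that in \<open>auto simp: hausdorff_gauge_def\<close>)
  then show ?thesis
    unfolding surface_measure_def by (auto simp: le_zero_eq intro!: antisym SUP_least)
qed

text \<open>Serves to interleave two sequences into one: two covers for the surface measure here,
  two partitions for the total variation later.\<close>

lemma suminf_even_odd:
  fixes a :: "nat \<Rightarrow> ennreal"
  shows "(\<Sum>i. a i) = (\<Sum>i. a (2 * i)) + (\<Sum>i. a (2 * i + 1))"
proof -
  have even_odd: "(\<Sum>i<2 * n. a i) = (\<Sum>i<n. a (2 * i) + a (2 * i + 1))" for n
    by (induction n) (auto simp: algebra_simps)
  have "(\<Sum>i. a i) = (\<Sum>i. a (2 * i) + a (2 * i + 1))"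
  proof (rule antisym)
    have "(\<Sum>i<n. a i) \<le> (\<Sum>i. a (2 * i) + a (2 * i + 1))" for n
    proof -
      have "(\<Sum>i<n. a i) \<le> (\<Sum>i<2 * n. a i)" by (intro sum_mono2) auto
      also have "\<dots> \<le> (\<Sum>i. a (2 * i) + a (2 * i + 1))"
        unfolding even_odd by (intro sum_le_suminf) auto
      finally show ?thesis .
    qed
    then show "(\<Sum>i. a i) \<le> (\<Sum>i. a (2 * i) + a (2 * i + 1))"
      by (subst suminf_eq_SUP) (rule SUP_least)
    have "(\<Sum>i<n. a (2 * i) + a (2 * i + 1)) \<le> (\<Sum>i. a i)" for n
      unfolding even_odd[symmetric] by (intro sum_le_suminf) auto
    then show "(\<Sum>i. a (2 * i) + a (2 * i + 1)) \<le> (\<Sum>i. a i)"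
      by (subst suminf_eq_SUP) (rule SUP_least)
  qed
  then show ?thesis by (simp add: suminf_add)
qed

text \<open>At each scale \<open>\<delta>\<close>, covers of \<open>A\<close> and \<open>B\<close>
  of total gauge below \<open>e / 2\<close> are interleaved at even and odd indices into one cover
  of the union.\<close>

lemma surface_measure_Un_null:
  fixes A B :: "'a::euclidean_space set"
  assumes "surface_measure A = 0" "surface_measure B = 0"
  shows "surface_measure (A \<union> B) = 0"
proof -
  define covers where "covers \<delta> A = {U :: nat \<Rightarrow> 'a set. A \<subseteq> (\<Union>i. U i) \<and> (\<forall>i. bounded (U i) \<and> diameter (U i) \<le> \<delta>)}"
    for \<delta> A
  have covers: "\<exists>U\<in>covers \<delta> A. (\<Sum>i. hausdorff_gauge (U i)) < e"
    if "surface_measure A = 0" "\<delta> > 0" "e > 0" for \<delta> e and A :: "'a set"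
  proof -
    have "(INF U\<in>covers \<delta> A. \<Sum>i. hausdorff_gauge (U i)) \<le> surface_measure A"
      unfolding surface_measure_def covers_def using \<open>\<delta> > 0\<close> by (intro SUP_upper) auto
    then have "(INF U\<in>covers \<delta> A. \<Sum>i. hausdorff_gauge (U i)) < e"
      using that by simp
    then show ?thesis by (simp add: INF_less_iff)
  qed
  have "(INF U\<in>covers \<delta> (A \<union> B). \<Sum>i. hausdorff_gauge (U i)) \<le> 0" if "\<delta> > 0" for \<delta>
  proof (rule ennreal_le_epsilon)
    fix e :: real assume "e > 0"
    then have "ennreal (e / 2) > 0" by simp
    obtain U where U: "U \<in> covers \<delta> A" "(\<Sum>i. hausdorff_gauge (U i)) < ennreal (e / 2)"
      using covers[OF assms(1) \<open>\<delta> > 0\<close> \<open>ennreal (e / 2) > 0\<close>] by blast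
    obtain V where V: "V \<in> covers \<delta> B" "(\<Sum>i. hausdorff_gauge (V i)) < ennreal (e / 2)"
      using covers[OF assms(2) \<open>\<delta> > 0\<close> \<open>ennreal (e / 2) > 0\<close>] by blast
    define W where "W i = (if even i then U (i div 2) else V (i div 2))" for i
    have "U i = W (2 * i)" "V i = W (2 * i + 1)" for i by (auto simp: W_def)
    then have "(\<Union>i. U i) \<union> (\<Union>i. V i) \<subseteq> (\<Union>i. W i)" by blast
    moreover have "bounded (W i) \<and> diameter (W i) \<le> \<delta>" for i
      using U(1) V(1) by (simp add: covers_def W_def)
    ultimately have W: "W \<in> covers \<delta> (A \<union> B)"
      using U(1) V(1) unfolding covers_def by blast
    have "(\<Sum>i. hausdorff_gauge (W i)) = (\<Sum>i. hausdorff_gauge (U i)) + (\<Sum>i. hausdorff_gauge (V i))"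
      by (subst suminf_even_odd) (simp add: W_def)
    also have "\<dots> \<le> ennreal (e / 2) + ennreal (e / 2)"
      using U(2) V(2) by (intro add_mono) auto
    also have "\<dots> = 0 + ennreal e"
      using \<open>e > 0\<close> by (simp flip: ennreal_plus)
    finally show "(INF U\<in>covers \<delta> (A \<union> B). \<Sum>i. hausdorff_gauge (U i)) \<le> 0 + ennreal e"
      by (rule INF_lower2[OF W])
  qed
  then show ?thesis
    unfolding surface_measure_def covers_def by (auto simp: le_zero_eq intro!: antisym SUP_least)
qed

lemma surface_AE_I: "(\<And>x. x \<in> \<Gamma> \<Longrightarrow> P x) \<Longrightarrow> surface_AE \<Gamma> P"
proof -
  assume "\<And>x. x \<in> \<Gamma> \<Longrightarrow> P x"
  then have "{x \<in> \<Gamma>. \<not> P x} = {}" by auto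
  then show ?thesis unfolding surface_AE_def by (simp only: surface_measure_empty)
qed

text \<open>\<open>surface_AE\<close> comes from an outer measure rather than from an
  almost-everywhere filter, so combining two such statements rests on the union of two null sets
  being null.\<close>

lemma surface_AE_mp2:
  assumes "surface_AE \<Gamma> P" "surface_AE \<Gamma> Q" "\<And>x. x \<in> \<Gamma> \<Longrightarrow> P x \<Longrightarrow> Q x \<Longrightarrow> R x"
  shows "surface_AE \<Gamma> R"
proof -
  have "surface_measure {x \<in> \<Gamma>. \<not> R x} \<le> surface_measure ({x \<in> \<Gamma>. \<not> P x} \<union> {x \<in> \<Gamma>. \<not> Q x})"
    using assms(3) by (intro surface_measure_mono) auto
  also have "\<dots> = 0"
    using assms(1,2) unfolding surface_AE_def by (rule surface_measure_Un_null)
  finally show ?thesis by (simp add: surface_AE_def)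
qed

lemma smooth_derivative:
  assumes "smooth \<phi>" "b \<in> Basis"
  shows "continuous_on UNIV \<phi>" "continuous_on UNIV (\<lambda>x. frechet_derivative \<phi> (at x) b)"
proof -
  obtain D where D: "D [] = \<phi>" "\<And>bs x. (D bs has_derivative (\<lambda>h. \<Sum>i\<in>Basis. (h \<bullet> i) * D (bs @ [i]) x)) (at x)"
    using assms(1) unfolding smooth_def by blast
  have cont: "continuous_on UNIV (D bs)" for bs
    using has_derivative_continuous[OF D(2)[of bs]] by (simp add: continuous_at_imp_continuous_on)
  then show "continuous_on UNIV \<phi>" using D(1) by metis
  have "frechet_derivative \<phi> (at x) b = D [b] x" for x
  proof -
    have "frechet_derivative \<phi> (at x) = (\<lambda>h. \<Sum>i\<in>Basis. (h \<bullet> i) * D ([] @ [i]) x)"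
      using frechet_derivative_at[OF D(2)[of "[]" x]] by (simp add: D(1))
    then have "frechet_derivative \<phi> (at x) b = (\<Sum>i\<in>Basis. (b \<bullet> i) * D [i] x)" by simp
    also have "\<dots> = (\<Sum>i\<in>Basis. if b = i then D [i] x else 0)"
      by (rule sum.cong) (use assms(2) in \<open>auto simp: inner_Basis\<close>)
    finally show ?thesis using assms(2) by simp
  qed
  then show "continuous_on UNIV (\<lambda>x. frechet_derivative \<phi> (at x) b)"
    using cont[of "[b]"] by simp
qed

lemma open_not_null:
  fixes S :: "'a::euclidean_space set"
  assumes "open S" "S \<in> null_sets lebesgue"
  shows "S = {}"
proof (rule ccontr)
  assume "S \<noteq> {}"
  then obtain z r where "r > 0" "ball z r \<subseteq> S"
    using assms(1) by (meson ex_in_conv open_contains_ball)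
  then have "emeasure lebesgue (ball z r) \<le> emeasure lebesgue S"
    using assms(1) by (intro emeasure_mono) auto
  then have "emeasure lebesgue (ball z r) = 0" using assms(2) by (auto simp: null_sets_def)
  then show False using content_ball_pos[OF \<open>r > 0\<close>, of z] by (auto simp: measure_def)
qed

section \<open>Uniqueness and linearity of gradients, traces and the load\<close>

context bounded_open
begin

lemma continuous_Linf:
  fixes h :: "'a \<Rightarrow> real"
  assumes "continuous_on UNIV h"
  shows "h \<in> Linf \<Omega>"
proof -
  have "compact (h ` closure \<Omega>)"
    using bounded_dom assms by (intro compact_continuous_image) (auto intro: continuous_on_subset)
  then have "bounded (h ` closure \<Omega>)" by (rule compact_imp_bounded)
  then obtain c where "\<forall>y\<in>h ` closure \<Omega>. norm y \<le> c"
    unfolding bounded_iff by blast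
  then have "\<And>x. x \<in> \<Omega> \<Longrightarrow> norm (h x) \<le> c" using closure_subset by blast
  moreover have "h \<in> borel_measurable M"
    using assms by (intro measurable_restrict_space1 measurable_completion) (simp add: borel_measurable_continuous_onI)
  ultimately show ?thesis by (intro LinfI[of _ _ c]) auto
qed

lemma test_function_Linf: "\<phi> \<in> test_functions \<Omega> \<Longrightarrow> \<phi> \<in> Linf \<Omega>"
  using smooth_derivative(1)[OF _ SOME_Basis] by (auto simp: test_functions_def intro!: continuous_Linf)

lemma test_function_derivative_Linf:
  "\<phi> \<in> test_functions \<Omega> \<Longrightarrow> b \<in> Basis \<Longrightarrow> (\<lambda>x. frechet_derivative \<phi> (at x) b) \<in> Linf \<Omega>"
  using smooth_derivative(2) by (auto simp: test_functions_def intro!: continuous_Linf)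

lemma Linf_mult:
  fixes y z :: "'a \<Rightarrow> real"
  shows "y \<in> Linf \<Omega> \<Longrightarrow> z \<in> Linf \<Omega> \<Longrightarrow> (\<lambda>x. y x * z x) \<in> Linf \<Omega>"
  using Linf_inner[of y \<Omega> z] by simp

lemma AE_eq_if_components:
  fixes G H :: "'a \<Rightarrow> 'a"
  assumes "\<And>b. b \<in> Basis \<Longrightarrow> AE x in M. (G x - H x) \<bullet> b = 0"
  shows "AE x in M. G x = H x"
proof -
  have "AE x in M. \<forall>b\<in>Basis. (G x - H x) \<bullet> b = 0"
    by (intro AE_finite_allI) (use assms in auto)
  then show ?thesis
    by eventually_elim (metis euclidean_all_zero_iff right_minus_eq)
qed

text \<open>\<open>grad\<close> is an arbitrary choice among weak gradients; this makes the choice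
  immaterial up to null sets. Componentwise, the difference of two weak gradients annihilates all
  test functions.\<close>

lemma weak_gradient_unique:
  assumes G: "G \<in> Linf \<Omega>" "weak_gradient \<Omega> v G" and H: "H \<in> Linf \<Omega>" "weak_gradient \<Omega> v H"
  shows "AE x in M. G x = H x"
proof (rule AE_eq_if_components, rule AE_eq_0_if_test_integrals_eq_0)
  fix b :: 'a assume b: "b \<in> Basis"
  show "(\<lambda>x. (G x - H x) \<bullet> b) \<in> Linf \<Omega>"
    using G H by (intro Linf_inner Linf_diff) auto
  fix \<phi> assume phi: "\<phi> \<in> test_functions \<Omega>"
  have int: "integrable M (\<lambda>x. (G x \<bullet> b) * \<phi> x)" "integrable M (\<lambda>x. (H x \<bullet> b) * \<phi> x)"
    using G H test_function_Linf[OF phi] by (auto intro!: integrable_Linf Linf_mult Linf_inner)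
  have "(LINT x|M. ((G x - H x) \<bullet> b) * \<phi> x) = (LINT x|M. (G x \<bullet> b) * \<phi> x - (H x \<bullet> b) * \<phi> x)"
    by (simp add: inner_diff_left left_diff_distrib)
  also have "\<dots> = (LINT x|M. (G x \<bullet> b) * \<phi> x) - (LINT x|M. (H x \<bullet> b) * \<phi> x)"
    using int by (rule Bochner_Integration.integral_diff)
  also have "\<dots> = 0"
    using G(2) H(2) phi b by (simp add: weak_gradient_def)
  finally show "(LINT x|M. ((G x - H x) \<bullet> b) * \<phi> x) = 0" .
qed

lemma weak_gradient_lincomb:
  assumes v: "v \<in> Linf \<Omega>" "G \<in> Linf \<Omega>" "weak_gradient \<Omega> v G"
    and w: "w \<in> Linf \<Omega>" "H \<in> Linf \<Omega>" "weak_gradient \<Omega> w H"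
  shows "weak_gradient \<Omega> (\<lambda>x. v x + c * w x) (\<lambda>x. G x + c *\<^sub>R H x)"
  unfolding weak_gradient_def
proof (intro ballI)
  fix \<phi> and b :: 'a assume phi: "\<phi> \<in> test_functions \<Omega>" and b: "b \<in> Basis"
  let ?d = "\<lambda>x. frechet_derivative \<phi> (at x) b"
  note phi' = test_function_Linf[OF phi] test_function_derivative_Linf[OF phi b]
  have int: "integrable M (\<lambda>x. v x * ?d x)" "integrable M (\<lambda>x. w x * ?d x)"
    "integrable M (\<lambda>x. (G x \<bullet> b) * \<phi> x)" "integrable M (\<lambda>x. (H x \<bullet> b) * \<phi> x)"
    using v w phi' by (auto intro!: integrable_Linf Linf_mult Linf_inner)
  have "(LINT x|M. (v x + c * w x) * ?d x) = (LINT x|M. v x * ?d x + c * (w x * ?d x))"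
    by (simp add: algebra_simps)
  also have "\<dots> = (LINT x|M. v x * ?d x) + c * (LINT x|M. w x * ?d x)"
    using int by simp
  also have "\<dots> = - ((LINT x|M. (G x \<bullet> b) * \<phi> x) + c * (LINT x|M. (H x \<bullet> b) * \<phi> x))"
    using v(3) w(3) phi b by (simp add: weak_gradient_def)
  also have "(LINT x|M. (G x \<bullet> b) * \<phi> x) + c * (LINT x|M. (H x \<bullet> b) * \<phi> x) =
      (LINT x|M. (G x \<bullet> b) * \<phi> x + c * ((H x \<bullet> b) * \<phi> x))"
    using int by simp
  also have "\<dots> = (LINT x|M. ((G x + c *\<^sub>R H x) \<bullet> b) * \<phi> x)"
    by (simp add: inner_add_left algebra_simps)
  finally show "(LINT x|M. (v x + c * w x) * ?d x) = - (LINT x|M. ((G x + c *\<^sub>R H x) \<bullet> b) * \<phi> x)" .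
qed

lemma W1inf_grad:
  assumes "v \<in> W1inf \<Omega>"
  shows "v \<in> Linf \<Omega>" "grad \<Omega> v \<in> Linf \<Omega>" "weak_gradient \<Omega> v (grad \<Omega> v)"
proof -
  have "\<exists>G. G \<in> Linf \<Omega> \<and> weak_gradient \<Omega> v G"
    using assms by (auto simp: W1inf_def)
  from someI_ex[OF this] show "grad \<Omega> v \<in> Linf \<Omega>" "weak_gradient \<Omega> v (grad \<Omega> v)"
    unfolding grad_def by auto
  show "v \<in> Linf \<Omega>" using assms by (simp add: W1inf_def)
qed

lemma W1infI:
  assumes "v \<in> Linf \<Omega>" "G \<in> Linf \<Omega>" "weak_gradient \<Omega> v G"
  shows "v \<in> W1inf \<Omega>" "AE x in M. grad \<Omega> v x = G x"
proof -
  show v: "v \<in> W1inf \<Omega>" using assms by (auto simp: W1inf_def)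
  show "AE x in M. grad \<Omega> v x = G x"
    using weak_gradient_unique[OF W1inf_grad(2,3)[OF v] assms(2,3)] .
qed

lemma W1inf_lincomb:
  assumes "v \<in> W1inf \<Omega>" "w \<in> W1inf \<Omega>"
  shows "(\<lambda>x. v x + c * w x) \<in> W1inf \<Omega>"
    "AE x in M. grad \<Omega> (\<lambda>x. v x + c * w x) x = grad \<Omega> v x + c *\<^sub>R grad \<Omega> w x"
proof -
  note v = W1inf_grad[OF assms(1)] and w = W1inf_grad[OF assms(2)]
  note * = Linf_add[OF v(1) Linf_cmult[OF w(1)]] Linf_add[OF v(2) Linf_scaleR[OF w(2)]] weak_gradient_lincomb[OF v w]
  show "(\<lambda>x. v x + c * w x) \<in> W1inf \<Omega>"
    "AE x in M. grad \<Omega> (\<lambda>x. v x + c * w x) x = grad \<Omega> v x + c *\<^sub>R grad \<Omega> w x"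
    using W1infI[OF *] by blast+
qed

lemma W1inf_zero: "(\<lambda>x. 0) \<in> W1inf \<Omega>" "AE x in M. grad \<Omega> (\<lambda>x. 0) x = 0"
  using W1infI[of "\<lambda>x. 0" "\<lambda>x. 0"] by (simp_all add: weak_gradient_def)

text \<open>In the domain, the set where two continuous representatives differ is both open and
  null, hence empty, and continuity carries the equality to the closure. Boundary values are
  therefore independent of the choice made in \<open>trace\<close>.\<close>

lemma continuous_rep_unique:
  assumes V: "continuous_rep \<Omega> v V" and W: "continuous_rep \<Omega> v W" and x: "x \<in> closure \<Omega>"
  shows "V x = W x"
proof -
  have cont: "continuous_on (closure \<Omega>) (\<lambda>x. V x - W x)"
    using V W by (auto simp: continuous_rep_def intro!: continuous_intros)
  have "AE x in M. V x - W x = 0"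
    using V[unfolded continuous_rep_def, THEN conjunct2] W[unfolded continuous_rep_def, THEN conjunct2]
    by eventually_elim simp
  define S where "S = \<Omega> \<inter> (\<lambda>x. V x - W x) -` (- {0})"
  have "open S"
    unfolding S_def
    using continuous_open_preimage[OF continuous_on_subset[OF cont closure_subset] open_dom, of "- {0}"]
    by (simp add: open_Compl)
  moreover have "S \<in> null_sets lebesgue"
  proof -
    have "AE x in lebesgue. x \<notin> S"
      using \<open>AE x in M. V x - W x = 0\<close> by (auto simp: AE_restrict_space_iff S_def elim: eventually_mono)
    then show ?thesis using \<open>open S\<close> by (subst (asm) AE_iff_null_sets[symmetric]) auto
  qed
  ultimately have "S = {}" by (rule open_not_null)
  then have "\<And>y. y \<in> \<Omega> \<Longrightarrow> V y - W y = 0" by (auto simp: S_def)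
  then have "V x - W x = 0"
    using continuous_constant_on_closure[OF cont] x by blast
  then show ?thesis by simp
qed

lemma continuous_rep_lincomb:
  "continuous_rep \<Omega> v V \<Longrightarrow> continuous_rep \<Omega> w W \<Longrightarrow>
    continuous_rep \<Omega> (\<lambda>x. v x + c * w x) (\<lambda>x. V x + c * W x)"
  unfolding continuous_rep_def by (auto intro!: continuous_intros)

lemma trace_eq_on_lincomb:
  assumes "trace_eq_on \<Omega> \<Gamma> v a" "trace_eq_on \<Omega> \<Gamma> w b"
  shows "trace_eq_on \<Omega> \<Gamma> (\<lambda>x. v x + c * w x) (\<lambda>x. a x + c * b x)"
proof -
  obtain V W where V: "continuous_rep \<Omega> v V" "surface_AE \<Gamma> (\<lambda>x. V x = a x)"
    and W: "continuous_rep \<Omega> w W" "surface_AE \<Gamma> (\<lambda>x. W x = b x)"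
    using assms by (auto simp: trace_eq_on_def)
  have "surface_AE \<Gamma> (\<lambda>x. V x + c * W x = a x + c * b x)"
    by (rule surface_AE_mp2[OF V(2) W(2)]) simp
  then show ?thesis
    using continuous_rep_lincomb[OF V(1) W(1)] unfolding trace_eq_on_def by blast
qed

text \<open>A boundary condition contains the existence of a continuous representative, which is
  what gives the choice in \<open>trace\<close> its meaning. This is why functions travel together
  with a boundary condition in \<open>load_lincomb\<close>.\<close>

lemma continuous_rep_trace: "trace_eq_on \<Omega> \<Gamma> v a \<Longrightarrow> continuous_rep \<Omega> v (trace \<Omega> v)"
  unfolding trace_def trace_eq_on_def by (metis someI_ex)

lemma trace_eq_on_trace: "continuous_rep \<Omega> v (trace \<Omega> v) \<Longrightarrow> trace_eq_on \<Omega> \<Gamma> v (trace \<Omega> v)"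
  unfolding trace_eq_on_def by (auto intro: surface_AE_I)

text \<open>The zero function is a lift of such a \<open>d\<close>, so its quotient norm is 0, and
  boundedness of \<open>g\<close> does the rest.\<close>

lemma bdry_functional_eq_0:
  assumes g: "g \<in> W1inf_bdry_dual \<Omega> \<Gamma>" and d: "\<And>x. x \<in> \<Gamma> \<Longrightarrow> d x = 0"
  shows "d \<in> W1inf_bdry \<Omega> \<Gamma>" "g d = 0"
proof -
  have tr: "trace_eq_on \<Omega> \<Gamma> (\<lambda>x. 0) d"
    unfolding trace_eq_on_def continuous_rep_def using d
    by (intro exI[of _ "\<lambda>x. 0"]) (auto intro: surface_AE_I)
  then show "d \<in> W1inf_bdry \<Omega> \<Gamma>"
    using W1inf_zero(1) by (auto simp: W1inf_bdry_def)
  have "Linf_norm \<Omega> (\<lambda>x::'a. 0::real) \<le> ereal 0"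
    by (subst Linf_norm_le_iff) auto
  moreover have "Linf_norm \<Omega> (grad \<Omega> (\<lambda>x. 0)) \<le> ereal 0"
    using W1inf_zero by (subst Linf_norm_le_iff) (auto simp: W1inf_grad Linf_measurable)
  ultimately have "W1inf_norm \<Omega> (\<lambda>x. 0) \<le> 0"
    using add_mono[of "Linf_norm \<Omega> (\<lambda>x::'a. 0::real)" "ereal 0" "Linf_norm \<Omega> (grad \<Omega> (\<lambda>x. 0))" "ereal 0"]
    by (simp add: W1inf_norm_def zero_ereal_def)
  then have "W1inf_bdry_norm \<Omega> \<Gamma> d \<le> 0"
    unfolding W1inf_bdry_norm_def using W1inf_zero(1) tr by (intro INF_lower2[of "\<lambda>x. 0"]) auto
  moreover have "0 \<le> W1inf_bdry_norm \<Omega> \<Gamma> d"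
    unfolding W1inf_bdry_norm_def W1inf_norm_def by (intro INF_greatest add_nonneg_nonneg Linf_norm_nonneg)
  ultimately have "W1inf_bdry_norm \<Omega> \<Gamma> d = 0" by (rule antisym)
  moreover obtain C where "\<forall>w\<in>W1inf_bdry \<Omega> \<Gamma>. ereal \<bar>g w\<bar> \<le> ereal C * W1inf_bdry_norm \<Omega> \<Gamma> w"
    using g by (auto simp: W1inf_bdry_dual_def)
  ultimately have "ereal \<bar>g d\<bar> \<le> 0"
    using \<open>d \<in> W1inf_bdry \<Omega> \<Gamma>\<close> by (force dest!: bspec)
  then show "g d = 0" by simp
qed

text \<open>The trace of a combination is chosen independently of the traces of its terms. Their
  discrepancy \<open>d\<close> vanishes on the closure of the domain, in particular on
  \<open>\<Gamma>\<close>, and is therefore annihilated by \<open>g\<close>.\<close>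

lemma load_lincomb:
  assumes g: "g \<in> W1inf_bdry_dual \<Omega> \<Gamma>" and \<Gamma>: "\<Gamma> \<subseteq> closure \<Omega>" and f: "integrable M f"
    and v: "v \<in> W1inf \<Omega>" "trace_eq_on \<Omega> \<Gamma>1 v a" and w: "w \<in> W1inf \<Omega>" "trace_eq_on \<Omega> \<Gamma>2 w b"
  shows "load \<Omega> f g (\<lambda>x. v x + c * w x) = load \<Omega> f g v + c * load \<Omega> f g w"
proof -
  let ?v = "trace \<Omega> v" and ?w = "trace \<Omega> w" and ?t = "trace \<Omega> (\<lambda>x. v x + c * w x)"
  have V: "continuous_rep \<Omega> v ?v" and W: "continuous_rep \<Omega> w ?w"
    using v w by (auto intro: continuous_rep_trace)
  have VW: "continuous_rep \<Omega> (\<lambda>x. v x + c * w x) (\<lambda>x. ?v x + c * ?w x)"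
    using V W by (rule continuous_rep_lincomb)
  have T: "continuous_rep \<Omega> (\<lambda>x. v x + c * w x) ?t"
    using someI[of "continuous_rep \<Omega> (\<lambda>x. v x + c * w x)", OF VW] by (simp add: trace_def)
  define d where "d x = ?t x - (?v x + c * ?w x)" for x
  have "d x = 0" if "x \<in> \<Gamma>" for x
    using continuous_rep_unique[OF T VW, of x] \<Gamma> that by (auto simp: d_def)
  then have d: "d \<in> W1inf_bdry \<Omega> \<Gamma>" "g d = 0"
    using bdry_functional_eq_0[OF g] by auto
  have zero: "trace_eq_on \<Omega> \<Gamma> (\<lambda>x. 0) (\<lambda>x. 0)"
    unfolding trace_eq_on_def continuous_rep_def by (intro exI[of _ "\<lambda>x. 0"]) (auto intro: surface_AE_I)
  note tv = trace_eq_on_trace[OF V, of \<Gamma>] and tw = trace_eq_on_trace[OF W, of \<Gamma>]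
  have bdry: "?v \<in> W1inf_bdry \<Omega> \<Gamma>" "?w \<in> W1inf_bdry \<Omega> \<Gamma>"
    using v(1) w(1) tv tw unfolding W1inf_bdry_def by blast+
  have bdry2: "(\<lambda>x. ?v x + c * ?w x) \<in> W1inf_bdry \<Omega> \<Gamma>"
    using W1inf_lincomb(1)[OF v(1) w(1), of c] trace_eq_on_lincomb[OF tv tw, of c]
    unfolding W1inf_bdry_def by blast
  have bdry3: "(\<lambda>x. c * ?w x) \<in> W1inf_bdry \<Omega> \<Gamma>"
    using W1inf_lincomb(1)[OF W1inf_zero(1) w(1), of c] trace_eq_on_lincomb[OF zero tw, of c]
    unfolding W1inf_bdry_def by auto
  have "g ?t = g (\<lambda>x. (?v x + c * ?w x) + d x)"
    by (simp add: d_def)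
  also have "\<dots> = g ?v + c * g ?w"
    using g bdry bdry2 bdry3 d unfolding W1inf_bdry_dual_def by simp
  finally have gt: "g ?t = g ?v + c * g ?w" .
  have int: "integrable M (\<lambda>x. f x * v x)" "integrable M (\<lambda>x. f x * w x)"
    using integrable_inner_Linf[OF f W1inf_grad(1)[OF v(1)]] integrable_inner_Linf[OF f W1inf_grad(1)[OF w(1)]] by simp_all
  have "(LINT x|M. f x * (v x + c * w x)) = (LINT x|M. f x * v x + c * (f x * w x))"
    by (simp add: algebra_simps)
  also have "\<dots> = (LINT x|M. f x * v x) + c * (LINT x|M. f x * w x)"
    using int by simp
  finally show ?thesis
    unfolding load_def gt by (simp add: algebra_simps)
qed

end

section \<open>Integration against finitely additive measures\<close>

text \<open>A bounded linear functional with some admissible constant \<open>C\<close>, not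
  necessarily its norm. Using almost-everywhere bounds builds in invariance under changes on null
  sets, by taking \<open>c = 0\<close>.\<close>

definition Linf_functional :: "'a::euclidean_space set \<Rightarrow> (('a \<Rightarrow> 'a) \<Rightarrow> real) \<Rightarrow> real \<Rightarrow> bool" where
  "Linf_functional \<Omega> T C \<longleftrightarrow> C \<ge> 0 \<and>
     (\<forall>q\<in>Linf \<Omega>. \<forall>r\<in>Linf \<Omega>. \<forall>c. T (\<lambda>x. q x + c *\<^sub>R r x) = T q + c * T r) \<and>
     (\<forall>q\<in>Linf \<Omega>. \<forall>c\<ge>0. (AE x in lebesgue_on \<Omega>. norm (q x) \<le> c) \<longrightarrow> \<bar>T q\<bar> \<le> C * c)"

lemma Linf_sum: "finite I \<Longrightarrow> (\<And>i. i \<in> I \<Longrightarrow> q i \<in> Linf \<Omega>) \<Longrightarrow> (\<lambda>x. \<Sum>i\<in>I. q i x) \<in> Linf \<Omega>"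
  by (induction I rule: finite_induct) (auto intro: Linf_add)

context
  fixes \<Omega> :: "'a::euclidean_space set" and T C
  assumes T: "Linf_functional \<Omega> T C"
begin

lemma Linf_functional_lincomb:
  "q \<in> Linf \<Omega> \<Longrightarrow> r \<in> Linf \<Omega> \<Longrightarrow> T (\<lambda>x. q x + c *\<^sub>R r x) = T q + c * T r"
  using T by (simp add: Linf_functional_def)

lemma Linf_functional_bound:
  "q \<in> Linf \<Omega> \<Longrightarrow> c \<ge> 0 \<Longrightarrow> AE x in lebesgue_on \<Omega>. norm (q x) \<le> c \<Longrightarrow> \<bar>T q\<bar> \<le> C * c"
  using T by (simp add: Linf_functional_def)

lemma Linf_functional_add:
  "q \<in> Linf \<Omega> \<Longrightarrow> r \<in> Linf \<Omega> \<Longrightarrow> T (\<lambda>x. q x + r x) = T q + T r"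
  using Linf_functional_lincomb[of q r 1] by simp

lemma Linf_functional_diff:
  "q \<in> Linf \<Omega> \<Longrightarrow> r \<in> Linf \<Omega> \<Longrightarrow> T (\<lambda>x. q x - r x) = T q - T r"
  using Linf_functional_lincomb[of q r "-1"] by simp

lemma Linf_functional_zero: "T (\<lambda>x. 0) = 0"
  using Linf_functional_bound[of "\<lambda>x. 0" 0] by simp

lemma Linf_functional_scaleR:
  "q \<in> Linf \<Omega> \<Longrightarrow> T (\<lambda>x. c *\<^sub>R q x) = c * T q"
  using Linf_functional_lincomb[of "\<lambda>x. 0" q c] Linf_functional_zero by simp

lemma Linf_functional_AE_cong:
  assumes "q \<in> Linf \<Omega>" "r \<in> Linf \<Omega>" "AE x in lebesgue_on \<Omega>. q x = r x"
  shows "T q = T r"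
proof -
  have "AE x in lebesgue_on \<Omega>. norm (q x - r x) \<le> 0"
    using assms(3) by eventually_elim simp
  then have "\<bar>T (\<lambda>x. q x - r x)\<bar> \<le> C * 0"
    using assms(1,2) by (intro Linf_functional_bound Linf_diff) auto
  then show ?thesis using Linf_functional_diff[OF assms(1,2)] by simp
qed

lemma Linf_functional_sum:
  "finite I \<Longrightarrow> (\<And>i. i \<in> I \<Longrightarrow> q i \<in> Linf \<Omega>) \<Longrightarrow> T (\<lambda>x. \<Sum>i\<in>I. q i x) = (\<Sum>i\<in>I. T (q i))"
  by (induction I rule: finite_induct) (auto simp: Linf_functional_zero Linf_functional_add Linf_sum)

end

section \<open>Uniform approximation by simple fields\<close>

context bounded_open
begin

lemma simple_Linf:
  assumes "simple_function M s"
  shows "(s :: 'a \<Rightarrow> 'a) \<in> Linf \<Omega>"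
proof -
  have "finite (s ` \<Omega>)" using simple_functionD(1)[OF assms] by simp
  then obtain c where "\<forall>y\<in>s ` \<Omega>. norm y \<le> c"
    using finite_imp_bounded bounded_iff by metis
  then show ?thesis
    using assms by (intro LinfI[of _ _ c] borel_measurable_simple_function AE_I2) auto
qed

lemma Linf_norm_tendsto_0_iff:
  fixes y :: "nat \<Rightarrow> 'a \<Rightarrow> 'a"
  assumes "\<And>n. y n \<in> borel_measurable M"
  shows "(\<lambda>n. Linf_norm \<Omega> (y n)) \<longlonglongrightarrow> 0 \<longleftrightarrow> (\<forall>e>0. \<forall>\<^sub>F n in sequentially. AE x in M. norm (y n x) \<le> e)"
proof
  assume *: "(\<lambda>n. Linf_norm \<Omega> (y n)) \<longlonglongrightarrow> 0"
  show "\<forall>e>0. \<forall>\<^sub>F n in sequentially. AE x in M. norm (y n x) \<le> e"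
  proof (intro allI impI)
    fix e :: real assume "e > 0"
    then have "\<forall>\<^sub>F n in sequentially. Linf_norm \<Omega> (y n) < ereal e"
      using * by (intro order_tendstoD(2)) auto
    then show "\<forall>\<^sub>F n in sequentially. AE x in M. norm (y n x) \<le> e"
      by eventually_elim (simp add: Linf_norm_le_iff[OF assms, symmetric])
  qed
next
  assume *: "\<forall>e>0. \<forall>\<^sub>F n in sequentially. AE x in M. norm (y n x) \<le> e"
  show "(\<lambda>n. Linf_norm \<Omega> (y n)) \<longlonglongrightarrow> 0"
  proof (rule order_tendstoI)
    fix a :: ereal assume "a < 0"
    then show "\<forall>\<^sub>F n in sequentially. a < Linf_norm \<Omega> (y n)"
      by (intro always_eventually allI) (rule less_le_trans[OF _ Linf_norm_nonneg])
  next
    fix a :: ereal assume "0 < a"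
    then obtain e where e: "0 < ereal e" "ereal e < a"
      using ereal_dense2 by blast
    then have "\<forall>\<^sub>F n in sequentially. AE x in M. norm (y n x) \<le> e" using * by simp
    then show "\<forall>\<^sub>F n in sequentially. Linf_norm \<Omega> (y n) < a"
    proof eventually_elim
      case (elim n)
      then have "Linf_norm \<Omega> (y n) \<le> ereal e" by (subst Linf_norm_le_iff[OF assms])
      then show ?case using e(2) by (rule le_less_trans)
    qed
  qed
qed

text \<open>Each coordinate is rounded down to the grid of mesh \<open>1 / Suc n\<close>. The
  coordinate errors add up to at most \<open>DIM('a) / Suc n\<close>.\<close>

lemma Linf_uniform_simple_approx:
  assumes q: "q \<in> Linf \<Omega>"
  obtains s :: "nat \<Rightarrow> 'a \<Rightarrow> 'a" where "\<And>n. simple_function M (s n)"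
    "\<And>n. AE x in M. norm (s n x - q x) \<le> DIM('a) / Suc n"
proof -
  obtain c where c: "c \<ge> 0" "AE x in M. norm (q x) \<le> c" using q by (rule LinfE)
  \<comment> \<open>The default 0 beyond the essential bound \<open>c\<close> keeps the range finite
    and changes the error only on a null set.\<close>
  define s where "s n x = (if norm (q x) \<le> c
      then \<Sum>b\<in>Basis. (of_int \<lfloor>real (Suc n) * (q x \<bullet> b)\<rfloor> / real (Suc n)) *\<^sub>R b else 0)" for n x
  have qm [measurable]: "q \<in> borel_measurable M" using q by (rule Linf_measurable)
  have "simple_function M (s n)" for n
    unfolding simple_function_borel_measurable
  proof (rule simple_function_borel_measurable)
    show "s n \<in> borel_measurable M" unfolding s_def by measurable
    \<comment> \<open>Rounded coordinates have modulus at most \<open>K\<close>; the added 1 leaves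
      room for rounding downwards.\<close>
    define K where "K = \<lceil>real (Suc n) * c\<rceil> + 1"
    define F where "F k = (\<Sum>b\<in>Basis. (of_int (k b) / real (Suc n)) *\<^sub>R b)" for k :: "'a \<Rightarrow> int"
    have "s n x \<in> insert 0 (F ` (Basis \<rightarrow>\<^sub>E {-K..K}))" for x
    proof (cases "norm (q x) \<le> c")
      case True
      define k where "k = (\<lambda>b\<in>Basis. \<lfloor>real (Suc n) * (q x \<bullet> b)\<rfloor>)"
      have "s n x = F k" using True by (simp add: s_def F_def k_def)
      moreover have "k \<in> Basis \<rightarrow>\<^sub>E {-K..K}"
      proof (rule PiE_I)
        fix b :: 'a assume b: "b \<in> Basis"
        then have "\<bar>q x \<bullet> b\<bar> \<le> c" using True Basis_le_norm order_trans by blast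
        then have "\<bar>real (Suc n) * (q x \<bullet> b)\<bar> \<le> real (Suc n) * c"
          by (simp add: abs_mult mult_left_mono del: of_nat_Suc)
        then show "k b \<in> {-K..K}" using b unfolding k_def K_def by simp linarith
      qed (simp add: k_def)
      ultimately show ?thesis by blast
    qed (simp add: s_def)
    then have "s n ` space M \<subseteq> insert 0 (F ` (Basis \<rightarrow>\<^sub>E {-K..K}))" by blast
    moreover have "finite (insert 0 (F ` (Basis \<rightarrow>\<^sub>E {-K..K})))"
      by (intro finite.insertI finite_imageI finite_PiE) auto
    ultimately show "finite (s n ` space M)" by (rule finite_subset)
  qed
  moreover have "AE x in M. norm (s n x - q x) \<le> DIM('a) / Suc n" for n
    using c(2)
  proof eventually_elim
    case (elim x)
    let ?d = "\<lambda>b. of_int \<lfloor>real (Suc n) * (q x \<bullet> b)\<rfloor> / real (Suc n) - q x \<bullet> b"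
    have "s n x - q x = (\<Sum>b\<in>Basis. (of_int \<lfloor>real (Suc n) * (q x \<bullet> b)\<rfloor> / real (Suc n)) *\<^sub>R b) - (\<Sum>b\<in>Basis. (q x \<bullet> b) *\<^sub>R b)"
      using elim by (simp add: s_def euclidean_representation)
    also have "\<dots> = (\<Sum>b\<in>Basis. ?d b *\<^sub>R b)"
      by (simp add: sum_subtractf scaleR_diff_left)
    finally have eq: "s n x - q x = (\<Sum>b\<in>Basis. ?d b *\<^sub>R b)" .
    have "norm (s n x - q x) \<le> (\<Sum>b\<in>Basis. norm (?d b *\<^sub>R b))"
      unfolding eq by (rule norm_sum)
    also have "\<dots> \<le> (\<Sum>b\<in>(Basis :: 'a set). 1 / Suc n)"
    proof (rule sum_mono)
      fix b :: 'a assume b: "b \<in> Basis"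
      have "?d b = (of_int \<lfloor>real (Suc n) * (q x \<bullet> b)\<rfloor> - real (Suc n) * (q x \<bullet> b)) / real (Suc n)"
        by (simp add: diff_divide_distrib del: of_nat_Suc)
      also have "\<bar>\<dots>\<bar> \<le> 1 / real (Suc n)"
      proof -
        have "\<bar>of_int \<lfloor>real (Suc n) * (q x \<bullet> b)\<rfloor> - real (Suc n) * (q x \<bullet> b)\<bar> \<le> 1" by linarith
        then show ?thesis by (simp add: abs_divide divide_right_mono del: of_nat_Suc)
      qed
      finally show "norm (?d b *\<^sub>R b) \<le> 1 / Suc n" using b by simp
    qed
    finally show ?case by simp
  qed
  ultimately show thesis by (rule that)
qed

lemma DIM_div_Suc_small: "e > 0 \<Longrightarrow> \<forall>\<^sub>F n in sequentially. DIM('a) / Suc n \<le> e"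
proof -
  have "(\<lambda>n. real DIM('a) * inverse (real (Suc n))) \<longlonglongrightarrow> real DIM('a) * 0"
    by (intro tendsto_intros LIMSEQ_inverse_real_of_nat)
  then have lim: "(\<lambda>n. real DIM('a) / real (Suc n)) \<longlonglongrightarrow> 0" by (simp add: divide_inverse)
  assume "e > 0"
  from order_tendstoD(2)[OF lim this] show ?thesis
    by eventually_elim simp
qed

lemma Linf_approx_norm_tendsto:
  fixes q :: "'a \<Rightarrow> 'a"
  assumes q: "q \<in> Linf \<Omega>" and s: "\<And>n. simple_function M (s n)"
    "\<And>n. AE x in M. norm (s n x - q x) \<le> DIM('a) / Suc n"
  shows "(\<lambda>n. Linf_norm \<Omega> (\<lambda>x. s n x - q x)) \<longlonglongrightarrow> 0"
proof -
  have meas: "(\<lambda>x. s n x - q x) \<in> borel_measurable M" for n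
    using borel_measurable_simple_function[OF s(1)] Linf_measurable[OF q] by measurable
  show ?thesis
    unfolding Linf_norm_tendsto_0_iff[OF meas]
  proof safe
  fix e :: real assume "e > 0"
  from DIM_div_Suc_small[OF this] show "\<forall>\<^sub>F n in sequentially. AE x in M. norm (s n x - q x) \<le> e"
  proof eventually_elim
    case (elim n)
    from s(2)[of n] show ?case
      by eventually_elim (use elim in linarith)
  qed
  qed
qed

lemma simple_function_level_set: "simple_function M s \<Longrightarrow> s -` {c} \<inter> \<Omega> \<in> sets M"
  using simple_functionD(2)[of M s "{c}"] by simp

lemma Linf_functional_simple:
  assumes T: "Linf_functional \<Omega> T C"
    and ind: "\<And>A c. A \<in> sets M \<Longrightarrow> T (\<lambda>x. indicator A x *\<^sub>R c) = c \<bullet> \<nu> A"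
    and s: "simple_function M s"
  shows "T s = ba_simple_integral \<Omega> \<nu> s"
proof -
  have fin: "finite (s ` \<Omega>)" using simple_functionD(1)[OF s] by simp
  have L: "(\<lambda>x. indicator (s -` {c} \<inter> \<Omega>) x *\<^sub>R c) \<in> Linf \<Omega>" for c
    using simple_function_level_set[OF s] by (intro Linf_scaleR_fun Linf_indicator Linf_const)
  have "T s = T (\<lambda>x. \<Sum>c\<in>s ` \<Omega>. indicator (s -` {c} \<inter> \<Omega>) x *\<^sub>R c)"
  proof (rule Linf_functional_AE_cong[OF T simple_Linf[OF s] Linf_sum[OF fin L]], rule AE_I2)
    fix x assume "x \<in> space M"
    then have "(\<Sum>c\<in>s ` \<Omega>. indicator (s -` {c} \<inter> \<Omega>) x *\<^sub>R c) = (\<Sum>c\<in>s ` \<Omega>. if s x = c then c else 0)"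
      by (intro sum.cong) (auto simp: indicator_def)
    then show "s x = (\<Sum>c\<in>s ` \<Omega>. indicator (s -` {c} \<inter> \<Omega>) x *\<^sub>R c)"
      using fin \<open>x \<in> space M\<close> by simp
  qed
  also have "\<dots> = (\<Sum>c\<in>s ` \<Omega>. T (\<lambda>x. indicator (s -` {c} \<inter> \<Omega>) x *\<^sub>R c))"
    by (rule Linf_functional_sum[OF T fin L])
  also have "\<dots> = ba_simple_integral \<Omega> \<nu> s"
    unfolding ba_simple_integral_def
    by (intro sum.cong refl ind simple_function_level_set s)
  finally show ?thesis .
qed

text \<open>A bounded functional is determined by its values on indicator fields: linearity covers
  simple fields, and boundedness passes to their uniform limits.\<close>

lemma Linf_functional_has_ba_integral:
  assumes T: "Linf_functional \<Omega> T C"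
    and ind: "\<And>A c. A \<in> sets M \<Longrightarrow> T (\<lambda>x. indicator A x *\<^sub>R c) = c \<bullet> \<nu> A"
    and q: "q \<in> Linf \<Omega>"
  shows "has_ba_integral \<Omega> \<nu> q (T q)"
proof -
  obtain s where s: "\<And>n. simple_function M (s n)" "\<And>n. AE x in M. norm (s n x - q x) \<le> DIM('a) / Suc n"
    using Linf_uniform_simple_approx[OF q] by blast
  have bd: "\<bar>T (s n) - T q\<bar> \<le> C * (DIM('a) / Suc n)" for n
  proof -
    have "T (s n) - T q = T (\<lambda>x. s n x - q x)"
      by (rule Linf_functional_diff[OF T simple_Linf[OF s(1)] q, symmetric])
    also have "\<bar>\<dots>\<bar> \<le> C * (DIM('a) / Suc n)"
      by (rule Linf_functional_bound[OF T Linf_diff[OF simple_Linf[OF s(1)] q] _ s(2)]) simp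
    finally show ?thesis .
  qed
  have "(\<lambda>n. C * (real DIM('a) * inverse (real (Suc n)))) \<longlonglongrightarrow> C * (real DIM('a) * 0)"
    by (intro tendsto_intros LIMSEQ_inverse_real_of_nat)
  then have lim: "(\<lambda>n. C * (DIM('a) / Suc n)) \<longlonglongrightarrow> 0" by (simp add: divide_inverse)
  have "(\<lambda>n. T (s n) - T q) \<longlonglongrightarrow> 0"
    by (rule Lim_null_comparison[OF _ lim]) (use bd in auto)
  then have "(\<lambda>n. T (s n)) \<longlonglongrightarrow> T q" by (simp add: LIM_zero_iff)
  then have "(\<lambda>n. ba_simple_integral \<Omega> \<nu> (s n)) \<longlonglongrightarrow> T q"
    using Linf_functional_simple[OF T ind s(1)] by simp
  then show ?thesis
    unfolding has_ba_integral_def using s(1) Linf_approx_norm_tendsto[OF q s] by blast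
qed

section \<open>Total variation of set functions\<close>

lemma total_variation_upper:
  assumes "range A \<subseteq> sets M" "disjoint_family A" "(\<Union>i. A i) = B"
  shows "(\<Sum>i. ennreal (norm (\<nu> (A i)))) \<le> total_variation \<Omega> \<nu> B"
  unfolding total_variation_def using assms by (intro SUP_upper) auto

lemma total_variation_leI:
  assumes "\<And>A n. range A \<subseteq> sets M \<Longrightarrow> disjoint_family A \<Longrightarrow> (\<Union>i. A i) = B \<Longrightarrow>
    (\<Sum>i<(n::nat). norm (\<nu> (A i))) \<le> C"
  shows "total_variation \<Omega> \<nu> B \<le> ennreal C"
  unfolding total_variation_def
proof (rule SUP_least)
  fix A :: "nat \<Rightarrow> 'a set"
  assume "A \<in> {A. range A \<subseteq> sets M \<and> disjoint_family A \<and> (\<Union>i. A i) = B}"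
  then have "(\<Sum>i<n. norm (\<nu> (A i))) \<le> C" for n using assms[of A n] by blast
  then have "(\<Sum>i<n. ennreal (norm (\<nu> (A i)))) \<le> ennreal C" for n
    by (simp add: sum_ennreal ennreal_leI)
  then show "(\<Sum>i. ennreal (norm (\<nu> (A i)))) \<le> ennreal C"
    by (subst suminf_eq_SUP) (rule SUP_least)
qed

lemma total_variation_eq_0I:
  assumes "\<And>A. A \<in> sets M \<Longrightarrow> A \<subseteq> B \<Longrightarrow> \<nu> A = 0"
  shows "total_variation \<Omega> \<nu> B = 0"
proof -
  have "total_variation \<Omega> \<nu> B \<le> ennreal 0"
  proof (rule total_variation_leI)
    fix A :: "nat \<Rightarrow> 'a set" and n assume "range A \<subseteq> sets M" "(\<Union>i. A i) = B"
    then have "\<nu> (A i) = 0" for i by (intro assms) auto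
    then show "(\<Sum>i<n. norm (\<nu> (A i))) \<le> 0" by simp
  qed
  then show ?thesis by simp
qed

text \<open>A partition of \<open>B\<close> and one of \<open>C\<close> interleave to a partition of
  the union; afterwards the suprema are taken separately over the two.\<close>

lemma total_variation_superadd:
  assumes that: "B \<in> sets M" "C \<in> sets M" and B: "B \<inter> C = {}"
  shows "total_variation \<Omega> \<nu> B + total_variation \<Omega> \<nu> C \<le> total_variation \<Omega> \<nu> (B \<union> C)"
proof -
  define P where "P B = {A :: nat \<Rightarrow> 'a set. range A \<subseteq> sets M \<and> disjoint_family A \<and> (\<Union>i. A i) = B}" for B
  have ne: "P B \<noteq> {}" if "B \<in> sets M" for B
  proof -
    have "(\<lambda>i. if i = 0 then B else {}) \<in> P B"
      using that by (auto simp: P_def disjoint_family_on_def split: if_splits)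
    then show ?thesis by blast
  qed
  have "(\<Sum>i. ennreal (norm (\<nu> (U i)))) + (\<Sum>i. ennreal (norm (\<nu> (V i)))) \<le> total_variation \<Omega> \<nu> (B \<union> C)"
    if U: "U \<in> P B" and V: "V \<in> P C" for U V
  proof -
    define W where "W i = (if even i then U (i div 2) else V (i div 2))" for i
    have UV: "U i = W (2 * i)" "V i = W (2 * i + 1)" for i by (auto simp: W_def)
    have "(\<Union>i. W i) = B \<union> C"
    proof
      show "(\<Union>i. W i) \<subseteq> B \<union> C" using U V by (auto simp: P_def W_def split: if_splits)
      have "(\<Union>i. U i) \<subseteq> (\<Union>i. W i)" "(\<Union>i. V i) \<subseteq> (\<Union>i. W i)" using UV by blast+
      then show "B \<union> C \<subseteq> (\<Union>i. W i)" using U V by (simp add: P_def)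
    qed
    moreover have "disjoint_family W"
      unfolding disjoint_family_on_def
    proof (intro ballI impI)
      fix m n :: nat assume "m \<noteq> n"
      have sub: "U i \<subseteq> B" "V i \<subseteq> C" for i using U V by (auto simp: P_def)
      consider "even m" "even n" | "odd m" "odd n" | "even m \<noteq> even n" by blast
      then show "W m \<inter> W n = {}"
      proof cases
        case 1
        then have "m div 2 \<noteq> n div 2" using \<open>m \<noteq> n\<close> by (metis dvd_div_mult_self)
        then show ?thesis using 1 U by (auto simp: W_def P_def disjoint_family_on_def)
      next
        case 2
        then have "m div 2 \<noteq> n div 2" using \<open>m \<noteq> n\<close> by (metis odd_two_times_div_two_succ)
        then show ?thesis using 2 V by (auto simp: W_def P_def disjoint_family_on_def)
      next
        case 3
        then show ?thesis using sub[of "m div 2"] sub[of "n div 2"] B by (auto simp: W_def)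
      qed
    qed
    moreover have "range W \<subseteq> sets M"
      using U V by (auto simp: W_def P_def)
    ultimately have *: "(\<Sum>i. ennreal (norm (\<nu> (W i)))) \<le> total_variation \<Omega> \<nu> (B \<union> C)"
      by (intro total_variation_upper)
    then show ?thesis by (subst (asm) suminf_even_odd) (simp add: W_def)
  qed
  then have "(SUP U\<in>P B. \<Sum>i. ennreal (norm (\<nu> (U i)))) + (SUP V\<in>P C. \<Sum>i. ennreal (norm (\<nu> (V i)))) \<le> total_variation \<Omega> \<nu> (B \<union> C)"
    by (simp add: ennreal_SUP_add_left[OF ne[OF that(1)], symmetric] ennreal_SUP_add_right[OF ne[OF that(2)]] SUP_least)
  then show ?thesis by (simp add: total_variation_def P_def)
qed

lemma total_variation_mono:
  assumes "B \<in> sets M" "C \<in> sets M" "B \<subseteq> C"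
  shows "total_variation \<Omega> \<nu> B \<le> total_variation \<Omega> \<nu> C"
proof -
  have "total_variation \<Omega> \<nu> B \<le> total_variation \<Omega> \<nu> B + total_variation \<Omega> \<nu> (C - B)" by simp
  also have "\<dots> \<le> total_variation \<Omega> \<nu> (B \<union> (C - B))"
    using assms by (intro total_variation_superadd) auto
  also have "B \<union> (C - B) = C" using assms by auto
  finally show ?thesis .
qed

lemma norm_le_total_variation:
  assumes "B \<in> sets M"
  shows "ennreal (norm (\<nu> B)) \<le> total_variation \<Omega> \<nu> B"
proof -
  let ?A = "\<lambda>i::nat. if i = 0 then B else {}"
  define f where "f i = ennreal (norm (\<nu> (?A i)))" for i
  have "ennreal (norm (\<nu> B)) = sum f {0}" by (simp add: f_def)
  also have "\<dots> \<le> suminf f" by (intro sum_le_suminf) auto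
  also have "suminf f = (\<Sum>i. ennreal (norm (\<nu> (?A i))))" by (simp only: f_def[abs_def])
  also have "\<dots> \<le> total_variation \<Omega> \<nu> B"
    using assms by (intro total_variation_upper) (auto simp: disjoint_family_on_def split: if_splits)
  finally show ?thesis .
qed

end

lemma sum_le_suminf_ennreal: "(\<And>i. (f i :: ennreal) \<le> g i + h i) \<Longrightarrow> suminf f \<le> suminf g + suminf h"
proof -
  assume "\<And>i. f i \<le> g i + h i"
  then have "suminf f \<le> (\<Sum>i. g i + h i)" by (intro suminf_le) auto
  also have "\<dots> = suminf g + suminf h" by (rule suminf_add[symmetric]) auto
  finally show ?thesis .
qed

section \<open>Additivity of the variation and the integral of bounded fields\<close>

context bounded_open
begin

lemma ba_add: "\<nu> \<in> ba \<Omega> \<Longrightarrow> A \<in> sets M \<Longrightarrow> B \<in> sets M \<Longrightarrow> A \<inter> B = {} \<Longrightarrow> \<nu> (A \<union> B) = \<nu> A + \<nu> B"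
  by (simp add: ba_def)

lemma ba_null: "\<nu> \<in> ba \<Omega> \<Longrightarrow> A \<in> null_sets M \<Longrightarrow> \<nu> A = 0"
  by (simp add: ba_def)

lemma ba_empty [simp]: "\<nu> \<in> ba \<Omega> \<Longrightarrow> \<nu> {} = 0"
  by (rule ba_null) auto

text \<open>The value type is left general so that the lemma serves both the vector measure and its
  real-valued variation \<open>tv\<close>.\<close>

lemma additive_UN:
  fixes \<tau> :: "'a set \<Rightarrow> 'b::ab_group_add"
  assumes add: "\<And>A B. A \<in> sets M \<Longrightarrow> B \<in> sets M \<Longrightarrow> A \<inter> B = {} \<Longrightarrow> \<tau> (A \<union> B) = \<tau> A + \<tau> B"
    and A: "finite I" "disjoint_family_on A I" "\<And>i. i \<in> I \<Longrightarrow> A i \<in> sets M"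
  shows "\<tau> (\<Union>i\<in>I. A i) = (\<Sum>i\<in>I. \<tau> (A i))"
  using A
proof (induction I rule: finite_induct)
  case empty
  show ?case using add[of "{}" "{}"] by simp
next
  case (insert i I)
  have "A i \<inter> (\<Union>i\<in>I. A i) = {}"
    using insert.prems insert.hyps by (auto simp: disjoint_family_on_def)
  moreover have "(\<Union>i\<in>I. A i) \<in> sets M" using insert by auto
  ultimately have "\<tau> (\<Union>i\<in>insert i I. A i) = \<tau> (A i) + \<tau> (\<Union>i\<in>I. A i)"
    using insert.prems add by simp
  then show ?case
    using insert by (simp add: disjoint_family_on_def)
qed

lemma ba_UN:
  assumes "\<nu> \<in> ba \<Omega>" "finite I" "disjoint_family_on A I" "\<And>i. i \<in> I \<Longrightarrow> A i \<in> sets M"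
  shows "\<nu> (\<Union>i\<in>I. A i) = (\<Sum>i\<in>I. \<nu> (A i))"
  by (rule additive_UN[of \<nu>, OF ba_add[OF assms(1)] assms(2-4)])

text \<open>\<open>enn2real\<close> would turn an infinite variation into 0. On \<open>ba\<close>
  this cannot happen, by \<open>total_variation_eq_tv\<close>.\<close>

definition tv :: "('a set \<Rightarrow> 'a) \<Rightarrow> 'a set \<Rightarrow> real" where
  "tv \<nu> B = enn2real (total_variation \<Omega> \<nu> B)"

lemma total_variation_eq_tv:
  assumes "\<nu> \<in> ba \<Omega>" "B \<in> sets M"
  shows "total_variation \<Omega> \<nu> B = ennreal (tv \<nu> B)"
proof -
  have "total_variation \<Omega> \<nu> B \<le> total_variation \<Omega> \<nu> \<Omega>"
    using assms by (intro total_variation_mono) (auto simp: sets_M)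
  also have "\<dots> < \<infinity>" using assms by (simp add: ba_def)
  finally show ?thesis by (simp add: tv_def)
qed

lemma tv_nonneg [simp]: "0 \<le> tv \<nu> B"
  by (simp add: tv_def)

lemma norm_le_tv: "\<nu> \<in> ba \<Omega> \<Longrightarrow> B \<in> sets M \<Longrightarrow> norm (\<nu> B) \<le> tv \<nu> B"
  using norm_le_total_variation[of B \<nu>] by (simp add: total_variation_eq_tv)

text \<open>Every piece of a partition of the union splits into its parts in \<open>B\<close> and in
  \<open>C\<close>, and additivity of \<open>\<nu>\<close> with the triangle inequality bounds its
  norm.\<close>

lemma total_variation_subadd:
  assumes nu: "\<nu> \<in> ba \<Omega>" and B: "B \<in> sets M" "C \<in> sets M" and that: "B \<inter> C = {}"
  shows "total_variation \<Omega> \<nu> (B \<union> C) \<le> total_variation \<Omega> \<nu> B + total_variation \<Omega> \<nu> C"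
  unfolding total_variation_def[of \<Omega> \<nu> "B \<union> C"]
proof (rule SUP_least, safe)
  fix A :: "nat \<Rightarrow> 'a set" assume A: "range A \<subseteq> sets M" "disjoint_family A" "(\<Union>i. A i) = B \<union> C"
  then have A': "A i \<in> sets M" "A i \<subseteq> B \<union> C" for i by auto
  have "(\<Sum>i. ennreal (norm (\<nu> (A i)))) \<le> (\<Sum>i. ennreal (norm (\<nu> (A i \<inter> B)))) + (\<Sum>i. ennreal (norm (\<nu> (A i \<inter> C))))"
  proof (rule sum_le_suminf_ennreal)
    fix i
    have "\<nu> ((A i \<inter> B) \<union> (A i \<inter> C)) = \<nu> (A i \<inter> B) + \<nu> (A i \<inter> C)"
      by (rule ba_add[OF nu]) (use A' B that in auto)
    moreover have "(A i \<inter> B) \<union> (A i \<inter> C) = A i" using A'(2) by auto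
    ultimately have "norm (\<nu> (A i)) \<le> norm (\<nu> (A i \<inter> B)) + norm (\<nu> (A i \<inter> C))"
      using norm_triangle_ineq by metis
    then show "ennreal (norm (\<nu> (A i))) \<le> ennreal (norm (\<nu> (A i \<inter> B))) + ennreal (norm (\<nu> (A i \<inter> C)))"
      by (simp add: ennreal_leI flip: ennreal_plus)
  qed
  also have "\<dots> \<le> total_variation \<Omega> \<nu> B + total_variation \<Omega> \<nu> C"
    by (intro add_mono total_variation_upper) (use A A' B in \<open>auto simp: disjoint_family_on_def\<close>)
  finally show "(\<Sum>i. ennreal (norm (\<nu> (A i)))) \<le> total_variation \<Omega> \<nu> B + total_variation \<Omega> \<nu> C" .
qed

lemma tv_add:
  assumes nu: "\<nu> \<in> ba \<Omega>" and B: "B \<in> sets M" "C \<in> sets M" "B \<inter> C = {}"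
  shows "tv \<nu> (B \<union> C) = tv \<nu> B + tv \<nu> C"
proof -
  have "total_variation \<Omega> \<nu> (B \<union> C) = total_variation \<Omega> \<nu> B + total_variation \<Omega> \<nu> C"
    using assms by (blast intro: antisym total_variation_subadd total_variation_superadd)
  then have "ennreal (tv \<nu> (B \<union> C)) = ennreal (tv \<nu> B + tv \<nu> C)"
    using assms by (simp add: total_variation_eq_tv)
  then show ?thesis by (subst (asm) ennreal_inj) auto
qed

lemma tv_mono: "\<nu> \<in> ba \<Omega> \<Longrightarrow> B \<in> sets M \<Longrightarrow> C \<in> sets M \<Longrightarrow> B \<subseteq> C \<Longrightarrow> tv \<nu> B \<le> tv \<nu> C"
  using total_variation_mono[of B C \<nu>] by (simp add: total_variation_eq_tv)

lemma tv_UN: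
  assumes "\<nu> \<in> ba \<Omega>" "finite I" "disjoint_family_on A I" "\<And>i. i \<in> I \<Longrightarrow> A i \<in> sets M"
  shows "tv \<nu> (\<Union>i\<in>I. A i) = (\<Sum>i\<in>I. tv \<nu> (A i))"
  by (rule additive_UN[of "tv \<nu>", OF tv_add[OF assms(1)] assms(2-4)])

lemma tv_null:
  assumes nu: "\<nu> \<in> ba \<Omega>" and A: "A \<in> null_sets M"
  shows "tv \<nu> A = 0"
proof -
  have "total_variation \<Omega> \<nu> A = 0"
    using A by (intro total_variation_eq_0I ba_null[OF nu]) (rule null_sets_subset)
  then show ?thesis by (simp add: tv_def)
qed

lemma sum_norm_le_tv:
  assumes "\<nu> \<in> ba \<Omega>" "finite I" "disjoint_family_on A I" "\<And>i. i \<in> I \<Longrightarrow> A i \<in> sets M"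
  shows "(\<Sum>i\<in>I. norm (\<nu> (A i))) \<le> tv \<nu> \<Omega>"
proof -
  have "(\<Sum>i\<in>I. norm (\<nu> (A i))) \<le> (\<Sum>i\<in>I. tv \<nu> (A i))"
    using assms by (intro sum_mono norm_le_tv) auto
  also have "\<dots> = tv \<nu> (\<Union>i\<in>I. A i)" using assms by (intro tv_UN[symmetric])
  also have "\<dots> \<le> tv \<nu> \<Omega>"
  proof (rule tv_mono)
    show "(\<Union>i\<in>I. A i) \<in> sets M" using assms by auto
    show "(\<Union>i\<in>I. A i) \<subseteq> \<Omega>" using assms(4) by (auto simp: sets_M)
  qed (use assms in auto)
  finally show ?thesis .
qed

text \<open>The sum may be taken over the level sets of a finer simple function \<open>w\<close>.
  With \<open>w\<close> the pair of two simple fields, linearity of the integral becomes linearity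
  of one finite sum.\<close>

lemma ba_simple_integral_comp:
  assumes nu: "\<nu> \<in> ba \<Omega>" and w: "simple_function M w"
  shows "ba_simple_integral \<Omega> \<nu> (\<lambda>x. h (w x)) = (\<Sum>d\<in>w ` \<Omega>. h d \<bullet> \<nu> (w -` {d} \<inter> \<Omega>))"
proof -
  have fin: "finite (w ` \<Omega>)" using simple_functionD(1)[OF w] by simp
  have "(\<Sum>d\<in>w ` \<Omega>. h d \<bullet> \<nu> (w -` {d} \<inter> \<Omega>)) =
      (\<Sum>c\<in>h ` w ` \<Omega>. \<Sum>d\<in>{d \<in> w ` \<Omega>. h d = c}. h d \<bullet> \<nu> (w -` {d} \<inter> \<Omega>))"
    by (rule sum.image_gen[OF fin])
  also have "\<dots> = (\<Sum>c\<in>h ` w ` \<Omega>. c \<bullet> \<nu> ((\<lambda>x. h (w x)) -` {c} \<inter> \<Omega>))"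
  proof (rule sum.cong)
    fix c assume "c \<in> h ` w ` \<Omega>"
    have "(\<lambda>x. h (w x)) -` {c} \<inter> \<Omega> = (\<Union>d\<in>{d \<in> w ` \<Omega>. h d = c}. w -` {d} \<inter> \<Omega>)" by auto
    also have "\<nu> \<dots> = (\<Sum>d\<in>{d \<in> w ` \<Omega>. h d = c}. \<nu> (w -` {d} \<inter> \<Omega>))"
      using fin simple_function_level_set[OF w]
      by (intro ba_UN[OF nu]) (auto simp: disjoint_family_on_def)
    finally show "(\<Sum>d\<in>{d \<in> w ` \<Omega>. h d = c}. h d \<bullet> \<nu> (w -` {d} \<inter> \<Omega>)) = c \<bullet> \<nu> ((\<lambda>x. h (w x)) -` {c} \<inter> \<Omega>)"
      by (simp add: inner_sum_right)
  qed simp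
  finally show ?thesis by (simp add: ba_simple_integral_def image_image)
qed

lemma ba_simple_integral_lincomb:
  assumes nu: "\<nu> \<in> ba \<Omega>" and s: "simple_function M s" and t: "simple_function M t"
  shows "ba_simple_integral \<Omega> \<nu> (\<lambda>x. s x + c *\<^sub>R t x) = ba_simple_integral \<Omega> \<nu> s + c * ba_simple_integral \<Omega> \<nu> t"
proof -
  have w: "simple_function M (\<lambda>x. (s x, t x))" using s t by (rule simple_function_Pair)
  show ?thesis
    using ba_simple_integral_comp[OF nu w, of "\<lambda>(a, b). a + c *\<^sub>R b"]
      ba_simple_integral_comp[OF nu w, of fst] ba_simple_integral_comp[OF nu w, of snd]
    by (simp add: case_prod_unfold inner_add_left sum.distrib sum_distrib_left)
qed

lemma ba_simple_integral_bound:
  assumes nu: "\<nu> \<in> ba \<Omega>" and s: "simple_function M s" and c: "c \<ge> 0" "AE x in M. norm (s x) \<le> c"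
  shows "\<bar>ba_simple_integral \<Omega> \<nu> s\<bar> \<le> tv \<nu> \<Omega> * c"
proof -
  have fin: "finite (s ` \<Omega>)" using simple_functionD(1)[OF s] by simp
  have "\<bar>ba_simple_integral \<Omega> \<nu> s\<bar> \<le> (\<Sum>d\<in>s ` \<Omega>. \<bar>d \<bullet> \<nu> (s -` {d} \<inter> \<Omega>)\<bar>)"
    unfolding ba_simple_integral_def by (rule sum_abs)
  also have "\<dots> \<le> (\<Sum>d\<in>s ` \<Omega>. c * norm (\<nu> (s -` {d} \<inter> \<Omega>)))"
  proof (rule sum_mono)
    fix d assume "d \<in> s ` \<Omega>"
    show "\<bar>d \<bullet> \<nu> (s -` {d} \<inter> \<Omega>)\<bar> \<le> c * norm (\<nu> (s -` {d} \<inter> \<Omega>))"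
    proof (cases "norm d \<le> c")
      case True
      have "\<bar>d \<bullet> \<nu> (s -` {d} \<inter> \<Omega>)\<bar> \<le> norm d * norm (\<nu> (s -` {d} \<inter> \<Omega>))" by (rule Cauchy_Schwarz_ineq2)
      also have "\<dots> \<le> c * norm (\<nu> (s -` {d} \<inter> \<Omega>))" using True by (intro mult_right_mono) auto
      finally show ?thesis .
    next
      case False
      \<comment> \<open>A value above the essential bound is attained only on a null set, which
        \<open>\<nu>\<close> does not charge.\<close>
      have "AE x in M. x \<notin> s -` {d} \<inter> \<Omega>"
        using c(2) by eventually_elim (use False in auto)
      then have "s -` {d} \<inter> \<Omega> \<in> null_sets M"
        using simple_function_level_set[OF s] by (simp add: AE_iff_null_sets)
      then show ?thesis using ba_null[OF nu] by simp
    qed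
  qed
  also have "\<dots> = c * (\<Sum>d\<in>s ` \<Omega>. norm (\<nu> (s -` {d} \<inter> \<Omega>)))" by (simp add: sum_distrib_left)
  also have "\<dots> \<le> c * tv \<nu> \<Omega>"
    using c(1) fin simple_function_level_set[OF s]
    by (intro mult_left_mono sum_norm_le_tv[OF nu]) (auto simp: disjoint_family_on_def)
  finally show ?thesis by (simp add: mult.commute)
qed

lemma has_ba_integral_lincomb:
  assumes nu: "\<nu> \<in> ba \<Omega>" and q: "q \<in> Linf \<Omega>" "has_ba_integral \<Omega> \<nu> q I" and r: "r \<in> Linf \<Omega>" "has_ba_integral \<Omega> \<nu> r J"
  shows "has_ba_integral \<Omega> \<nu> (\<lambda>x. q x + c *\<^sub>R r x) (I + c * J)"
proof -
  obtain s where s: "\<And>n. simple_function M (s n)" "(\<lambda>n. Linf_norm \<Omega> (\<lambda>x. s n x - q x)) \<longlonglongrightarrow> 0"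
    "(\<lambda>n. ba_simple_integral \<Omega> \<nu> (s n)) \<longlonglongrightarrow> I"
    using q(2) by (auto simp: has_ba_integral_def)
  obtain t where t: "\<And>n. simple_function M (t n)" "(\<lambda>n. Linf_norm \<Omega> (\<lambda>x. t n x - r x)) \<longlonglongrightarrow> 0"
    "(\<lambda>n. ba_simple_integral \<Omega> \<nu> (t n)) \<longlonglongrightarrow> J"
    using r(2) by (auto simp: has_ba_integral_def)
  note [measurable] = borel_measurable_simple_function[OF s(1)] borel_measurable_simple_function[OF t(1)]
    Linf_measurable[OF q(1)] Linf_measurable[OF r(1)]
  have st: "simple_function M (\<lambda>x. s n x + c *\<^sub>R t n x)" for n
    using simple_function_compose2[OF s(1) t(1), of "\<lambda>a b. a + c *\<^sub>R b"] .
  have m: "(\<lambda>x. s n x - q x) \<in> borel_measurable M" "(\<lambda>x. t n x - r x) \<in> borel_measurable M"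
    "(\<lambda>x. (s n x + c *\<^sub>R t n x) - (q x + c *\<^sub>R r x)) \<in> borel_measurable M" for n by measurable
  have "(\<lambda>n. Linf_norm \<Omega> (\<lambda>x. (s n x + c *\<^sub>R t n x) - (q x + c *\<^sub>R r x))) \<longlonglongrightarrow> 0"
    unfolding Linf_norm_tendsto_0_iff[OF m(3)]
  proof safe
    fix e :: real assume "e > 0"
    define d where "d = e / (1 + \<bar>c\<bar>)"
    have "1 + \<bar>c\<bar> > 0" by linarith
    then have d: "d > 0" using \<open>e > 0\<close> by (simp add: d_def)
    have "(1 + \<bar>c\<bar>) * d = e" using \<open>1 + \<bar>c\<bar> > 0\<close> by (simp add: d_def)
    then have d2: "d + \<bar>c\<bar> * d = e" by (simp add: algebra_simps)
    have "\<forall>\<^sub>F n in sequentially. AE x in M. norm (s n x - q x) \<le> d"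
      "\<forall>\<^sub>F n in sequentially. AE x in M. norm (t n x - r x) \<le> d"
      using s(2) t(2) d unfolding Linf_norm_tendsto_0_iff[OF m(1)] Linf_norm_tendsto_0_iff[OF m(2)] by auto
    then show "\<forall>\<^sub>F n in sequentially. AE x in M. norm ((s n x + c *\<^sub>R t n x) - (q x + c *\<^sub>R r x)) \<le> e"
    proof eventually_elim
      case (elim n)
      then show ?case
      proof eventually_elim
        case (elim x)
        have "(s n x + c *\<^sub>R t n x) - (q x + c *\<^sub>R r x) = (s n x - q x) + c *\<^sub>R (t n x - r x)"
          by (simp add: algebra_simps)
        also have "norm \<dots> \<le> norm (s n x - q x) + \<bar>c\<bar> * norm (t n x - r x)"
          by (metis norm_scaleR norm_triangle_ineq)
        also have "\<dots> \<le> d + \<bar>c\<bar> * d" using elim by (intro add_mono mult_left_mono) auto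
        finally show ?case using d2 by simp
      qed
    qed
  qed
  moreover have "(\<lambda>n. ba_simple_integral \<Omega> \<nu> (\<lambda>x. s n x + c *\<^sub>R t n x)) \<longlonglongrightarrow> I + c * J"
    unfolding ba_simple_integral_lincomb[OF nu s(1) t(1)] using s(3) t(3) by (intro tendsto_intros)
  ultimately show ?thesis
    unfolding has_ba_integral_def using st by (intro exI[of _ "\<lambda>n x. s n x + c *\<^sub>R t n x"]) auto
qed

lemma has_ba_integral_bound:
  assumes nu: "\<nu> \<in> ba \<Omega>" and q: "q \<in> Linf \<Omega>" "has_ba_integral \<Omega> \<nu> q I" and c: "c \<ge> 0" "AE x in M. norm (q x) \<le> c"
  shows "\<bar>I\<bar> \<le> tv \<nu> \<Omega> * c"
proof -
  obtain s where s: "\<And>n. simple_function M (s n)" "(\<lambda>n. Linf_norm \<Omega> (\<lambda>x. s n x - q x)) \<longlonglongrightarrow> 0"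
    "(\<lambda>n. ba_simple_integral \<Omega> \<nu> (s n)) \<longlonglongrightarrow> I"
    using q(2) by (auto simp: has_ba_integral_def)
  note [measurable] = borel_measurable_simple_function[OF s(1)] Linf_measurable[OF q(1)]
  have m: "(\<lambda>x. s n x - q x) \<in> borel_measurable M" for n by measurable
  have *: "\<bar>I\<bar> \<le> tv \<nu> \<Omega> * c + e * tv \<nu> \<Omega>" if "e > 0" for e
  proof (rule tendsto_upperbound[OF tendsto_rabs[OF s(3)]])
    have "\<forall>\<^sub>F n in sequentially. AE x in M. norm (s n x - q x) \<le> e"
      using s(2) that unfolding Linf_norm_tendsto_0_iff[OF m] by auto
    then show "\<forall>\<^sub>F n in sequentially. \<bar>ba_simple_integral \<Omega> \<nu> (s n)\<bar> \<le> tv \<nu> \<Omega> * c + e * tv \<nu> \<Omega>"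
    proof eventually_elim
      case (elim n)
      then have "AE x in M. norm (s n x) \<le> c + e"
        using c(2) by eventually_elim norm
      then have "\<bar>ba_simple_integral \<Omega> \<nu> (s n)\<bar> \<le> tv \<nu> \<Omega> * (c + e)"
        using c(1) that by (intro ba_simple_integral_bound[OF nu s(1)]) auto
      then show ?case by (simp add: algebra_simps)
    qed
  qed simp
  show ?thesis
  proof (rule field_le_epsilon)
    fix e :: real assume "e > 0"
    then have "e / (1 + tv \<nu> \<Omega>) * tv \<nu> \<Omega> \<le> e" "e / (1 + tv \<nu> \<Omega>) > 0"
      by (simp_all add: divide_le_eq add_pos_nonneg algebra_simps)
    then show "\<bar>I\<bar> \<le> tv \<nu> \<Omega> * c + e" using *[of "e / (1 + tv \<nu> \<Omega>)"] by linarith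
  qed
qed

text \<open>The difference of the field with itself has integral \<open>I - J\<close>, which the
  bound with \<open>c = 0\<close> forces to vanish. This makes the definite description in
  \<open>ba_integral\<close> meaningful.\<close>

lemma has_ba_integral_unique:
  assumes nu: "\<nu> \<in> ba \<Omega>" and q: "q \<in> Linf \<Omega>" "has_ba_integral \<Omega> \<nu> q I" "has_ba_integral \<Omega> \<nu> q J"
  shows "I = J"
proof -
  have "has_ba_integral \<Omega> \<nu> (\<lambda>x. q x + (-1) *\<^sub>R q x) (I + (-1) * J)"
    by (rule has_ba_integral_lincomb) (use assms in auto)
  then have "\<bar>I + (-1) * J\<bar> \<le> tv \<nu> \<Omega> * 0"
    by (intro has_ba_integral_bound[OF nu]) auto
  then show ?thesis by simp
qed

lemma ba_integral_eq:
  assumes "\<nu> \<in> ba \<Omega>" "q \<in> Linf \<Omega>" "has_ba_integral \<Omega> \<nu> q I"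
  shows "ba_integral \<Omega> \<nu> q = I"
  unfolding ba_integral_def using assms has_ba_integral_unique by blast

text \<open>Two uniform approximants of the same field differ by at most \<open>2 * e\<close>, so
  the bound for simple integrals makes the approximating integrals a Cauchy sequence.\<close>

lemma has_ba_integral_ba_integral:
  assumes nu: "\<nu> \<in> ba \<Omega>" and q: "q \<in> Linf \<Omega>"
  shows "has_ba_integral \<Omega> \<nu> q (ba_integral \<Omega> \<nu> q)"
proof -
  obtain s where s: "\<And>n. simple_function M (s n)" "\<And>n. AE x in M. norm (s n x - q x) \<le> DIM('a) / Suc n"
    using Linf_uniform_simple_approx[OF q] by blast
  have bd: "\<bar>ba_simple_integral \<Omega> \<nu> (s m) - ba_simple_integral \<Omega> \<nu> (s n)\<bar> \<le> tv \<nu> \<Omega> * (2 * e)"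
    if "DIM('a) / Suc m \<le> e" "DIM('a) / Suc n \<le> e" for m n e
  proof -
    have "AE x in M. norm (s m x + (-1) *\<^sub>R s n x) \<le> 2 * e"
      using s(2)[of m] s(2)[of n] 
    proof eventually_elim
      case (elim x)
      then have "norm (s m x - q x) \<le> e" "norm (s n x - q x) \<le> e" using that by linarith+
      then show ?case by norm
    qed
    moreover have "e \<ge> 0" using that(1) by (meson divide_nonneg_nonneg of_nat_0_le_iff order_trans)
    ultimately have "\<bar>ba_simple_integral \<Omega> \<nu> (\<lambda>x. s m x + (-1) *\<^sub>R s n x)\<bar> \<le> tv \<nu> \<Omega> * (2 * e)"
      using simple_function_compose2[OF s(1) s(1), of "\<lambda>a b. a + (-1) *\<^sub>R b" m n]
      by (intro ba_simple_integral_bound[OF nu]) auto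
    then show ?thesis by (subst (asm) ba_simple_integral_lincomb[OF nu s(1) s(1)]) simp
  qed
  have "Cauchy (\<lambda>n. ba_simple_integral \<Omega> \<nu> (s n))"
  proof (rule CauchyI)
    fix e :: real assume "e > 0"
    define d where "d = e / (2 * (1 + tv \<nu> \<Omega>))"
    have tv1: "1 + tv \<nu> \<Omega> > 0" by (simp add: add_pos_nonneg)
    have d: "d > 0" "tv \<nu> \<Omega> * (2 * d) < e"
      using \<open>e > 0\<close> tv1 by (auto simp: d_def divide_simps)
    obtain N where "\<And>n. n \<ge> N \<Longrightarrow> DIM('a) / Suc n \<le> d"
      using DIM_div_Suc_small[OF d(1)] by (auto simp: eventually_sequentially)
    then show "\<exists>N. \<forall>m\<ge>N. \<forall>n\<ge>N. norm (ba_simple_integral \<Omega> \<nu> (s m) - ba_simple_integral \<Omega> \<nu> (s n)) < e"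
      using le_less_trans[OF bd d(2)] by (intro exI[of _ N]) simp
  qed
  then obtain I where "(\<lambda>n. ba_simple_integral \<Omega> \<nu> (s n)) \<longlonglongrightarrow> I"
    using Cauchy_convergent convergent_def by blast
  then have "has_ba_integral \<Omega> \<nu> q I"
    unfolding has_ba_integral_def using s(1) Linf_approx_norm_tendsto[OF q s] by blast
  then show ?thesis using ba_integral_eq[OF nu q] by simp
qed

lemma ba_integral_Linf_functional:
  assumes nu: "\<nu> \<in> ba \<Omega>"
  shows "Linf_functional \<Omega> (ba_integral \<Omega> \<nu>) (tv \<nu> \<Omega>)"
  unfolding Linf_functional_def
proof (intro conjI ballI allI impI)
  fix q r :: "'a \<Rightarrow> 'a" and c assume "q \<in> Linf \<Omega>" "r \<in> Linf \<Omega>"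
  then show "ba_integral \<Omega> \<nu> (\<lambda>x. q x + c *\<^sub>R r x) = ba_integral \<Omega> \<nu> q + c * ba_integral \<Omega> \<nu> r"
    by (intro ba_integral_eq[OF nu] Linf_add Linf_scaleR has_ba_integral_lincomb[OF nu] has_ba_integral_ba_integral[OF nu])
next
  fix q :: "'a \<Rightarrow> 'a" and c :: real assume "q \<in> Linf \<Omega>" "c \<ge> 0" "AE x in M. norm (q x) \<le> c"
  then show "\<bar>ba_integral \<Omega> \<nu> q\<bar> \<le> tv \<nu> \<Omega> * c"
    using has_ba_integral_bound[OF nu _ has_ba_integral_ba_integral[OF nu]] by blast
qed simp

lemma ba_integral_indicator:
  assumes nu: "\<nu> \<in> ba \<Omega>" and A: "A \<in> sets M"
  shows "ba_integral \<Omega> \<nu> (\<lambda>x. indicator A x *\<^sub>R c) = c \<bullet> \<nu> A"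
proof (rule ba_integral_eq[OF nu])
  let ?q = "\<lambda>x. indicator A x *\<^sub>R c"
  show L: "?q \<in> Linf \<Omega>"
    using A by (intro Linf_scaleR_fun Linf_indicator Linf_const)
  have ind: "simple_function M (indicator A :: 'a \<Rightarrow> real)"
    using A by (rule simple_function_indicator)
  then have s: "simple_function M ?q"
    using simple_function_compose1[OF ind, of "\<lambda>t. t *\<^sub>R c"] by simp
  have "ba_simple_integral \<Omega> \<nu> ?q = (\<Sum>d\<in>indicator A ` \<Omega>. (d *\<^sub>R c) \<bullet> \<nu> (indicator A -` {d :: real} \<inter> \<Omega>))"
    by (rule ba_simple_integral_comp[OF nu ind])
  also have "\<dots> = (\<Sum>d\<in>indicator A ` \<Omega> \<inter> {1}. (d *\<^sub>R c) \<bullet> \<nu> (indicator A -` {d :: real} \<inter> \<Omega>))"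
    using simple_functionD(1)[OF ind] by (intro sum.mono_neutral_right) (auto simp: indicator_def)
  also have "\<dots> = c \<bullet> \<nu> A"
  \<comment> \<open>The value 1 of the indicator is attained on the domain exactly when
    \<open>A\<close> is nonempty.\<close>
  proof (cases "A = {}")
    case True
    then have "indicator A ` \<Omega> \<inter> {1 :: real} = {}" by auto
    then show ?thesis using nu True by (simp only: sum.empty ba_empty inner_zero_right)
  next
    case False
    then have "indicator A ` \<Omega> \<inter> {1} = {1 :: real}" using A by (auto simp: sets_M indicator_def image_iff)
    moreover have "indicator A -` {1 :: real} \<inter> \<Omega> = A" using A by (auto simp: sets_M indicator_def)
    ultimately show ?thesis by simp
  qed
  finally show "has_ba_integral \<Omega> \<nu> ?q (c \<bullet> \<nu> A)"
    unfolding has_ba_integral_def using s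
    by (intro exI[of _ "\<lambda>n. ?q"]) (auto simp: Linf_norm_def esssup_const[of M 0] emeasure_dom_pos[THEN less_imp_neq, symmetric] zero_ereal_def[symmetric])
qed

text \<open>The device for evaluating integrals below: guess the functional and check it on
  indicators.\<close>

lemma ba_integral_eq_functional:
  assumes nu: "\<nu> \<in> ba \<Omega>" and T: "Linf_functional \<Omega> T C"
    and ind: "\<And>A c. A \<in> sets M \<Longrightarrow> T (\<lambda>x. indicator A x *\<^sub>R c) = c \<bullet> \<nu> A"
    and q: "q \<in> Linf \<Omega>"
  shows "ba_integral \<Omega> \<nu> q = T q"
  by (rule ba_integral_eq[OF nu q Linf_functional_has_ba_integral[OF T ind q]])

end

section \<open>The Yosida--Hewitt decomposition\<close>

text \<open>Absolute continuity in the epsilon-delta sense upgrades finite to countable additivity: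
  sets decreasing to the empty set have measure tending to 0, hence \<open>t\<close> tends to 0
  along them. Radon--Nikodym then supplies the density.\<close>

lemma (in finite_measure) density_of_abs_continuous_additive:
  fixes t :: "'a set \<Rightarrow> real"
  assumes nonneg: "\<And>A. A \<in> sets M \<Longrightarrow> 0 \<le> t A"
    and add: "\<And>A B. A \<in> sets M \<Longrightarrow> B \<in> sets M \<Longrightarrow> A \<inter> B = {} \<Longrightarrow> t (A \<union> B) = t A + t B"
    and ac: "\<And>e. e > 0 \<Longrightarrow> \<exists>d>0. \<forall>A\<in>sets M. measure M A < d \<longrightarrow> t A < e"
  obtains h where "integrable M h" "\<And>A. A \<in> sets M \<Longrightarrow> t A = (LINT x:A|M. h x)"
proof -
  have t0: "t {} = 0" using add[of "{}" "{}"] by simp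
  define N where "N = measure_of (space M) (sets M) (\<lambda>A. ennreal (t A))"
  have pos: "positive (sets M) (\<lambda>A. ennreal (t A))" by (simp add: positive_def t0)
  have ca: "countably_additive (sets M) (\<lambda>A. ennreal (t A))"
  proof (rule sets.empty_continuous_imp_countably_additive[OF pos])
    show "additive (sets M) (\<lambda>A. ennreal (t A))"
      using add nonneg by (auto simp: additive_def)
    fix A :: "nat \<Rightarrow> 'a set" assume A: "range A \<subseteq> sets M" "decseq A" "(\<Inter>i. A i) = {}"
    have lim: "(\<lambda>i. measure M (A i)) \<longlonglongrightarrow> 0"
      using finite_Lim_measure_decseq[OF A(1,2)] A(3) by simp
    have "(\<lambda>i. t (A i)) \<longlonglongrightarrow> 0"
    proof (rule order_tendstoI)
      fix a :: real assume "a < 0"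
      have "A i \<in> sets M" for i using A(1) by auto
      then have "a < t (A i)" for i by (rule less_le_trans[OF \<open>a < 0\<close> nonneg])
      then show "\<forall>\<^sub>F i in sequentially. a < t (A i)" by simp
    next
      fix a :: real assume "0 < a"
      from ac[OF this] obtain d where d: "d > 0" "\<forall>A\<in>sets M. measure M A < d \<longrightarrow> t A < a" by blast
      have "\<forall>\<^sub>F i in sequentially. measure M (A i) < d" using order_tendstoD(2)[OF lim d(1)] .
      then show "\<forall>\<^sub>F i in sequentially. t (A i) < a"
        by eventually_elim (use d(2) A(1) in auto)
    qed
    then show "(\<lambda>i. ennreal (t (A i))) \<longlonglongrightarrow> 0"
      using tendsto_ennrealI[of "\<lambda>i. t (A i)" 0 sequentially] by simp
  qed auto
  have sN [simp]: "sets N = sets M" and spN: "space N = space M" by (auto simp: N_def)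
  have eN: "emeasure N A = ennreal (t A)" if "A \<in> sets M" for A
    unfolding N_def by (rule emeasure_measure_of_sigma[OF sets.sigma_algebra_axioms pos ca that])
  have fN: "finite_measure N"
    by (rule finite_measureI) (simp add: spN eN)
  have "absolutely_continuous M N"
    unfolding absolutely_continuous_def
  proof
    fix A assume A: "A \<in> null_sets M"
    then have m: "A \<in> sets M" "measure M A = 0" by (auto simp: measure_def)
    have "t A \<le> 0 + e" if "e > 0" for e
      using ac[OF that] m by fastforce
    then have "t A \<le> 0" by (rule field_le_epsilon)
    then have "t A = 0" using nonneg[OF m(1)] by simp
    then show "A \<in> null_sets N" using eN[OF m(1)] m(1) by (auto simp: null_sets_def)
  qed
  then obtain D where D: "D \<in> borel_measurable M" "AE x in M. RN_deriv M N x = ennreal (D x)" "\<And>x. 0 \<le> D x"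
    and dens: "density M (RN_deriv M N) = N"
    using real_RN_deriv[OF fN _ sN] density_RN_deriv[OF _ sN] by metis
  have nn: "ennreal (t A) = (\<integral>\<^sup>+x. ennreal (indicator A x * D x) \<partial>M)" if A: "A \<in> sets M" for A
  proof -
    have "ennreal (t A) = emeasure (density M (RN_deriv M N)) A" using eN[OF A] dens by simp
    also have "\<dots> = (\<integral>\<^sup>+x. RN_deriv M N x * indicator A x \<partial>M)" using A by (intro emeasure_density) auto
    also have "\<dots> = (\<integral>\<^sup>+x. ennreal (indicator A x * D x) \<partial>M)"
      by (rule nn_integral_cong_AE) (use D(2) in \<open>eventually_elim, auto simp: indicator_def\<close>)
    finally show ?thesis .
  qed
  have "integrable M D"
  proof (rule integrableI_nn_integral_finite)
    have "(\<integral>\<^sup>+x. ennreal (D x) \<partial>M) = (\<integral>\<^sup>+x. ennreal (indicator (space M) x * D x) \<partial>M)"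
      by (rule nn_integral_cong) simp
    then show "(\<integral>\<^sup>+x. ennreal (D x) \<partial>M) = ennreal (t (space M))" using nn[of "space M"] by simp
  qed (use D in auto)
  moreover have "t A = (LINT x:A|M. D x)" if A: "A \<in> sets M" for A
  proof -
    have "(LINT x:A|M. D x) = enn2real (\<integral>\<^sup>+x. ennreal (indicator A x * D x) \<partial>M)"
      unfolding set_lebesgue_integral_def real_scaleR_def
      using D(1,3) A by (intro integral_eq_nn_integral) auto
    also have "\<dots> = t A" using nn[OF A, symmetric] nonneg[OF A] by simp
    finally show ?thesis by simp
  qed
  ultimately show thesis by (rule that)
qed

lemma exists_near_minimizer:
  fixes F :: "'b \<Rightarrow> real"
  assumes "S \<noteq> {}" "\<And>x. x \<in> S \<Longrightarrow> 0 \<le> F x" "e > 0"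
  shows "\<exists>x\<in>S. \<forall>y\<in>S. F x \<le> F y + e"
proof -
  have bdd: "bdd_below (F ` S)" using assms(2) by (intro bdd_belowI[of _ 0]) auto
  have "Inf (F ` S) < Inf (F ` S) + e" using assms(3) by simp
  then obtain x where x: "x \<in> S" "F x < Inf (F ` S) + e"
    using cInf_less_iff[of "F ` S" "Inf (F ` S) + e"] assms(1) bdd by auto
  then show ?thesis
    using cInf_lower[OF _ bdd] by (intro bexI[of _ x]) fastforce+
qed

lemma sgn_inner_self: "sgn v \<bullet> v = norm (v :: 'b::real_inner)"
  by (cases "v = 0") (auto simp: sgn_div_norm dot_square_norm power2_eq_square)

lemma disjoint_indicator_sum_norm_le:
  fixes e :: "'i \<Rightarrow> 'b::real_normed_vector"
  assumes "finite I" "disjoint_family_on A I" "\<And>i. i \<in> I \<Longrightarrow> norm (e i) \<le> 1"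
  shows "norm (\<Sum>i\<in>I. indicator (A i) x *\<^sub>R e i) \<le> 1"
proof (cases "\<exists>j\<in>I. x \<in> A j")
  case True
  then obtain j where j: "j \<in> I" "x \<in> A j" by blast
  have "(\<Sum>i\<in>I. indicator (A i) x *\<^sub>R e i) = (\<Sum>i\<in>I. if i = j then e i else 0)"
    using j assms(2) by (intro sum.cong) (auto simp: indicator_def disjoint_family_on_def)
  then show ?thesis using j assms(1,3) by simp
next
  case False
  then have "(\<Sum>i\<in>I. indicator (A i) x *\<^sub>R e i) = 0" by (intro sum.neutral) auto
  then show ?thesis by simp
qed

section \<open>Representing measures and decomposition of finitely additive measures\<close>

context bounded_open
begin

text \<open>The representing measure in the identification of \<open>ba\<close> with the dual of the
  bounded fields; \<open>ba_integral_functional_measure\<close> confirms it.\<close>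

definition functional_measure :: "(('a \<Rightarrow> 'a) \<Rightarrow> real) \<Rightarrow> 'a set \<Rightarrow> 'a" where
  "functional_measure T A = (\<Sum>b\<in>Basis. T (\<lambda>x. indicator A x *\<^sub>R b) *\<^sub>R b)"

lemma Linf_indicator_scaleR [intro]: "A \<in> sets M \<Longrightarrow> (\<lambda>x. indicator A x *\<^sub>R (c :: 'a)) \<in> Linf \<Omega>"
  by (intro Linf_scaleR_fun Linf_indicator Linf_const)

lemma inner_functional_measure:
  assumes T: "Linf_functional \<Omega> T C" and A: "A \<in> sets M"
  shows "T (\<lambda>x. indicator A x *\<^sub>R c) = c \<bullet> functional_measure T A"
proof -
  have "(\<lambda>x. indicator A x *\<^sub>R c) = (\<lambda>x. \<Sum>b\<in>Basis. (c \<bullet> b) *\<^sub>R indicator A x *\<^sub>R b)"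
  proof
    fix x
    have "indicator A x *\<^sub>R c = indicator A x *\<^sub>R (\<Sum>b\<in>Basis. (c \<bullet> b) *\<^sub>R b)" by (simp add: euclidean_representation)
    then show "indicator A x *\<^sub>R c = (\<Sum>b\<in>Basis. (c \<bullet> b) *\<^sub>R indicator A x *\<^sub>R b)"
      by (simp add: scaleR_sum_right mult.commute)
  qed
  then have "T (\<lambda>x. indicator A x *\<^sub>R c) = T (\<lambda>x. \<Sum>b\<in>Basis. (c \<bullet> b) *\<^sub>R indicator A x *\<^sub>R b)"
    by (rule arg_cong)
  also have "\<dots> = (\<Sum>b\<in>Basis. T (\<lambda>x. (c \<bullet> b) *\<^sub>R indicator A x *\<^sub>R b))"
    by (rule Linf_functional_sum[OF T finite_Basis]) (intro Linf_scaleR Linf_indicator_scaleR A)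
  also have "\<dots> = (\<Sum>b\<in>Basis. (c \<bullet> b) * T (\<lambda>x. indicator A x *\<^sub>R b))"
    using A by (intro sum.cong refl Linf_functional_scaleR[OF T]) auto
  also have "\<dots> = c \<bullet> functional_measure T A"
    by (simp add: functional_measure_def inner_sum_right mult.commute)
  finally show ?thesis .
qed

lemma baI:
  assumes add: "\<And>A B. A \<in> sets M \<Longrightarrow> B \<in> sets M \<Longrightarrow> A \<inter> B = {} \<Longrightarrow> \<nu> (A \<union> B) = \<nu> A + \<nu> B"
    and null: "\<And>A. A \<in> null_sets M \<Longrightarrow> \<nu> A = 0"
    and fin: "\<And>A n. range A \<subseteq> sets M \<Longrightarrow> disjoint_family A \<Longrightarrow> (\<Sum>i<(n::nat). norm (\<nu> (A i))) \<le> C"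
  shows "\<nu> \<in> ba \<Omega>"
proof -
  have "total_variation \<Omega> \<nu> \<Omega> \<le> ennreal C"
    by (rule total_variation_leI) (rule fin)
  also have "\<dots> < \<infinity>" by simp
  finally show ?thesis using add null by (simp add: ba_def)
qed

text \<open>For finite variation, put the unit vector in the direction of the measure of
  \<open>A i\<close> on each \<open>A i\<close>. The resulting field has norm at most 1, and
  \<open>T\<close> maps it to the sum of the norms of the measures.\<close>

lemma functional_measure_ba:
  assumes T: "Linf_functional \<Omega> T C"
  shows "functional_measure T \<in> ba \<Omega>"
proof (rule baI)
  fix A B assume AB: "A \<in> sets M" "B \<in> sets M" "A \<inter> B = {}"
  have "T (\<lambda>x. indicator (A \<union> B) x *\<^sub>R b) = T (\<lambda>x. indicator A x *\<^sub>R b) + T (\<lambda>x. indicator B x *\<^sub>R b)" for b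
  proof -
    have "(\<lambda>x. indicator (A \<union> B) x *\<^sub>R b) = (\<lambda>x. indicator A x *\<^sub>R b + indicator B x *\<^sub>R b)"
      using AB(3) by (auto simp: indicator_def fun_eq_iff)
    then show ?thesis
      using Linf_functional_add[OF T Linf_indicator_scaleR[OF AB(1)] Linf_indicator_scaleR[OF AB(2)]] by simp
  qed
  then show "functional_measure T (A \<union> B) = functional_measure T A + functional_measure T B"
    by (simp add: functional_measure_def scaleR_add_left sum.distrib)
next
  fix A assume A: "A \<in> null_sets M"
  have "T (\<lambda>x. indicator A x *\<^sub>R b) = T (\<lambda>x. 0)" for b
  proof (rule Linf_functional_AE_cong[OF T])
    show "AE x in M. indicator A x *\<^sub>R b = 0"
      using AE_not_in[OF A] by eventually_elim simp
  qed (use A in auto)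
  then show "functional_measure T A = 0"
    by (simp add: functional_measure_def Linf_functional_zero[OF T])
next
  fix A :: "nat \<Rightarrow> 'a set" and n assume A: "range A \<subseteq> sets M" "disjoint_family A"
  define e where "e i = sgn (functional_measure T (A i))" for i
  have Ai: "A i \<in> sets M" for i using A by auto
  have "(\<Sum>i<n. norm (functional_measure T (A i))) = (\<Sum>i<n. e i \<bullet> functional_measure T (A i))"
    by (simp add: e_def sgn_inner_self)
  also have "\<dots> = (\<Sum>i<n. T (\<lambda>x. indicator (A i) x *\<^sub>R e i))"
    using inner_functional_measure[OF T Ai] by simp
  also have "\<dots> = T (\<lambda>x. \<Sum>i<n. indicator (A i) x *\<^sub>R e i)"
    using Ai by (intro Linf_functional_sum[OF T, symmetric]) auto
  also have "\<dots> \<le> \<bar>\<dots>\<bar>" by simp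
  also have "\<dots> \<le> C * 1"
  proof (rule Linf_functional_bound[OF T])
    show "(\<lambda>x. \<Sum>i<n. indicator (A i) x *\<^sub>R e i) \<in> Linf \<Omega>" using Ai by (intro Linf_sum) auto
    have "disjoint_family_on A {..<n}" using A(2) by (auto simp: disjoint_family_on_def)
    then show "AE x in M. norm (\<Sum>i<n. indicator (A i) x *\<^sub>R e i) \<le> 1"
      by (intro AE_I2 disjoint_indicator_sum_norm_le) (auto simp: e_def norm_sgn)
  qed simp
  finally show "(\<Sum>i<n. norm (functional_measure T (A i))) \<le> C" by simp
qed

lemma ba_integral_functional_measure:
  "Linf_functional \<Omega> T C \<Longrightarrow> q \<in> Linf \<Omega> \<Longrightarrow> ba_integral \<Omega> (functional_measure T) q = T q"
  by (rule ba_integral_eq_functional[OF functional_measure_ba]) (auto intro: inner_functional_measure)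

text \<open>The sets off which \<open>\<nu>\<close> is absolutely continuous are tails of unions of sets \<open>B m\<close> that nearly minimise
  \<open>|\<nu>|(\<Omega> - B) + 4\<^sup>m |B|\<close>: near minimality gives \<open>|\<nu>|(A) \<le> 4\<^sup>m |A| + 2\<^sup>-\<^sup>m\<close> for every \<open>A\<close> disjoint from \<open>B m\<close>.\<close>

lemma ba_abs_continuous_off_small_sets:
  assumes nu: "\<nu> \<in> ba \<Omega>"
  obtains E :: "nat \<Rightarrow> 'a set" where "range E \<subseteq> sets M" "decseq E" "(\<lambda>n. measure M (E n)) \<longlonglongrightarrow> 0"
    "\<And>n e. e > 0 \<Longrightarrow> \<exists>d>0. \<forall>A\<in>sets M. A \<inter> E n = {} \<and> measure M A < d \<longrightarrow> tv \<nu> A < e"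
proof -
  have "\<exists>B\<in>sets M. \<forall>B'\<in>sets M. tv \<nu> (\<Omega> - B) + 4 ^ m * measure M B \<le> tv \<nu> (\<Omega> - B') + 4 ^ m * measure M B' + (1/2) ^ m"
    for m :: nat
    using exists_near_minimizer[of "sets M" "\<lambda>B. tv \<nu> (\<Omega> - B) + 4 ^ m * measure M B" "(1/2) ^ m"]
    by auto
  then obtain B where B: "\<And>m. B m \<in> sets M"
    "\<And>m B'. B' \<in> sets M \<Longrightarrow> tv \<nu> (\<Omega> - B m) + 4 ^ m * measure M (B m) \<le> tv \<nu> (\<Omega> - B') + 4 ^ m * measure M B' + (1/2) ^ m"
    by metis
  \<comment> \<open>Comparison with the competitor \<open>B' = {}\<close> bounds
    \<open>4 ^ m * measure M (B m)\<close> by the full variation plus \<open>(1/2) ^ m\<close>, and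
    the latter is at most 1.\<close>
  define K where "K = tv \<nu> \<Omega> + 1"
  have small: "measure M (B m) \<le> K * (1/4) ^ m" for m
  proof -
    have "(1/2 :: real) ^ m \<le> 1" by (simp add: power_le_one)
    then have "4 ^ m * measure M (B m) \<le> K"
      unfolding K_def using B(2)[of "{}" m, simplified] tv_nonneg[of \<nu> "\<Omega> - B m"] by linarith
    then show ?thesis by (simp add: field_simps power_divide)
  qed
  have ac: "tv \<nu> A \<le> 4 ^ m * measure M A + (1/2) ^ m" if A: "A \<in> sets M" "A \<inter> B m = {}" for A m
  proof -
    have "tv \<nu> (\<Omega> - B m) = tv \<nu> ((\<Omega> - (B m \<union> A)) \<union> A)"
      using A by (intro arg_cong[where f = "tv \<nu>"]) (auto simp: sets_M)
    also have "\<dots> = tv \<nu> (\<Omega> - (B m \<union> A)) + tv \<nu> A"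
      using A B(1) by (intro tv_add[OF nu]) auto
    finally have 1: "tv \<nu> (\<Omega> - B m) = tv \<nu> (\<Omega> - (B m \<union> A)) + tv \<nu> A" .
    have 2: "measure M (B m \<union> A) = measure M (B m) + measure M A"
      using A B(1) by (intro finite_measure_Union) auto
    \<comment> \<open>Competitor \<open>B m \<union> A\<close>: it lowers the variation term by
      \<open>tv \<nu> A\<close> and raises the measure term by \<open>4 ^ m * measure M A\<close>,
      so near minimality of \<open>B m\<close> is the claim.\<close>
    show ?thesis
      using B(2)[of "B m \<union> A" m] A B(1)[of m] unfolding 1 2 by (simp add: algebra_simps)
  qed
  define E where "E n = (\<Union>m. B (m + n))" for n
  have E: "E n \<in> sets M" for n using B(1) by (auto simp: E_def)
  show thesis
  proof (rule that[of E])
    show "range E \<subseteq> sets M" using E by auto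
    show "decseq E"
    proof (rule decseq_SucI)
      show "E (Suc n) \<subseteq> E n" for n
        unfolding E_def
      proof (rule UN_least)
        fix m
        have "B (m + Suc n) = B (Suc m + n)" by simp
        then show "B (m + Suc n) \<subseteq> (\<Union>m. B (m + n))" by blast
      qed
    qed
    show "(\<lambda>n. measure M (E n)) \<longlonglongrightarrow> 0"
    proof (rule Lim_null_comparison)
      have "measure M (E n) \<le> 2 * K * (1/4) ^ n" for n
      proof -
        have geo: "(\<lambda>m. K * (1/4) ^ (m + n)) sums (K * (1/4) ^ n * (4/3))"
          using sums_mult[OF geometric_sums[of "1/4 :: real"], of "K * (1/4) ^ n"]
          by (simp add: power_add mult_ac)
        have sm: "summable (\<lambda>m. measure M (B (m + n)))"
          by (rule summable_comparison_test'[OF sums_summable[OF geo], of 0]) (use small in auto)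
        have "measure M (E n) \<le> (\<Sum>m. measure M (B (m + n)))"
          unfolding E_def using B(1) sm by (intro finite_measure_subadditive_countably) auto
        also have "\<dots> \<le> (\<Sum>m. K * (1/4) ^ (m + n))"
          by (intro suminf_le sm sums_summable[OF geo] small)
        also have "\<dots> = K * (1/4) ^ n * (4/3)" using geo by (rule sums_unique[symmetric])
        also have "\<dots> \<le> 2 * K * (1/4) ^ n"
          using tv_nonneg[of \<nu> \<Omega>] by (simp add: K_def)
        finally show ?thesis .
      qed
      then show "\<forall>\<^sub>F n in sequentially. norm (measure M (E n)) \<le> 2 * K * (1/4) ^ n" by simp
      show "(\<lambda>n. 2 * K * (1/4) ^ n) \<longlonglongrightarrow> 0"
        by (intro tendsto_mult_right_zero LIMSEQ_power_zero) simp
    qed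
    fix n :: nat and e :: real assume "e > 0"
    have "(\<lambda>m. (1/2 :: real) ^ m) \<longlonglongrightarrow> 0" by (intro LIMSEQ_power_zero) simp
    then have "\<forall>\<^sub>F m in sequentially. (1/2 :: real) ^ m < e / 2" using \<open>e > 0\<close> by (intro order_tendstoD) auto
    then obtain k where "\<And>m. m \<ge> k \<Longrightarrow> (1/2 :: real) ^ m < e / 2"
      unfolding eventually_sequentially by blast
    then obtain m where m: "m \<ge> n" "(1/2 :: real) ^ m < e / 2"
      using max.cobounded1 max.cobounded2 by blast
    \<comment> \<open>The threshold makes the term \<open>4 ^ m * measure M A\<close> smaller than
      \<open>e / 2\<close>; the choice of \<open>m\<close> does the same for
      \<open>(1/2) ^ m\<close>.\<close>
    show "\<exists>d>0. \<forall>A\<in>sets M. A \<inter> E n = {} \<and> measure M A < d \<longrightarrow> tv \<nu> A < e"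
    proof (intro exI[of _ "e / 2 / 4 ^ m"] conjI ballI impI)
      show "e / 2 / 4 ^ m > 0" using \<open>e > 0\<close> by simp
      fix A assume A: "A \<in> sets M" "A \<inter> E n = {} \<and> measure M A < e / 2 / 4 ^ m"
      have "B m = B ((m - n) + n)" using m(1) by simp
      then have "B m \<subseteq> E n" unfolding E_def by blast
      then have "tv \<nu> A \<le> 4 ^ m * measure M A + (1/2) ^ m" using A by (intro ac) auto
      also have "4 ^ m * measure M A < e / 2" using A(2) by (simp add: field_simps)
      finally show "tv \<nu> A < e" using m(2) by simp
    qed
  qed
qed

text \<open>\<open>\<tau> (A - E n)\<close> increases with \<open>n\<close> and is bounded, so it
  has a limit \<open>t A\<close>. The limit is absolutely continuous because the variation left
  between \<open>E n\<close> and \<open>E m\<close> is uniformly small, so one fixed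
  \<open>n\<close> controls all \<open>m \<ge> n\<close>. The factor 2 in the bound fits the later
  choice of \<open>\<tau>\<close> as a component of \<open>\<nu>\<close> plus
  \<open>tv \<nu>\<close>.\<close>

lemma additive_le_tv_has_density:
  fixes \<tau> :: "'a set \<Rightarrow> real"
  assumes nu: "\<nu> \<in> ba \<Omega>" and E: "range E \<subseteq> sets M" "decseq E"
    and ac: "\<And>n e. e > 0 \<Longrightarrow> \<exists>d>0. \<forall>A\<in>sets M. A \<inter> E n = {} \<and> measure M A < d \<longrightarrow> tv \<nu> A < e"
    and add: "\<And>A B. A \<in> sets M \<Longrightarrow> B \<in> sets M \<Longrightarrow> A \<inter> B = {} \<Longrightarrow> \<tau> (A \<union> B) = \<tau> A + \<tau> B"
    and bnd: "\<And>A. A \<in> sets M \<Longrightarrow> 0 \<le> \<tau> A \<and> \<tau> A \<le> 2 * tv \<nu> A"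
  obtains h where "integrable M h" "\<And>A. A \<in> sets M \<Longrightarrow> (\<lambda>n. \<tau> (A - E n)) \<longlonglongrightarrow> (LINT x:A|M. h x)"
proof -
  have En: "E n \<in> sets M" for n using E(1) by auto
  have Edec: "E m \<subseteq> E n" if "n \<le> m" for m n using E(2) that by (auto simp: decseq_def)
  have diff: "\<tau> (A - E m) = \<tau> (A - E n) + \<tau> (A \<inter> (E n - E m))" if "A \<in> sets M" "n \<le> m" for A m n
  proof -
    have eq: "A - E m = (A - E n) \<union> (A \<inter> (E n - E m))" using Edec[OF that(2)] by auto
    show ?thesis unfolding eq by (rule add) (use that En in auto)
  qed
  \<comment> \<open>Kept general in \<open>\<rho>\<close>: it is used for \<open>\<tau>\<close> and
    again for the variation \<open>tv \<nu>\<close> itself.\<close>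
  have conv: "convergent (\<lambda>n. \<rho> (A - E n))" if A: "A \<in> sets M"
    and diff: "\<And>m n. n \<le> m \<Longrightarrow> \<rho> (A - E m) = \<rho> (A - E n) + \<rho> (A \<inter> (E n - E m))"
    and bnd: "\<And>A. A \<in> sets M \<Longrightarrow> 0 \<le> \<rho> A \<and> \<rho> A \<le> 2 * tv \<nu> A" for A and \<rho> :: "'a set \<Rightarrow> real"
  proof (rule Bseq_mono_convergent)
    show "\<forall>m. \<forall>n\<ge>m. \<rho> (A - E m) \<le> \<rho> (A - E n)"
    proof (intro allI impI)
      fix m n :: nat assume "m \<le> n"
      have "A \<inter> (E m - E n) \<in> sets M" using A En by auto
      then have "0 \<le> \<rho> (A \<inter> (E m - E n))" using bnd by simp
      then show "\<rho> (A - E m) \<le> \<rho> (A - E n)" using diff[OF \<open>m \<le> n\<close>] by simp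
    qed
    show "Bseq (\<lambda>n. \<rho> (A - E n))"
    proof (rule BseqI')
      fix n
      have S: "A - E n \<in> sets M" "A - E n \<subseteq> \<Omega>" using A En by (auto simp: sets_M)
      show "norm (\<rho> (A - E n)) \<le> 2 * tv \<nu> \<Omega>"
        using bnd[OF S(1)] tv_mono[OF nu S(1) dom_sets S(2)] by simp
    qed
  qed
  define t where "t A = lim (\<lambda>n. \<tau> (A - E n))" for A
  have t: "(\<lambda>n. \<tau> (A - E n)) \<longlonglongrightarrow> t A" if "A \<in> sets M" for A
    using conv[of A \<tau>, OF that diff[OF that] bnd] unfolding t_def by (simp add: convergent_LIMSEQ_iff)
  have Em: "tv \<nu> (\<Omega> - E m) = tv \<nu> (\<Omega> - E n) + tv \<nu> (\<Omega> \<inter> (E n - E m))" if "n \<le> m" for m n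
  proof -
    have eq: "\<Omega> - E m = (\<Omega> - E n) \<union> (\<Omega> \<inter> (E n - E m))" using Edec[OF that] by auto
    show ?thesis unfolding eq by (rule tv_add[OF nu]) (use En in auto)
  qed
  have "convergent (\<lambda>n. tv \<nu> (\<Omega> - E n))"
    by (rule conv[OF dom_sets Em]) simp_all
  then have cauchy: "Cauchy (\<lambda>n. tv \<nu> (\<Omega> - E n))" by (rule convergent_Cauchy)
  obtain h where h: "integrable M h" "\<And>A. A \<in> sets M \<Longrightarrow> t A = (LINT x:A|M. h x)"
  proof (rule density_of_abs_continuous_additive)
    fix A assume A: "A \<in> sets M"
    show "0 \<le> t A"
      using t[OF A] by (rule LIMSEQ_le_const) (use bnd A En in blast)
  next
    fix A B assume AB: "A \<in> sets M" "B \<in> sets M" "A \<inter> B = {}"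
    have "\<tau> (A \<union> B - E n) = \<tau> (A - E n) + \<tau> (B - E n)" for n
    proof -
      have eq: "A \<union> B - E n = (A - E n) \<union> (B - E n)" by auto
      show ?thesis unfolding eq by (rule add) (use AB En in auto)
    qed
    then have "(\<lambda>n. \<tau> (A \<union> B - E n)) \<longlonglongrightarrow> t A + t B"
      using t[OF AB(1)] t[OF AB(2)] by (simp add: tendsto_add)
    then show "t (A \<union> B) = t A + t B"
      using t[of "A \<union> B"] AB LIMSEQ_unique by blast
  next
    fix e :: real assume "e > 0"
    \<comment> \<open>Two pieces of variation below \<open>e / 8\<close> each and the factor 2 in
      \<open>bnd\<close> give at most \<open>e / 2\<close>, which keeps the inequality strict after
      the limit.\<close>
    then have e8: "e / 8 > 0" by simp
    obtain n where n: "\<And>m. m \<ge> n \<Longrightarrow> \<bar>tv \<nu> (\<Omega> - E m) - tv \<nu> (\<Omega> - E n)\<bar> < e / 8"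
      using CauchyD[OF cauchy e8] by fastforce
    obtain d where d: "d > 0" "\<forall>A\<in>sets M. A \<inter> E n = {} \<and> measure M A < d \<longrightarrow> tv \<nu> A < e / 8"
      using ac[OF e8] by blast
    have "t A < e" if A: "A \<in> sets M" "measure M A < d" for A
    proof -
      have "\<tau> (A - E m) \<le> e / 2" if "m \<ge> n" for m
      proof -
        have S: "A - E n \<in> sets M" "A \<inter> (E n - E m) \<in> sets M" "\<Omega> \<inter> (E n - E m) \<in> sets M" using A En by auto
        have "measure M (A - E n) \<le> measure M A" using A by (intro finite_measure_mono) auto
        then have 1: "tv \<nu> (A - E n) < e / 8" using d(2) S(1) A(2) by auto
        have "tv \<nu> (A \<inter> (E n - E m)) \<le> tv \<nu> (\<Omega> \<inter> (E n - E m))"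
          using A by (intro tv_mono[OF nu S(2,3)]) (auto simp: sets_M)
        also have "\<dots> < e / 8" using n[OF that] Em[OF that] by simp
        finally have 2: "tv \<nu> (A \<inter> (E n - E m)) < e / 8" .
        show ?thesis
          using diff[OF A(1) that] bnd[OF S(1)] bnd[OF S(2)] 1 2 by linarith
      qed
      then have "t A \<le> e / 2"
        using t[OF A(1)] by (intro LIMSEQ_le_const2) auto
      then show ?thesis using \<open>e > 0\<close> by simp
    qed
    then show "\<exists>d>0. \<forall>A\<in>sets M. measure M A < d \<longrightarrow> t A < e" using d(1) by blast
  qed (erule that, assumption)
  show thesis
    by (rule that[OF h(1)]) (use t h(2) in simp)
qed

text \<open>A component of \<open>\<nu>\<close> may change sign, so \<open>tv \<nu>\<close> is added
  to make it nonnegative; subtracting the density of \<open>tv \<nu>\<close> afterwards recovers the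
  density of the component. What remains of \<open>\<nu>\<close> vanishes off every
  \<open>E n\<close> and is therefore singular.\<close>

lemma yosida_hewitt_exists:
  assumes nu: "\<nu> \<in> ba \<Omega>"
  shows "\<exists>y \<nu>s. yosida_hewitt \<Omega> \<nu> y \<nu>s"
proof -
  obtain E :: "nat \<Rightarrow> 'a set" where E: "range E \<subseteq> sets M" "decseq E" "(\<lambda>n. measure M (E n)) \<longlonglongrightarrow> 0"
    and ac: "\<And>n e. e > 0 \<Longrightarrow> \<exists>d>0. \<forall>A\<in>sets M. A \<inter> E n = {} \<and> measure M A < d \<longrightarrow> tv \<nu> A < e"
    using ba_abs_continuous_off_small_sets[OF nu] by blast
  have En: "E n \<in> sets M" for n using E(1) by auto
  have "\<exists>h. integrable M h \<and> (\<forall>A\<in>sets M. (\<lambda>n. \<nu> (A - E n) \<bullet> b + tv \<nu> (A - E n)) \<longlonglongrightarrow> (LINT x:A|M. h x))"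
    if b: "b \<in> Basis" for b
  proof (rule additive_le_tv_has_density[OF nu E(1,2) ac])
    fix A assume A: "A \<in> sets M"
    have "\<bar>\<nu> A \<bullet> b\<bar> \<le> tv \<nu> A" using Basis_le_norm[OF b, of "\<nu> A"] norm_le_tv[OF nu A] by simp
    then show "0 \<le> \<nu> A \<bullet> b + tv \<nu> A \<and> \<nu> A \<bullet> b + tv \<nu> A \<le> 2 * tv \<nu> A" by linarith
  next
    fix A B assume "A \<in> sets M" "B \<in> sets M" "A \<inter> B = {}"
    then show "\<nu> (A \<union> B) \<bullet> b + tv \<nu> (A \<union> B) = (\<nu> A \<bullet> b + tv \<nu> A) + (\<nu> B \<bullet> b + tv \<nu> B)"
      using ba_add[OF nu] tv_add[OF nu] by (simp add: inner_add_left)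
  qed (assumption | blast)+
  then have "\<forall>b\<in>Basis. \<exists>h. integrable M h \<and> (\<forall>A\<in>sets M. (\<lambda>n. \<nu> (A - E n) \<bullet> b + tv \<nu> (A - E n)) \<longlonglongrightarrow> (LINT x:A|M. h x))"
    by blast
  from bchoice[OF this] obtain h where h: "\<And>b. b \<in> Basis \<Longrightarrow> integrable M (h b)"
    "\<And>b A. b \<in> Basis \<Longrightarrow> A \<in> sets M \<Longrightarrow> (\<lambda>n. \<nu> (A - E n) \<bullet> b + tv \<nu> (A - E n)) \<longlonglongrightarrow> (LINT x:A|M. h b x)"
    by auto
  obtain h0 where h0: "integrable M h0" "\<And>A. A \<in> sets M \<Longrightarrow> (\<lambda>n. tv \<nu> (A - E n)) \<longlonglongrightarrow> (LINT x:A|M. h0 x)"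
    by (rule additive_le_tv_has_density[OF nu E(1,2) ac tv_add[OF nu]]) auto
  define y where "y x = (\<Sum>b\<in>Basis. (h b x - h0 x) *\<^sub>R b)" for x
  have y: "integrable M y"
    unfolding y_def using h(1) h0(1) by (intro Bochner_Integration.integrable_sum integrable_scaleR_left Bochner_Integration.integrable_diff) auto
  have yA: "integrable M (\<lambda>x. indicator A x *\<^sub>R y x)" if "A \<in> sets M" for A
    using that y by (intro integrable_mult_indicator)
  have lim: "(\<lambda>n. \<nu> (A - E n)) \<longlonglongrightarrow> (LINT x:A|M. y x)" if A: "A \<in> sets M" for A
  proof (rule iffD2[OF tendsto_componentwise_iff], rule ballI)
    fix b :: 'a assume b: "b \<in> Basis"
    have "(LINT x:A|M. y x) \<bullet> b = (LINT x|M. (indicator A x *\<^sub>R y x) \<bullet> b)"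
      unfolding set_lebesgue_integral_def using integral_inner_left[OF yA[OF A], of b] by simp
    also have "\<dots> = (LINT x:A|M. h b x - h0 x)"
      unfolding set_lebesgue_integral_def y_def using b by (simp add: inner_sum_left_Basis)
    also have "\<dots> = (LINT x:A|M. h b x) - (LINT x:A|M. h0 x)"
      using h(1)[OF b] h0(1) A by (intro set_integral_diff) (simp_all only: set_integrable_def integrable_mult_indicator)
    finally have "(LINT x:A|M. y x) \<bullet> b = (LINT x:A|M. h b x) - (LINT x:A|M. h0 x)" .
    then show "(\<lambda>n. \<nu> (A - E n) \<bullet> b) \<longlonglongrightarrow> (LINT x:A|M. y x) \<bullet> b"
      using tendsto_diff[OF h(2)[OF b A] h0(2)[OF A]] by simp
  qed
  \<comment> \<open>Used twice: the integral of \<open>y\<close> vanishes on null sets, and the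
    remainder keeps finite variation.\<close>
  have y_le: "norm (LINT x:A|M. y x) \<le> tv \<nu> A" if A: "A \<in> sets M" for A
  proof (rule LIMSEQ_le_const2[OF tendsto_norm[OF lim[OF A]]], intro exI allI impI)
    fix n
    have S: "A - E n \<in> sets M" using A En by auto
    show "norm (\<nu> (A - E n)) \<le> tv \<nu> A"
      using norm_le_tv[OF nu S] tv_mono[OF nu S A] by auto
  qed
  define \<nu>s where "\<nu>s A = \<nu> A - (LINT x:A|M. y x)" for A
  have "\<nu>s \<in> ba \<Omega>"
  proof (rule baI)
    fix A B assume AB: "A \<in> sets M" "B \<in> sets M" "A \<inter> B = {}"
    have "(LINT x:A \<union> B|M. y x) = (LINT x:A|M. y x) + (LINT x:B|M. y x)"
      using AB yA by (intro set_integral_Un) (auto simp: set_integrable_def)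
    then show "\<nu>s (A \<union> B) = \<nu>s A + \<nu>s B"
      using ba_add[OF nu AB] by (simp add: \<nu>s_def)
  next
    fix A assume A: "A \<in> null_sets M"
    have "norm (LINT x:A|M. y x) \<le> 0" using y_le[of A] tv_null[OF nu A] A by auto
    then show "\<nu>s A = 0" using ba_null[OF nu A] by (simp add: \<nu>s_def)
  next
    fix A :: "nat \<Rightarrow> 'a set" and n assume A: "range A \<subseteq> sets M" "disjoint_family A"
    then have Ai: "A i \<in> sets M" for i by auto
    have "(\<Sum>i<n. norm (\<nu>s (A i))) \<le> (\<Sum>i<n. 2 * tv \<nu> (A i))"
    proof (rule sum_mono)
      fix i
      have "norm (\<nu>s (A i)) \<le> norm (\<nu> (A i)) + norm (LINT x:A i|M. y x)"
        unfolding \<nu>s_def by (rule norm_triangle_ineq4)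
      then show "norm (\<nu>s (A i)) \<le> 2 * tv \<nu> (A i)"
        using norm_le_tv[OF nu Ai[of i]] y_le[OF Ai[of i]] by linarith
    qed
    also have "\<dots> = 2 * tv \<nu> (\<Union>i<n. A i)"
    proof -
      have "disjoint_family_on A {..<n}" using A(2) by (auto simp: disjoint_family_on_def)
      then show ?thesis using tv_UN[OF nu _ _ Ai, of "{..<n}"] by (simp add: sum_distrib_left)
    qed
    also have "\<dots> \<le> 2 * tv \<nu> \<Omega>"
    proof -
      have "(\<Union>i<n. A i) \<in> sets M" using Ai by auto
      then show ?thesis using tv_mono[OF nu _ dom_sets, of "\<Union>i<n. A i"] by (simp add: sets_M)
    qed
    finally show "(\<Sum>i<n. norm (\<nu>s (A i))) \<le> 2 * tv \<nu> \<Omega>" .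
  qed
  moreover have "ba_singular \<Omega> \<nu>s"
    unfolding ba_singular_def
  proof (intro exI[of _ E] conjI allI E(1,2))
    show "(\<lambda>n. emeasure M (E n)) \<longlonglongrightarrow> 0"
      using tendsto_ennrealI[OF E(3)] by (simp add: emeasure_eq_measure)
    fix n
    \<comment> \<open>For such \<open>A\<close> the sets \<open>A - E m\<close> equal
      \<open>A\<close> from \<open>m = n\<close> on, so the limit defining the density already
      accounts for all of \<open>\<nu> A\<close>.\<close>
    have zero: "\<nu>s A = 0" if A: "A \<in> sets M" "A \<inter> E n = {}" for A
    proof -
      have "A - E m = A" if "m \<ge> n" for m
        using A(2) E(2) that by (auto simp: decseq_def)
      then have "\<forall>\<^sub>F m in sequentially. \<nu> (A - E m) = \<nu> A"
        unfolding eventually_sequentially by (intro exI[of _ n]) simp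
      then have "(\<lambda>m. \<nu> (A - E m)) \<longlonglongrightarrow> \<nu> A" by (rule tendsto_eventually)
      then have "\<nu> A = (LINT x:A|M. y x)" using lim[OF A(1)] LIMSEQ_unique by blast
      then show ?thesis by (simp add: \<nu>s_def)
    qed
    show "total_variation \<Omega> \<nu>s (\<Omega> - E n) = 0"
      by (rule total_variation_eq_0I) (auto intro: zero)
  qed
  ultimately have "yosida_hewitt \<Omega> \<nu> y \<nu>s"
    unfolding yosida_hewitt_def using y by (simp add: \<nu>s_def)
  then show ?thesis by blast
qed

lemma yosida_hewitt_parts:
  assumes "\<nu> \<in> ba \<Omega>"
  shows "yosida_hewitt \<Omega> \<nu> (ac_part \<Omega> \<nu>) (sing_part \<Omega> \<nu>)"
proof -
  have "\<exists>\<nu>s. yosida_hewitt \<Omega> \<nu> (ac_part \<Omega> \<nu>) \<nu>s"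
    unfolding ac_part_def using yosida_hewitt_exists[OF assms] by (rule someI_ex)
  then show ?thesis
    unfolding sing_part_def by (rule someI_ex)
qed

end

section \<open>A Hahn--Banach theorem for convex cones of inequalities\<close>

text \<open>A pair \<open>(q, r)\<close> encodes the constraint \<open>T q \<le> r\<close> on the linear functional \<open>T\<close> to be constructed.\<close>

definition constraint_cone :: "('x \<Rightarrow> 'v::real_vector) set \<Rightarrow> (('x \<Rightarrow> 'v) \<times> real) set \<Rightarrow> bool" where
  "constraint_cone X S \<longleftrightarrow> S \<subseteq> X \<times> UNIV \<and>
     (\<forall>q r q' r'. (q, r) \<in> S \<longrightarrow> (q', r') \<in> S \<longrightarrow> ((\<lambda>x. q x + q' x), r + r') \<in> S) \<and>
     (\<forall>q r c. (q, r) \<in> S \<longrightarrow> c \<ge> 0 \<longrightarrow> ((\<lambda>x. c *\<^sub>R q x), c * r) \<in> S) \<and>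
     (\<forall>r. ((\<lambda>x. 0), r) \<in> S \<longrightarrow> r \<ge> 0)"

lemma constraint_cone_Union:
  assumes C: "C \<noteq> {}" "subset.chain {S. constraint_cone X S \<and> R \<subseteq> S} C"
  shows "constraint_cone X (\<Union>C) \<and> R \<subseteq> \<Union>C"
proof -
  have cone: "constraint_cone X S" "R \<subseteq> S" if "S \<in> C" for S
    using C(2) that by (auto simp: subset.chain_def)
  have dir: "S \<subseteq> S' \<or> S' \<subseteq> S" if "S \<in> C" "S' \<in> C" for S S'
    using C(2) that by (auto simp: subset_chain_def)
  have "((\<lambda>x. q x + q' x), r + r') \<in> \<Union>C" if "(q, r) \<in> \<Union>C" "(q', r') \<in> \<Union>C" for q r q' r'
  proof -
    obtain S S' where S: "S \<in> C" "S' \<in> C" "(q, r) \<in> S" "(q', r') \<in> S'" using \<open>(q, r) \<in> \<Union>C\<close> \<open>(q', r') \<in> \<Union>C\<close> by blast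
    then obtain S'' where "S'' \<in> C" "(q, r) \<in> S''" "(q', r') \<in> S''" using dir[OF S(1,2)] by blast
    then show ?thesis using cone[of S''] unfolding constraint_cone_def by blast
  qed
  moreover have "((\<lambda>x. c *\<^sub>R q x), c * r) \<in> \<Union>C" if "(q, r) \<in> \<Union>C" "c \<ge> 0" for q r c
    using that cone unfolding constraint_cone_def by blast
  moreover have "r \<ge> 0" if "((\<lambda>x. 0), r) \<in> \<Union>C" for r
    using that cone unfolding constraint_cone_def by blast
  moreover have "\<Union>C \<subseteq> X \<times> UNIV" using cone unfolding constraint_cone_def by blast
  moreover have "R \<subseteq> \<Union>C" using C(1) cone(2) by blast
  ultimately show ?thesis unfolding constraint_cone_def by blast
qed

text \<open>Zorn's lemma gives a maximal consistent system of constraints. In it the best upper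
  bound for \<open>q\<close> is also a lower bound, since otherwise the opposite constraint could
  still be added. The best bounds are then odd as well as sublinear, hence linear.\<close>

lemma Hahn_Banach_cone:
  fixes X :: "('x \<Rightarrow> 'v::real_vector) set"
  assumes X: "\<And>q r c. q \<in> X \<Longrightarrow> r \<in> X \<Longrightarrow> (\<lambda>x. q x + c *\<^sub>R r x) \<in> X" "(\<lambda>x. 0) \<in> X"
    and R: "constraint_cone X R" and total: "\<And>q. q \<in> X \<Longrightarrow> \<exists>r. (q, r) \<in> R"
  obtains T where "\<And>q r c. q \<in> X \<Longrightarrow> r \<in> X \<Longrightarrow> T (\<lambda>x. q x + c *\<^sub>R r x) = T q + c * T r"
    "\<And>q r. (q, r) \<in> R \<Longrightarrow> T q \<le> r"
proof -
  let ?A = "{S. constraint_cone X S \<and> R \<subseteq> S}"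
  have "\<exists>S\<in>?A. \<forall>S'\<in>?A. S \<subseteq> S' \<longrightarrow> S' = S"
  proof (rule subset_Zorn_nonempty)
    show "?A \<noteq> {}" using R by blast
    show "\<Union>C \<in> ?A" if "C \<noteq> {}" "subset.chain ?A C" for C
      using constraint_cone_Union[OF that] by simp
  qed
  then obtain S where S': "S \<in> ?A" "\<forall>S'\<in>?A. S \<subseteq> S' \<longrightarrow> S' = S" by (rule bexE)
  have S: "constraint_cone X S" "R \<subseteq> S" using S'(1) by simp_all
  have maxS: "S' = S" if "constraint_cone X S'" "S \<subseteq> S'" for S'
  proof -
    have "S' \<in> ?A" using that(1) subset_trans[OF S(2) that(2)] by (intro CollectI conjI)
    from S'(2)[rule_format, OF this that(2)] show ?thesis .
  qed
  have SX: "q \<in> X" if "(q, r) \<in> S" for q r using S(1) that by (auto simp: constraint_cone_def)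
  have Sadd: "((\<lambda>x. q x + q' x), r + r') \<in> S" if "(q, r) \<in> S" "(q', r') \<in> S" for q r q' r'
    using S(1) that by (auto simp: constraint_cone_def)
  have Sscale: "((\<lambda>x. c *\<^sub>R q x), c * r) \<in> S" if "(q, r) \<in> S" "c \<ge> 0" for q r c
    using S(1) that by (auto simp: constraint_cone_def)
  have S0: "r \<ge> 0" if "((\<lambda>x. 0), r) \<in> S" for r
    using S(1) that by (auto simp: constraint_cone_def)
  have Xscale: "(\<lambda>x. c *\<^sub>R q x) \<in> X" if "q \<in> X" for q c using X(1)[OF X(2) that, of c] by simp
  have zero: "((\<lambda>x. 0), 0) \<in> S"
  proof -
    obtain r where "((\<lambda>x. 0), r) \<in> S" using total[OF X(2)] S(2) by blast
    from Sscale[OF this, of 0] show ?thesis by simp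
  qed
  \<comment> \<open>The sharpest upper bound on \<open>T q\<close> in the system, and the future
    value of \<open>T q\<close>. The infimum is over a set bounded below because \<open>- q\<close>
    is constrained as well.\<close>
  define p where "p q = Inf {r. (q, r) \<in> S}" for q
  have ne: "{r. (q, r) \<in> S} \<noteq> {}" if "q \<in> X" for q using total[OF that] S(2) by blast
  have opp: "r + r' \<ge> 0" if "(q, r) \<in> S" "((\<lambda>x. - q x), r') \<in> S" for q r r'
    using S0 Sadd[OF that] by simp
  have Xneg: "(\<lambda>x. - q x) \<in> X" if "q \<in> X" for q using Xscale[OF that, of "-1"] by simp
  have bdd: "bdd_below {r. (q, r) \<in> S}" if q: "q \<in> X" for q
  proof -
    obtain r' where "((\<lambda>x. - q x), r') \<in> S" using ne[OF Xneg[OF q]] by blast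
    then have "- r' \<le> r" if "(q, r) \<in> S" for r using opp[OF that] by fastforce
    then show ?thesis by (intro bdd_belowI[of _ "- r'"]) auto
  qed
  have p_le: "p q \<le> r" if "(q, r) \<in> S" for q r
    unfolding p_def using that SX by (intro cInf_lower bdd) auto
  have neg: "((\<lambda>x. - q x), - p q) \<in> S" if q: "q \<in> X" for q
  proof -
    \<comment> \<open>The cone generated by the system and the additional constraint
      \<open>T (- q) \<le> - p q\<close>.\<close>
    define S' where "S' = {((\<lambda>x. a x - s *\<^sub>R q x), r - s * p q) | a s r. (a, r) \<in> S \<and> s \<ge> 0}"
    have S'I: "((\<lambda>x. a x - s *\<^sub>R q x), r - s * p q) \<in> S'" if "(a, r) \<in> S" "s \<ge> 0" for a s r
      using that unfolding S'_def by blast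
    have "constraint_cone X S'"
      unfolding constraint_cone_def
    proof (intro conjI allI impI)
      have "(\<lambda>x. a x - s *\<^sub>R q x) \<in> X" if "(a, r) \<in> S" for a r s
        using X(1)[OF SX[OF that] q, of "- s"] by simp
      then show "S' \<subseteq> X \<times> UNIV" unfolding S'_def by blast
    next
      fix q1 r1 q2 r2 assume "(q1, r1) \<in> S'" "(q2, r2) \<in> S'"
      then obtain a1 s1 t1 a2 s2 t2 where *: "(a1, t1) \<in> S" "s1 \<ge> 0" "(a2, t2) \<in> S" "s2 \<ge> 0"
        "q1 = (\<lambda>x. a1 x - s1 *\<^sub>R q x)" "r1 = t1 - s1 * p q" "q2 = (\<lambda>x. a2 x - s2 *\<^sub>R q x)" "r2 = t2 - s2 * p q"
        unfolding S'_def by blast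
      show "((\<lambda>x. q1 x + q2 x), r1 + r2) \<in> S'"
        using S'I[OF Sadd[OF *(1,3)], of "s1 + s2"] *(2,4) unfolding *(5-8)
        by (simp add: algebra_simps)
    next
      fix q1 r1 c assume "(q1, r1) \<in> S'" and c: "(0::real) \<le> c"
      then obtain a1 s1 t1 where *: "(a1, t1) \<in> S" "s1 \<ge> 0"
        "q1 = (\<lambda>x. a1 x - s1 *\<^sub>R q x)" "r1 = t1 - s1 * p q"
        unfolding S'_def by blast
      show "((\<lambda>x. c *\<^sub>R q1 x), c * r1) \<in> S'"
        using S'I[OF Sscale[OF *(1) c], of "c * s1"] *(2) c unfolding *(3,4)
        by (simp add: algebra_simps)
    next
      fix r assume "((\<lambda>x. 0), r) \<in> S'"
      then obtain a s t where *: "(a, t) \<in> S" "s \<ge> 0" "(\<lambda>x. 0) = (\<lambda>x. a x - s *\<^sub>R q x)" "r = t - s * p q"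
        unfolding S'_def by blast
      \<comment> \<open>Consistency of the enlarged system: the combination is zero only if
        \<open>a\<close> is \<open>s\<close> times \<open>q\<close>. For \<open>s > 0\<close> the
        quotient \<open>t / s\<close> is then an upper bound for \<open>q\<close> in the old system,
        hence at least the infimum \<open>p q\<close>.\<close>
      have a: "a = (\<lambda>x. s *\<^sub>R q x)"
        using fun_cong[OF *(3)] by (intro ext) simp
      show "0 \<le> r"
      proof (cases "s = 0")
        case True
        then show ?thesis using S0 *(1,4) a by simp
      next
        case False
        then have "s > 0" using *(2) by simp
        then have "(q, (1 / s) * t) \<in> S"
          using Sscale[OF *(1), of "1 / s"] by (simp add: a)
        then have "p q \<le> (1 / s) * t" by (rule p_le)
        then show ?thesis using \<open>s > 0\<close> *(4) by (simp add: field_simps)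
      qed
    qed
    moreover have "S \<subseteq> S'"
      using S'I[of _ _ 0] by auto
    ultimately have "S' = S" by (rule maxS)
    then show ?thesis using S'I[OF zero, of 1] by simp
  qed
  have p_odd: "p (\<lambda>x. - q x) = - p q" if q: "q \<in> X" for q
  proof (rule antisym)
    show "p (\<lambda>x. - q x) \<le> - p q" using neg[OF q] by (rule p_le)
    show "- p q \<le> p (\<lambda>x. - q x)"
      unfolding p_def[of "\<lambda>x. - q x"]
    proof (rule cInf_greatest[OF ne[OF Xneg[OF q]]])
      fix r assume "r \<in> {r. ((\<lambda>x. - q x), r) \<in> S}"
      moreover have "(q, p q) \<in> S"
      proof -
        have "(q, - p (\<lambda>x. - q x)) \<in> S" using neg[OF Xneg[OF q]] by simp
        moreover have "- p (\<lambda>x. - q x) \<le> t" if "(q, t) \<in> S" for t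
        proof -
          have "- t \<le> p (\<lambda>x. - q x)"
            unfolding p_def[of "\<lambda>x. - q x"] using opp[OF that] by (intro cInf_greatest[OF ne[OF Xneg[OF q]]]) fastforce
          then show ?thesis by simp
        qed
        then have "- p (\<lambda>x. - q x) \<le> p q"
          unfolding p_def[of q] by (intro cInf_greatest[OF ne[OF q]]) auto
        ultimately show ?thesis using p_le[of q "- p (\<lambda>x. - q x)"] by (metis order_antisym)
      qed
      ultimately show "- p q \<le> r" using opp[of q "p q" r] by simp
    qed
  qed
  have signed: "((\<lambda>x. c *\<^sub>R q x), c * p q) \<in> S" if q: "q \<in> X" for q c
  proof (cases "c \<ge> 0")
    case True
    have "(q, p q) \<in> S" using neg[OF Xneg[OF q]] p_odd[OF q] by simp
    then show ?thesis using True by (rule Sscale)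
  next
    case False
    then show ?thesis using Sscale[OF neg[OF q], of "- c"] by simp
  qed
  show thesis
  proof (rule that[of p])
    fix q r c assume q: "q \<in> X" and r: "r \<in> X"
    let ?s = "\<lambda>x. q x + c *\<^sub>R r x"
    have "(?s, p q + c * p r) \<in> S"
      using Sadd[OF signed[OF q, of 1] signed[OF r, of c]] by simp
    then have 1: "p ?s \<le> p q + c * p r" by (rule p_le)
    have "((\<lambda>x. - ?s x), - (p q + c * p r)) \<in> S"
      using Sadd[OF signed[OF q, of "-1"] signed[OF r, of "- c"]] by simp
    moreover have "(?s, p ?s) \<in> S"
      using signed[OF X(1)[OF q r, of c], of 1] by simp
    ultimately have "p ?s + - (p q + c * p r) \<ge> 0" by (intro opp)
    with 1 show "p ?s = p q + c * p r" by simp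
  next
    fix q r assume "(q, r) \<in> R"
    then show "p q \<le> r" using S(2) by (intro p_le) auto
  qed
qed

section \<open>The conjugate of the constrained quadratic energy\<close>

text \<open>Fenchel's inequality for the conjugate of half the squared norm restricted to the ball
  of radius \<open>\<zeta> x\<close>.\<close>

lemma phi_star_fenchel:
  assumes "norm q \<le> \<zeta> x"
  shows "s \<bullet> q - 1/2 * (norm q)\<^sup>2 \<le> phi_star \<zeta> x s"
proof (cases "norm s \<le> \<zeta> x")
  case True
  have "0 \<le> (norm (s - q))\<^sup>2" by simp
  also have "\<dots> = (norm s)\<^sup>2 - 2 * (s \<bullet> q) + (norm q)\<^sup>2"
    by (simp add: power2_norm_eq_inner inner_diff inner_commute)
  finally show ?thesis using True by (simp add: phi_star_def)
next
  case False
  \<comment> \<open>Expanded, this product is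
    \<open>\<zeta> x * norm s - 1/2 * (\<zeta> x)^2\<close> minus
    \<open>norm s * norm q - 1/2 * (norm q)^2\<close>. The second factor is nonnegative because
    \<open>norm q \<le> \<zeta> x < norm s\<close>.\<close>
  have "0 \<le> (\<zeta> x - norm q) * (norm s - (\<zeta> x + norm q) / 2)"
    using assms False by (intro mult_nonneg_nonneg) auto
  moreover have "s \<bullet> q \<le> norm s * norm q" by (rule norm_cauchy_schwarz)
  ultimately show ?thesis
    using False by (simp add: phi_star_def power2_eq_square algebra_simps diff_divide_distrib)
qed

definition ball_proj :: "real \<Rightarrow> 'a::euclidean_space \<Rightarrow> 'a" where
  "ball_proj r s = (if norm s \<le> r then s else (r / norm s) *\<^sub>R s)"

lemma norm_ball_proj_le: "0 \<le> r \<Longrightarrow> norm (ball_proj r s) \<le> r"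
  by (auto simp: ball_proj_def)

text \<open>The projection onto the ball attains equality in Fenchel's inequality, which makes it
  the pointwise maximiser for the density part.\<close>

lemma phi_star_ball_proj:
  assumes "0 \<le> \<zeta> x"
  shows "s \<bullet> ball_proj (\<zeta> x) s - 1/2 * (norm (ball_proj (\<zeta> x) s))\<^sup>2 = phi_star \<zeta> x s"
proof (cases "norm s \<le> \<zeta> x")
  case True
  then show ?thesis by (simp add: ball_proj_def phi_star_def dot_square_norm)
next
  case False
  then have "norm s > 0" using assms by linarith
  then have "norm (ball_proj (\<zeta> x) s) = \<zeta> x" "s \<bullet> ball_proj (\<zeta> x) s = \<zeta> x * norm s"
    using False assms by (auto simp: ball_proj_def dot_square_norm power2_eq_square)
  then show ?thesis using False by (simp add: phi_star_def)
qed

lemma phi_star_bounds: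
  assumes "0 \<le> \<zeta> x"
  shows "0 \<le> phi_star \<zeta> x s" "phi_star \<zeta> x s \<le> \<zeta> x * norm s"
proof -
  show "0 \<le> phi_star \<zeta> x s" using phi_star_fenchel[of 0 \<zeta> x s] assms by simp
  have "norm s * norm s \<le> \<zeta> x * norm s" if "norm s \<le> \<zeta> x" using that by (intro mult_right_mono) auto
  moreover have "0 \<le> \<zeta> x * norm s" using assms by simp
  ultimately show "phi_star \<zeta> x s \<le> \<zeta> x * norm s"
    unfolding phi_star_def power2_eq_square by auto
qed

section \<open>Functionals split and weighted by a finitely additive measure\<close>

context bounded_open
begin

lemma integral_Linf_functional:
  assumes y: "integrable M y"
  shows "Linf_functional \<Omega> (\<lambda>q. LINT x|M. y x \<bullet> q x) (LINT x|M. norm (y x))"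
  unfolding Linf_functional_def
proof (intro conjI ballI allI impI)
  show "0 \<le> (LINT x|M. norm (y x))" by simp
next
  fix q r :: "'a \<Rightarrow> 'a" and c assume "q \<in> Linf \<Omega>" "r \<in> Linf \<Omega>"
  then have "integrable M (\<lambda>x. y x \<bullet> q x)" "integrable M (\<lambda>x. y x \<bullet> r x)"
    using y by (auto intro: integrable_inner_Linf)
  then show "(LINT x|M. y x \<bullet> (q x + c *\<^sub>R r x)) = (LINT x|M. y x \<bullet> q x) + c * (LINT x|M. y x \<bullet> r x)"
    by (simp add: inner_add_right)
next
  fix q :: "'a \<Rightarrow> 'a" and c :: real assume q: "q \<in> Linf \<Omega>" "0 \<le> c" "AE x in M. norm (q x) \<le> c"
  have int: "integrable M (\<lambda>x. y x \<bullet> q x)" using y q(1) by (rule integrable_inner_Linf)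
  have "\<bar>LINT x|M. y x \<bullet> q x\<bar> \<le> (LINT x|M. \<bar>y x \<bullet> q x\<bar>)" by (rule integral_abs_bound)
  also have "\<dots> \<le> (LINT x|M. norm (y x) * c)"
  proof (rule integral_mono_AE)
    show "AE x in M. \<bar>y x \<bullet> q x\<bar> \<le> norm (y x) * c"
      using q(3)
    proof eventually_elim
      case (elim x)
      have "\<bar>y x \<bullet> q x\<bar> \<le> norm (y x) * norm (q x)" by (rule Cauchy_Schwarz_ineq2)
      also have "\<dots> \<le> norm (y x) * c" using elim by (intro mult_left_mono) auto
      finally show ?case .
    qed
  qed (use int y in auto)
  also have "\<dots> = (LINT x|M. norm (y x)) * c" by simp
  finally show "\<bar>LINT x|M. y x \<bullet> q x\<bar> \<le> (LINT x|M. norm (y x)) * c" .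
qed

lemma Linf_functional_plus:
  assumes "Linf_functional \<Omega> S C" "Linf_functional \<Omega> T D"
  shows "Linf_functional \<Omega> (\<lambda>q. S q + T q) (C + D)"
  unfolding Linf_functional_def
proof (intro conjI ballI allI impI)
  show "0 \<le> C + D" using assms by (auto simp: Linf_functional_def)
next
  fix q r :: "'a \<Rightarrow> 'a" and c assume "q \<in> Linf \<Omega>" "r \<in> Linf \<Omega>"
  then show "S (\<lambda>x. q x + c *\<^sub>R r x) + T (\<lambda>x. q x + c *\<^sub>R r x) = S q + T q + c * (S r + T r)"
    using assms by (simp add: Linf_functional_lincomb algebra_simps)
next
  fix q :: "'a \<Rightarrow> 'a" and c :: real assume q: "q \<in> Linf \<Omega>" "0 \<le> c" "AE x in M. norm (q x) \<le> c"
  then show "\<bar>S q + T q\<bar> \<le> (C + D) * c"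
    using Linf_functional_bound[OF assms(1) q] Linf_functional_bound[OF assms(2) q]
    by (simp add: algebra_simps)
qed

lemma Linf_functional_mult:
  assumes T: "Linf_functional \<Omega> T C" and h: "h \<in> Linf \<Omega>" "d \<ge> 0" "AE x in M. norm (h x) \<le> d"
  shows "Linf_functional \<Omega> (\<lambda>q. T (\<lambda>x. h x *\<^sub>R q x)) (C * d)"
  unfolding Linf_functional_def
proof (intro conjI ballI allI impI)
  show "0 \<le> C * d" using T h(2) by (auto simp: Linf_functional_def)
next
  fix q r :: "'a \<Rightarrow> 'a" and c assume "q \<in> Linf \<Omega>" "r \<in> Linf \<Omega>"
  then have "T (\<lambda>x. h x *\<^sub>R q x + c *\<^sub>R h x *\<^sub>R r x) = T (\<lambda>x. h x *\<^sub>R q x) + c * T (\<lambda>x. h x *\<^sub>R r x)"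
    using h(1) by (intro Linf_functional_lincomb[OF T] Linf_scaleR_fun)
  then show "T (\<lambda>x. h x *\<^sub>R (q x + c *\<^sub>R r x)) = T (\<lambda>x. h x *\<^sub>R q x) + c * T (\<lambda>x. h x *\<^sub>R r x)"
    by (simp add: scaleR_add_right mult.commute)
next
  fix q :: "'a \<Rightarrow> 'a" and c :: real assume q: "q \<in> Linf \<Omega>" "0 \<le> c" "AE x in M. norm (q x) \<le> c"
  have "AE x in M. norm (h x *\<^sub>R q x) \<le> d * c"
    using q(3) h(3) by eventually_elim (use h(2) in \<open>auto intro!: mult_mono\<close>)
  then have "\<bar>T (\<lambda>x. h x *\<^sub>R q x)\<bar> \<le> C * (d * c)"
    using q h by (intro Linf_functional_bound[OF T] Linf_scaleR_fun) auto
  then show "\<bar>T (\<lambda>x. h x *\<^sub>R q x)\<bar> \<le> C * d * c" by (simp add: mult.assoc)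
qed

text \<open>Both summands on the right are bounded functionals, so agreement on indicators, which is
  the set-wise decomposition, suffices.\<close>

lemma ba_integral_yosida_hewitt:
  assumes nu: "\<nu> \<in> ba \<Omega>" and yh: "yosida_hewitt \<Omega> \<nu> y \<nu>s" and q: "q \<in> Linf \<Omega>"
  shows "ba_integral \<Omega> \<nu> q = (LINT x|M. y x \<bullet> q x) + ba_integral \<Omega> \<nu>s q"
proof (rule ba_integral_eq_functional[OF nu _ _ q])
  have y: "integrable M y" and s: "\<nu>s \<in> ba \<Omega>" using yh by (auto simp: yosida_hewitt_def)
  show "Linf_functional \<Omega> (\<lambda>q. (LINT x|M. y x \<bullet> q x) + ba_integral \<Omega> \<nu>s q) ((LINT x|M. norm (y x)) + tv \<nu>s \<Omega>)"
    by (intro Linf_functional_plus integral_Linf_functional ba_integral_Linf_functional y s)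
  fix A and c :: 'a assume A: "A \<in> sets M"
  have "(LINT x|M. y x \<bullet> (indicator A x *\<^sub>R c)) = (LINT x|M. (indicator A x *\<^sub>R y x) \<bullet> c)" by simp
  also have "\<dots> = (LINT x:A|M. y x) \<bullet> c"
    unfolding set_lebesgue_integral_def using A y by (intro integral_inner_left integrable_mult_indicator)
  finally show "(LINT x|M. y x \<bullet> (indicator A x *\<^sub>R c)) + ba_integral \<Omega> \<nu>s (\<lambda>x. indicator A x *\<^sub>R c) = c \<bullet> \<nu> A"
    using yh A by (simp add: ba_integral_indicator[OF s A] yosida_hewitt_def inner_add_right inner_commute)
qed

lemma zero_ba: "(\<lambda>A. 0) \<in> ba \<Omega>"
  by (rule baI[where C = 0]) auto

lemma Linf_functional_eq_0:
  assumes T: "Linf_functional \<Omega> T C" and "\<And>A c. A \<in> sets M \<Longrightarrow> T (\<lambda>x. indicator A x *\<^sub>R c) = 0"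
    and q: "q \<in> Linf \<Omega>"
  shows "T q = 0"
proof -
  have "ba_integral \<Omega> (\<lambda>A. 0) q = T q"
    by (rule ba_integral_eq_functional[OF zero_ba T _ q]) (simp add: assms(2))
  moreover have "ba_integral \<Omega> (\<lambda>A. 0) q = 0"
    by (rule ba_integral_eq_functional[OF zero_ba _ _ q, of "\<lambda>q. 0" 0]) (auto simp: Linf_functional_def)
  ultimately show ?thesis by simp
qed

text \<open>On an indicator of \<open>A\<close> the restricted functional yields the measure of
  \<open>A - E\<close>, which has no variation; vanishing on indicators then spreads to all bounded
  fields.\<close>

lemma ba_integral_eq_0_off:
  assumes nu: "\<nu> \<in> ba \<Omega>" and E: "E \<in> sets M" "total_variation \<Omega> \<nu> (\<Omega> - E) = 0" and q: "q \<in> Linf \<Omega>"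
  shows "ba_integral \<Omega> \<nu> (\<lambda>x. indicator (\<Omega> - E) x *\<^sub>R q x) = 0"
proof (rule Linf_functional_eq_0[OF _ _ q])
  have "\<Omega> - E \<in> sets M" using E(1) by auto
  then show "Linf_functional \<Omega> (\<lambda>q. ba_integral \<Omega> \<nu> (\<lambda>x. indicator (\<Omega> - E) x *\<^sub>R q x)) (tv \<nu> \<Omega> * 1)"
    by (intro Linf_functional_mult ba_integral_Linf_functional nu Linf_indicator) (auto simp: indicator_def)
  fix A and c :: 'a assume A: "A \<in> sets M"
  have AE: "A - E \<in> sets M" using A E(1) by auto
  have "norm (\<nu> (A - E)) \<le> tv \<nu> (A - E)" using nu AE by (rule norm_le_tv)
  also have "\<dots> \<le> tv \<nu> (\<Omega> - E)"
    using A E(1) by (intro tv_mono[OF nu]) (auto simp: sets_M)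
  also have "\<dots> = 0" using E(2) by (simp add: tv_def)
  finally have z: "\<nu> (A - E) = 0" by simp
  have "(\<lambda>x. indicator (\<Omega> - E) x *\<^sub>R indicator A x *\<^sub>R c) = (\<lambda>x. indicator (A - E) x *\<^sub>R c)"
    using A by (auto simp: fun_eq_iff indicator_def sets_M)
  then show "ba_integral \<Omega> \<nu> (\<lambda>x. indicator (\<Omega> - E) x *\<^sub>R indicator A x *\<^sub>R c) = 0"
    using ba_integral_indicator[OF nu AE] z by simp
qed

text \<open>Recognises the componentwise integral of \<open>\<zeta>\<close> as a representing
  measure, so that membership in \<open>ba\<close> and the change-of-density formula follow from the
  general representation.\<close>

lemma ba_density_functional_measure:
  "ba_density \<Omega> \<zeta> \<nu> = functional_measure (\<lambda>q. ba_integral \<Omega> \<nu> (\<lambda>x. \<zeta> x *\<^sub>R q x))"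
  by (simp add: fun_eq_iff ba_density_def functional_measure_def mult.commute)

lemma ba_density_ba:
  assumes nu: "\<nu> \<in> ba \<Omega>" and z: "\<zeta> \<in> Linf \<Omega>"
  shows "ba_density \<Omega> \<zeta> \<nu> \<in> ba \<Omega>"
    "\<And>q. q \<in> Linf \<Omega> \<Longrightarrow> ba_integral \<Omega> (ba_density \<Omega> \<zeta> \<nu>) q = ba_integral \<Omega> \<nu> (\<lambda>x. \<zeta> x *\<^sub>R q x)"
proof -
  obtain d where d: "d \<ge> 0" "AE x in M. norm (\<zeta> x) \<le> d" using z by (rule LinfE)
  note T = Linf_functional_mult[OF ba_integral_Linf_functional[OF nu] z d]
  show "ba_density \<Omega> \<zeta> \<nu> \<in> ba \<Omega>"
    unfolding ba_density_functional_measure using T by (rule functional_measure_ba)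
  show "ba_integral \<Omega> (ba_density \<Omega> \<zeta> \<nu>) q = ba_integral \<Omega> \<nu> (\<lambda>x. \<zeta> x *\<^sub>R q x)" if "q \<in> Linf \<Omega>" for q
    unfolding ba_density_functional_measure using T that by (rule ba_integral_functional_measure)
qed

end

text \<open>The number \<open>z0\<close> replaces the positive essential infimum: it permits
  division by \<open>\<zeta>\<close> and later measures the room left around
  \<open>uh\<close>.\<close>

locale gradient_bound = bounded_open \<Omega> for \<Omega> :: "'a::euclidean_space set" +
  fixes \<zeta> :: "'a \<Rightarrow> real" and z0 :: real
  assumes zeta_Linf: "\<zeta> \<in> Linf \<Omega>" and z0_pos: "z0 > 0" and zeta_ge: "AE x in lebesgue_on \<Omega>. z0 \<le> \<zeta> x"
begin

lemma zeta_measurable [measurable]: "\<zeta> \<in> borel_measurable M"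
  using zeta_Linf by (rule Linf_measurable)

lemma phi_star_integrable:
  assumes y: "integrable M y"
  shows "integrable M (\<lambda>x. phi_star \<zeta> x (y x))"
proof -
  have [measurable]: "y \<in> borel_measurable M" using y by auto
  obtain c where c: "c \<ge> 0" "AE x in M. norm (\<zeta> x) \<le> c" using zeta_Linf by (rule LinfE)
  show ?thesis
  proof (rule Bochner_Integration.integrable_bound)
    show "integrable M (\<lambda>x. c * norm (y x))" using y by auto
    show "(\<lambda>x. phi_star \<zeta> x (y x)) \<in> borel_measurable M" unfolding phi_star_def by measurable
    show "AE x in M. norm (phi_star \<zeta> x (y x)) \<le> norm (c * norm (y x))"
      using c(2) zeta_ge
    proof eventually_elim
      case (elim x)
      then have "0 \<le> \<zeta> x" using z0_pos by linarith
      have "\<zeta> x * norm (y x) \<le> c * norm (y x)" using elim by (intro mult_right_mono) auto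
      then show ?case using phi_star_bounds[of \<zeta> x "y x", OF \<open>0 \<le> \<zeta> x\<close>] c(1) by simp
    qed
  qed
qed

lemma Linf_of_norm_le_zeta:
  assumes "q \<in> borel_measurable M" "AE x in M. norm (q x) \<le> \<zeta> x"
  shows "q \<in> Linf \<Omega>"
proof -
  obtain c where c: "AE x in M. norm (\<zeta> x) \<le> c" using zeta_Linf by (rule LinfE)
  have "AE x in M. norm (q x) \<le> c" using assms(2) c by eventually_elim auto
  then show ?thesis using assms(1) by (rule LinfI[rotated])
qed

lemma energy_integrable:
  fixes q :: "'a \<Rightarrow> 'a"
  assumes "q \<in> Linf \<Omega>"
  shows "integrable M (\<lambda>x. (norm (q x))\<^sup>2)"
  unfolding power2_norm_eq_inner using assms by (intro integrable_Linf Linf_inner)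

text \<open>The density part is Fenchel's inequality under the integral. For the singular part write
  \<open>q\<close> as \<open>\<zeta>\<close> times a field \<open>r\<close> of norm at most 1:
  integrating \<open>q\<close> against \<open>\<nu>s\<close> is integrating \<open>r\<close> against
  \<open>\<zeta>\<nu>s\<close>, which is at most its variation.\<close>

lemma ba_integral_energy_le:
  assumes nu: "\<nu> \<in> ba \<Omega>" and yh: "yosida_hewitt \<Omega> \<nu> y \<nu>s" and q: "q \<in> Linf \<Omega>" "AE x in M. norm (q x) \<le> \<zeta> x"
  shows "ba_integral \<Omega> \<nu> q - 1/2 * (LINT x|M. (norm (q x))\<^sup>2) \<le>
    (LINT x|M. phi_star \<zeta> x (y x)) + tv (ba_density \<Omega> \<zeta> \<nu>s) \<Omega>"
proof -
  have y: "integrable M y" and s: "\<nu>s \<in> ba \<Omega>" using yh by (auto simp: yosida_hewitt_def)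
  note [measurable] = Linf_measurable[OF q(1)]
  define r where "r x = (1 / \<zeta> x) *\<^sub>R q x" for x
  have r1: "AE x in M. norm (r x) \<le> 1"
    using q(2) zeta_ge by eventually_elim (use z0_pos in \<open>simp add: r_def divide_le_eq\<close>)
  have r: "r \<in> Linf \<Omega>" by (rule LinfI[OF _ r1]) (simp add: r_def)
  have "AE x in M. q x = \<zeta> x *\<^sub>R r x"
    using zeta_ge by eventually_elim (use z0_pos in \<open>simp add: r_def\<close>)
  then have "ba_integral \<Omega> \<nu>s q = ba_integral \<Omega> \<nu>s (\<lambda>x. \<zeta> x *\<^sub>R r x)"
    by (intro Linf_functional_AE_cong[OF ba_integral_Linf_functional[OF s]] q Linf_scaleR_fun zeta_Linf r)
  also have "\<dots> = ba_integral \<Omega> (ba_density \<Omega> \<zeta> \<nu>s) r"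
    using ba_density_ba(2)[OF s zeta_Linf r] by simp
  also have "\<dots> \<le> tv (ba_density \<Omega> \<zeta> \<nu>s) \<Omega> * 1"
    using Linf_functional_bound[OF ba_integral_Linf_functional[OF ba_density_ba(1)[OF s zeta_Linf]] r _ r1] by simp
  finally have 1: "ba_integral \<Omega> \<nu>s q \<le> tv (ba_density \<Omega> \<zeta> \<nu>s) \<Omega>" by simp
  have int: "integrable M (\<lambda>x. y x \<bullet> q x)" "integrable M (\<lambda>x. (norm (q x))\<^sup>2)"
    using y q by (auto intro: integrable_inner_Linf energy_integrable)
  have "(LINT x|M. y x \<bullet> q x) - 1/2 * (LINT x|M. (norm (q x))\<^sup>2) = (LINT x|M. y x \<bullet> q x - 1/2 * (norm (q x))\<^sup>2)"
    using int by simp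
  also have "\<dots> \<le> (LINT x|M. phi_star \<zeta> x (y x))"
  proof (rule integral_mono_AE)
    show "AE x in M. y x \<bullet> q x - 1/2 * (norm (q x))\<^sup>2 \<le> phi_star \<zeta> x (y x)"
      using q(2) by eventually_elim (rule phi_star_fenchel)
  qed (use int phi_star_integrable[OF y] in auto)
  finally show ?thesis
    using 1 ba_integral_yosida_hewitt[OF nu yh q(1)] by simp
qed

text \<open>The two parts can be optimised independently: \<open>\<nu>s\<close> ignores what a field
  does off \<open>E k\<close>, while the density part forgets in the limit what it does on
  \<open>E k\<close>, since the measure of \<open>E k\<close> tends to 0.\<close>

lemma energy_bound_imp_conjugate_le:
  assumes nu: "\<nu> \<in> ba \<Omega>" and yh: "yosida_hewitt \<Omega> \<nu> y \<nu>s"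
    and R: "\<And>q. q \<in> Linf \<Omega> \<Longrightarrow> AE x in M. norm (q x) \<le> \<zeta> x \<Longrightarrow>
      ba_integral \<Omega> \<nu> q - 1/2 * (LINT x|M. (norm (q x))\<^sup>2) \<le> R"
  shows "(LINT x|M. phi_star \<zeta> x (y x)) + tv (ba_density \<Omega> \<zeta> \<nu>s) \<Omega> \<le> R"
proof -
  have y: "integrable M y" and s: "\<nu>s \<in> ba \<Omega>" using yh by (auto simp: yosida_hewitt_def)
  obtain E :: "nat \<Rightarrow> 'a set" where E: "range E \<subseteq> sets M" "decseq E" "(\<lambda>n. emeasure M (E n)) \<longlonglongrightarrow> 0"
    "\<And>n. total_variation \<Omega> \<nu>s (\<Omega> - E n) = 0"
    using yh by (auto simp: yosida_hewitt_def ba_singular_def)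
  have En: "E n \<in> sets M" for n using E(1) by auto
  obtain c where c: "c \<ge> 0" "AE x in M. norm (\<zeta> x) \<le> c" using zeta_Linf by (rule LinfE)
  define \<sigma> where "\<sigma> = ba_density \<Omega> \<zeta> \<nu>s"
  have sig: "\<sigma> \<in> ba \<Omega>" unfolding \<sigma>_def using s zeta_Linf by (rule ba_density_ba)
  define P where "P = (LINT x|M. phi_star \<zeta> x (y x))"
  have key: "P + (\<Sum>i<n. norm (\<sigma> (A i))) \<le> R"
    if A: "range A \<subseteq> sets M" "disjoint_family A" for A :: "nat \<Rightarrow> 'a set" and n
  proof -
    have Ai: "A i \<in> sets M" for i using A by auto
    define r where "r x = (\<Sum>i<n. indicator (A i) x *\<^sub>R sgn (\<sigma> (A i)))" for x
    have "disjoint_family_on A {..<n}" using A(2) by (auto simp: disjoint_family_on_def)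
    then have r1: "norm (r x) \<le> 1" for x
      unfolding r_def by (intro disjoint_indicator_sum_norm_le) (auto simp: norm_sgn)
    have r: "r \<in> Linf \<Omega>" unfolding r_def using Ai by (intro Linf_sum) auto
    have "ba_integral \<Omega> \<sigma> r = (\<Sum>i<n. ba_integral \<Omega> \<sigma> (\<lambda>x. indicator (A i) x *\<^sub>R sgn (\<sigma> (A i))))"
      unfolding r_def using Ai by (intro Linf_functional_sum[OF ba_integral_Linf_functional[OF sig]]) auto
    also have "\<dots> = (\<Sum>i<n. norm (\<sigma> (A i)))"
      by (simp add: ba_integral_indicator[OF sig Ai] sgn_inner_self)
    finally have sum_eq: "ba_integral \<Omega> \<nu>s (\<lambda>x. \<zeta> x *\<^sub>R r x) = (\<Sum>i<n. norm (\<sigma> (A i)))"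
      using ba_density_ba(2)[OF s zeta_Linf r] by (simp add: \<sigma>_def)
    define p where "p x = ball_proj (\<zeta> x) (y x)" for x
    have [measurable]: "y \<in> borel_measurable M" "r \<in> borel_measurable M" "\<And>k. E k \<in> sets M"
      using y r En by (auto simp: Linf_measurable)
    have [measurable]: "p \<in> borel_measurable M" unfolding p_def ball_proj_def by measurable
    have p_le: "AE x in M. norm (p x) \<le> \<zeta> x"
      using zeta_ge by eventually_elim (use z0_pos in \<open>auto simp: p_def intro!: norm_ball_proj_le\<close>)
    have p: "p \<in> Linf \<Omega>" by (rule Linf_of_norm_le_zeta[OF _ p_le]) measurable
    define w where "w x = \<zeta> x *\<^sub>R r x" for x
    have w: "w \<in> Linf \<Omega>" unfolding w_def by (intro Linf_scaleR_fun zeta_Linf r)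
    have w_le: "AE x in M. norm (w x) \<le> \<zeta> x"
      using zeta_ge by eventually_elim (use z0_pos r1 in \<open>simp add: w_def mult_left_le\<close>)
    \<comment> \<open>Equals \<open>w\<close> on \<open>E k\<close> and \<open>p\<close> off it.
      Written as \<open>w\<close> plus a field supported off \<open>E k\<close>, it has the same
      singular integral as \<open>w\<close>.\<close>
    define q where "q k x = w x + indicator (\<Omega> - E k) x *\<^sub>R (p x - w x)" for k x
    have q: "q k \<in> Linf \<Omega>" for k
      unfolding q_def using En by (intro Linf_add Linf_scaleR_fun Linf_indicator Linf_diff w p) auto
    have q_le: "AE x in M. norm (q k x) \<le> \<zeta> x" for k
      using p_le w_le by eventually_elim (auto simp: q_def indicator_def)
    have "ba_integral \<Omega> \<nu>s (q k) = (\<Sum>i<n. norm (\<sigma> (A i)))" for k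
    proof -
      have "(\<lambda>x. indicator (\<Omega> - E k) x *\<^sub>R (p x - w x)) \<in> Linf \<Omega>"
        using En by (intro Linf_scaleR_fun Linf_indicator Linf_diff w p) auto
      then have "ba_integral \<Omega> \<nu>s (q k) = ba_integral \<Omega> \<nu>s w + ba_integral \<Omega> \<nu>s (\<lambda>x. indicator (\<Omega> - E k) x *\<^sub>R (p x - w x))"
        unfolding q_def by (rule Linf_functional_add[OF ba_integral_Linf_functional[OF s] w])
      also have "ba_integral \<Omega> \<nu>s (\<lambda>x. indicator (\<Omega> - E k) x *\<^sub>R (p x - w x)) = 0"
        by (rule ba_integral_eq_0_off[OF s En E(4) Linf_diff[OF p w]])
      finally show ?thesis using sum_eq by (simp add: w_def)
    qed
    then have le: "(LINT x|M. y x \<bullet> q k x - 1/2 * (norm (q k x))\<^sup>2) + (\<Sum>i<n. norm (\<sigma> (A i))) \<le> R" for k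
      using R[OF q q_le, of k] ba_integral_yosida_hewitt[OF nu yh q, of k]
        integrable_inner_Linf[OF y q, of k] energy_integrable[OF q, of k] by simp
    have "(\<lambda>k. LINT x|M. y x \<bullet> q k x - 1/2 * (norm (q k x))\<^sup>2) \<longlonglongrightarrow> P"
      unfolding P_def
    proof (rule integral_dominated_convergence[where w = "\<lambda>x. c * norm (y x) + 1/2 * c\<^sup>2"])
      show "(\<lambda>x. phi_star \<zeta> x (y x)) \<in> borel_measurable M" using phi_star_integrable[OF y] by auto
      show "(\<lambda>x. y x \<bullet> q k x - 1/2 * (norm (q k x))\<^sup>2) \<in> borel_measurable M" for k
        using Linf_measurable[OF q[of k]] by measurable
      show "integrable M (\<lambda>x. c * norm (y x) + 1/2 * c\<^sup>2)" using y by auto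
      show "AE x in M. norm (y x \<bullet> q k x - 1/2 * (norm (q k x))\<^sup>2) \<le> c * norm (y x) + 1/2 * c\<^sup>2" for k
        using q_le[of k] c(2)
      proof eventually_elim
        case (elim x)
        then have "norm (q k x) \<le> c" by simp
        then have "norm (y x) * norm (q k x) \<le> norm (y x) * c" "(norm (q k x))\<^sup>2 \<le> c\<^sup>2"
          by (auto intro: mult_left_mono power_mono)
        moreover have "\<bar>y x \<bullet> q k x\<bar> \<le> norm (y x) * norm (q k x)" by (rule Cauchy_Schwarz_ineq2)
        ultimately have "\<bar>y x \<bullet> q k x\<bar> \<le> c * norm (y x)" by (simp add: mult.commute)
        moreover have "0 \<le> (norm (q k x))\<^sup>2" by simp
        ultimately show ?case
          using \<open>(norm (q k x))\<^sup>2 \<le> c\<^sup>2\<close> unfolding real_norm_def by linarith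
      qed
      have "(\<Inter>k. E k) \<in> null_sets M"
      proof (rule null_setsI)
        have "(\<lambda>n. emeasure M (E n)) \<longlonglongrightarrow> emeasure M (\<Inter>k. E k)"
          using E(1,2) by (intro Lim_emeasure_decseq) auto
        then show "emeasure M (\<Inter>k. E k) = 0" using E(3) LIMSEQ_unique by blast
      qed (use En in auto)
      from AE_not_in[OF this]
      show "AE x in M. (\<lambda>k. y x \<bullet> q k x - 1/2 * (norm (q k x))\<^sup>2) \<longlonglongrightarrow> phi_star \<zeta> x (y x)"
        using zeta_ge AE_space
      proof eventually_elim
        case (elim x)
        then obtain N where "x \<notin> E N" by auto
        then have "x \<in> \<Omega> - E k" if "k \<ge> N" for k using E(2) that elim(3) by (auto simp: decseq_def)
        then have "q k x = p x" if "k \<ge> N" for k using that by (simp add: q_def)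
        moreover have "0 \<le> \<zeta> x" using elim(2) z0_pos by linarith
        ultimately have "y x \<bullet> q k x - 1/2 * (norm (q k x))\<^sup>2 = phi_star \<zeta> x (y x)" if "k \<ge> N" for k
          using phi_star_ball_proj[of \<zeta> x "y x"] that by (simp add: p_def)
        then show ?case
          by (intro tendsto_eventually) (auto simp: eventually_sequentially)
      qed
    qed
    then have "(\<lambda>k. (LINT x|M. y x \<bullet> q k x - 1/2 * (norm (q k x))\<^sup>2) + (\<Sum>i<n. norm (\<sigma> (A i)))) \<longlonglongrightarrow> P + (\<Sum>i<n. norm (\<sigma> (A i)))"
      by (intro tendsto_add tendsto_const)
    then show ?thesis using le by (intro LIMSEQ_le_const2) auto
  qed
  \<comment> \<open>Nonnegativity of \<open>R - P\<close> ensures that the bound survives the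
    passage through \<open>ennreal\<close>.\<close>
  have P_le: "P \<le> R" using key[of "\<lambda>i. {}" 0] by (simp add: disjoint_family_on_def)
  have "total_variation \<Omega> \<sigma> \<Omega> \<le> ennreal (R - P)"
  proof (rule total_variation_leI)
    fix A :: "nat \<Rightarrow> 'a set" and n assume "range A \<subseteq> sets M" "disjoint_family A"
    from key[OF this, of n] show "(\<Sum>i<n. norm (\<sigma> (A i))) \<le> R - P" by simp
  qed
  then have "tv \<sigma> \<Omega> \<le> R - P"
    using P_le by (simp add: total_variation_eq_tv[OF sig])
  then show ?thesis by (simp add: P_def \<sigma>_def)
qed

end

section \<open>Strong duality\<close>

text \<open>\<open>\<theta>\<close> records strict feasibility: it is a number below 1 that bounds
  the quotient of the gradient of \<open>uh\<close> and \<open>\<zeta>\<close>.\<close>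

locale primal_problem = gradient_bound \<Omega> \<zeta> z0
  for \<Omega> :: "'a::euclidean_space set" and \<zeta> z0 +
  fixes \<Gamma>D \<Gamma>N :: "'a set" and f uD uh u :: "'a \<Rightarrow> real" and g :: "('a \<Rightarrow> real) \<Rightarrow> real" and \<theta> :: real
  assumes \<Gamma>N: "\<Gamma>N \<subseteq> closure \<Omega>" and f: "integrable (lebesgue_on \<Omega>) f" and g: "g \<in> W1inf_bdry_dual \<Omega> \<Gamma>N"
    and uh: "uh \<in> W1inf \<Omega>" "trace_eq_on \<Omega> \<Gamma>D uh uD"
    and \<theta>: "\<theta> < 1" "AE x in lebesgue_on \<Omega>. norm (grad \<Omega> uh x) \<le> \<theta> * \<zeta> x"
    and u: "u \<in> primal_set \<Omega> \<Gamma>D \<zeta> uD"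
    and u_min: "\<And>v. v \<in> W1inf \<Omega> \<Longrightarrow> primal_energy \<Omega> \<Gamma>D \<zeta> uD f g u \<le> primal_energy \<Omega> \<Gamma>D \<zeta> uD f g v"
begin

abbreviation "K \<equiv> primal_set \<Omega> \<Gamma>D \<zeta> uD"
abbreviation "V \<equiv> W1inf_D \<Omega> \<Gamma>D"
abbreviation "F \<equiv> load \<Omega> f g"
abbreviation gradient (\<open>\<nabla>\<close>) where "\<nabla> \<equiv> grad \<Omega>"

lemma KD: "v \<in> K \<Longrightarrow> v \<in> W1inf \<Omega>" "v \<in> K \<Longrightarrow> trace_eq_on \<Omega> \<Gamma>D v uD"
  "v \<in> K \<Longrightarrow> AE x in M. norm (\<nabla> v x) \<le> \<zeta> x"
  by (auto simp: primal_set_def)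

lemma VD: "w \<in> V \<Longrightarrow> w \<in> W1inf \<Omega>" "w \<in> V \<Longrightarrow> trace_eq_on \<Omega> \<Gamma>D w (\<lambda>x. 0)"
  by (auto simp: W1inf_D_def)

lemma grad_Linf: "v \<in> W1inf \<Omega> \<Longrightarrow> \<nabla> v \<in> Linf \<Omega>"
  by (rule W1inf_grad(2))

lemma lincomb_Dirichlet:
  assumes "v \<in> W1inf \<Omega>" "trace_eq_on \<Omega> \<Gamma>D v a" "w \<in> W1inf \<Omega>" "trace_eq_on \<Omega> \<Gamma>D w b"
  shows "F (\<lambda>x. v x + c * w x) = F v + c * F w"
  using load_lincomb[OF g \<Gamma>N f assms] .

lemma V_lincomb: "w1 \<in> V \<Longrightarrow> w2 \<in> V \<Longrightarrow> (\<lambda>x. w1 x + c * w2 x) \<in> V"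
  using W1inf_lincomb(1)[of w1 w2 c] trace_eq_on_lincomb[of \<Gamma>D w1 "\<lambda>x. 0" w2 "\<lambda>x. 0" c]
  by (simp add: W1inf_D_def)

lemma V_diff:
  assumes "v \<in> W1inf \<Omega>" "trace_eq_on \<Omega> \<Gamma>D v uD" "w \<in> W1inf \<Omega>" "trace_eq_on \<Omega> \<Gamma>D w uD"
  shows "(\<lambda>x. v x - w x) \<in> V" "AE x in M. \<nabla> (\<lambda>x. v x - w x) x = \<nabla> v x - \<nabla> w x"
    "F (\<lambda>x. v x - w x) = F v - F w"
  using W1inf_lincomb[OF assms(1,3), of "-1"] trace_eq_on_lincomb[OF assms(2,4), of "-1"]
    lincomb_Dirichlet[OF assms, of "-1"]
  by (simp_all add: W1inf_D_def)

definition A :: "('a \<Rightarrow> 'a) \<Rightarrow> real" where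
  "A q = (LINT x|M. \<nabla> u x \<bullet> q x)"

lemma A_functional: "Linf_functional \<Omega> A (LINT x|M. norm (\<nabla> u x))"
  unfolding A_def[abs_def] by (intro integral_Linf_functional integrable_Linf grad_Linf KD u)

lemma u_energy: "primal_energy \<Omega> \<Gamma>D \<zeta> uD f g u = ereal (1/2 * A (\<nabla> u) - F u)"
  using u by (simp add: primal_energy_def A_def power2_norm_eq_inner)

text \<open>The first-order optimality condition, from \<open>I u \<le> I (u + t (v - u))\<close> as \<open>t\<close> tends to \<open>0\<close>.\<close>

lemma variational_inequality:
  assumes v: "v \<in> K"
  shows "F v - F u \<le> A (\<nabla> v) - A (\<nabla> u)"
proof -
  note uK = KD[OF u] and vK = KD[OF v]
  define d where "d x = v x - u x" for x
  have d: "d \<in> V" "AE x in M. \<nabla> d x = \<nabla> v x - \<nabla> u x" "F d = F v - F u"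
    unfolding d_def using V_diff[OF vK(1,2) uK(1,2)] by auto
  define B where "B = (LINT x|M. (norm (\<nabla> d x))\<^sup>2)"
  have Ad: "A (\<nabla> d) = A (\<nabla> v) - A (\<nabla> u)"
    using Linf_functional_AE_cong[OF A_functional grad_Linf[OF VD(1)[OF d(1)]]
        Linf_diff[OF grad_Linf[OF vK(1)] grad_Linf[OF uK(1)]] d(2)]
      Linf_functional_diff[OF A_functional grad_Linf[OF vK(1)] grad_Linf[OF uK(1)]] by simp
  \<comment> \<open>The energy is quadratic along the segment, so comparing it at
    \<open>u + t * d\<close> with its value at \<open>u\<close> and dividing by \<open>t\<close>
    leaves an error \<open>t / 2 * B\<close>. The condition \<open>t \<le> 1\<close> keeps the
    segment in the convex set \<open>K\<close>.\<close>
  have step: "F d \<le> A (\<nabla> d) + t / 2 * B" if t: "0 < t" "t \<le> 1" for t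
  proof -
    define vt where "vt x = u x + t * d x" for x
    have vt: "vt \<in> W1inf \<Omega>" "AE x in M. \<nabla> vt x = \<nabla> u x + t *\<^sub>R \<nabla> d x"
      unfolding vt_def using W1inf_lincomb[OF uK(1) VD(1)[OF d(1)], of t] by auto
    have tr: "trace_eq_on \<Omega> \<Gamma>D vt uD"
      unfolding vt_def using trace_eq_on_lincomb[OF uK(2) VD(2)[OF d(1)], of t] by simp
    have Fvt: "F vt = F u + t * F d"
      unfolding vt_def by (rule lincomb_Dirichlet[OF uK(1,2) VD[OF d(1)]])
    have "AE x in M. norm (\<nabla> vt x) \<le> \<zeta> x"
      using vt(2) d(2) uK(3) vK(3)
    proof eventually_elim
      case (elim x)
      have "\<nabla> vt x = (1 - t) *\<^sub>R \<nabla> u x + t *\<^sub>R \<nabla> v x" using elim by (simp add: algebra_simps)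
      then have "norm (\<nabla> vt x) \<le> (1 - t) * norm (\<nabla> u x) + t * norm (\<nabla> v x)"
        using norm_triangle_ineq[of "(1 - t) *\<^sub>R \<nabla> u x" "t *\<^sub>R \<nabla> v x"] t by simp
      also have "\<dots> \<le> (1 - t) * \<zeta> x + t * \<zeta> x"
        using elim t by (intro add_mono mult_left_mono) auto
      finally show ?case by (simp add: algebra_simps)
    qed
    then have vtK: "vt \<in> K" using vt(1) tr by (simp add: primal_set_def)
    have int: "integrable M (\<lambda>x. \<nabla> u x \<bullet> \<nabla> u x)" "integrable M (\<lambda>x. \<nabla> u x \<bullet> \<nabla> d x)"
      "integrable M (\<lambda>x. (norm (\<nabla> d x))\<^sup>2)"
      using grad_Linf uK(1) VD(1)[OF d(1)] by (auto intro!: integrable_Linf Linf_inner energy_integrable)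
    have "(LINT x|M. (norm (\<nabla> vt x))\<^sup>2) =
        (LINT x|M. \<nabla> u x \<bullet> \<nabla> u x + 2 * t * (\<nabla> u x \<bullet> \<nabla> d x) + t\<^sup>2 * (norm (\<nabla> d x))\<^sup>2)"
    proof (rule integral_cong_AE)
      show "AE x in M. (norm (\<nabla> vt x))\<^sup>2 = \<nabla> u x \<bullet> \<nabla> u x + 2 * t * (\<nabla> u x \<bullet> \<nabla> d x) + t\<^sup>2 * (norm (\<nabla> d x))\<^sup>2"
        using vt(2)
      proof eventually_elim
        case (elim x)
        show ?case
          unfolding elim power2_norm_eq_inner
          by (simp add: inner_add_left inner_add_right inner_commute algebra_simps power2_eq_square)
      qed
      show "(\<lambda>x. (norm (\<nabla> vt x))\<^sup>2) \<in> borel_measurable M"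
        using energy_integrable[OF grad_Linf[OF vt(1)]] by auto
    qed (use int in auto)
    also have "\<dots> = A (\<nabla> u) + 2 * t * A (\<nabla> d) + t\<^sup>2 * B"
      unfolding A_def B_def using int by simp
    finally have "1/2 * A (\<nabla> u) - F u \<le> 1/2 * (A (\<nabla> u) + 2 * t * A (\<nabla> d) + t\<^sup>2 * B) - (F u + t * F d)"
      using u_min[OF vt(1)] vtK Fvt unfolding u_energy by (simp add: primal_energy_def)
    then have "t * F d \<le> t * (A (\<nabla> d) + t / 2 * B)" by (simp add: power2_eq_square algebra_simps)
    then show ?thesis using t by simp
  qed
  have "F d \<le> A (\<nabla> d)"
  proof (rule field_le_epsilon)
    fix e :: real assume "e > 0"
    have B0: "0 \<le> B" unfolding B_def by simp
    \<comment> \<open>Small enough that \<open>t / 2 * B \<le> e\<close>, and at most 1 for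
      feasibility; the 1 in the denominator avoids division by zero when
      \<open>B = 0\<close>.\<close>
    define t where "t = min 1 (e / (1 + B))"
    have "t > 0" "t \<le> 1" using \<open>e > 0\<close> B0 by (auto simp: t_def)
    have "t / 2 * B \<le> t * (1 + B)" using \<open>t > 0\<close> B0 by (simp add: algebra_simps)
    also have "\<dots> \<le> e / (1 + B) * (1 + B)" using B0 by (intro mult_right_mono) (auto simp: t_def)
    also have "\<dots> = e" using B0 by simp
    finally show "F d \<le> A (\<nabla> d) + e" using step[OF \<open>t > 0\<close> \<open>t \<le> 1\<close>] by simp
  qed
  then show ?thesis using d(3) Ad by simp
qed

section \<open>The residual functional and its bounded extension\<close>

definition residual :: "('a \<Rightarrow> real) \<Rightarrow> real" where
  "residual w = F w - A (\<nabla> w)"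

lemma grad_lincomb_AE:
  "w1 \<in> V \<Longrightarrow> w2 \<in> V \<Longrightarrow> AE x in M. \<nabla> (\<lambda>x. w1 x + c * w2 x) x = \<nabla> w1 x + c *\<^sub>R \<nabla> w2 x"
  using W1inf_lincomb(2) VD(1) by blast

lemma A_lincomb:
  assumes "v \<in> W1inf \<Omega>" "w \<in> W1inf \<Omega>"
  shows "A (\<nabla> (\<lambda>x. v x + c * w x)) = A (\<nabla> v) + c * A (\<nabla> w)"
proof -
  note L = grad_Linf[OF assms(1)] grad_Linf[OF assms(2)]
  show ?thesis
    using Linf_functional_AE_cong[OF A_functional grad_Linf[OF W1inf_lincomb(1)[OF assms]]
        Linf_add[OF L(1) Linf_scaleR[OF L(2)]] W1inf_lincomb(2)[OF assms]]
      Linf_functional_lincomb[OF A_functional L] by simp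
qed

lemma residual_lincomb:
  assumes "w1 \<in> V" "w2 \<in> V"
  shows "residual (\<lambda>x. w1 x + c * w2 x) = residual w1 + c * residual w2"
  using lincomb_Dirichlet[OF VD[OF assms(1)] VD[OF assms(2)]] A_lincomb[OF VD(1)[OF assms(1)] VD(1)[OF assms(2)]]
  by (simp add: residual_def algebra_simps)

text \<open>The direction from the strictly feasible lift to the minimiser. By optimality it
  maximises the residual among the differences \<open>v - uh\<close> with
  \<open>v \<in> K\<close>.\<close>

definition w0 :: "'a \<Rightarrow> real" where
  "w0 x = u x - uh x"

lemma w0: "w0 \<in> V" "AE x in M. \<nabla> w0 x = \<nabla> u x - \<nabla> uh x" "F w0 = F u - F uh"
  unfolding w0_def[abs_def] using V_diff[OF KD(1,2)[OF u] uh] by auto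

lemma residual_w0: "residual w0 = (F u - A (\<nabla> u)) - (F uh - A (\<nabla> uh))"
proof -
  have "A (\<nabla> w0) = A (\<nabla> u) - A (\<nabla> uh)"
    using A_lincomb[OF KD(1)[OF u] uh(1), of "-1"] by (simp add: w0_def[abs_def])
  then show ?thesis using w0(3) by (simp add: residual_def)
qed

lemma zeta_uh: "AE x in M. norm (\<nabla> uh x) \<le> \<zeta> x"
  using \<theta>(2) zeta_ge
proof eventually_elim
  case (elim x)
  then have "\<theta> * \<zeta> x \<le> 1 * \<zeta> x" using \<theta>(1) z0_pos by (intro mult_right_mono) auto
  then show ?case using elim by simp
qed

lemma residual_w0_nonneg: "0 \<le> residual w0"
proof -
  have "uh \<in> K" using uh zeta_uh by (simp add: primal_set_def)
  from variational_inequality[OF this] show ?thesis by (simp add: residual_w0)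
qed

text \<open>Dividing by \<open>t\<close> turns the hypothesis into feasibility of
  \<open>uh + w / t\<close>; the variational inequality for that function, multiplied by
  \<open>t\<close>, is the claim.\<close>

lemma residual_le_pos:
  assumes w: "w \<in> V" and t: "t > 0" and le: "AE x in M. norm (t *\<^sub>R \<nabla> uh x + \<nabla> w x) \<le> t * \<zeta> x"
  shows "residual w \<le> t * residual w0"
proof -
  define v where "v x = uh x + (1 / t) * w x" for x
  have v: "v \<in> W1inf \<Omega>" "AE x in M. \<nabla> v x = \<nabla> uh x + (1 / t) *\<^sub>R \<nabla> w x"
    unfolding v_def[abs_def] using W1inf_lincomb[OF uh(1) VD(1)[OF w], of "1 / t"] by auto
  have "trace_eq_on \<Omega> \<Gamma>D v uD"
    unfolding v_def[abs_def] using trace_eq_on_lincomb[OF uh(2) VD(2)[OF w], of "1 / t"] by simp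
  moreover have "AE x in M. norm (\<nabla> v x) \<le> \<zeta> x"
    using v(2) le
  proof eventually_elim
    case (elim x)
    have "\<nabla> v x = (1 / t) *\<^sub>R (t *\<^sub>R \<nabla> uh x + \<nabla> w x)" using t elim(1) by (simp add: scaleR_add_right)
    then have "norm (\<nabla> v x) = (1 / t) * norm (t *\<^sub>R \<nabla> uh x + \<nabla> w x)" using t by simp
    also have "\<dots> \<le> (1 / t) * (t * \<zeta> x)" using elim(2) t by (intro mult_left_mono) auto
    finally show ?case using t by simp
  qed
  ultimately have "v \<in> K" using v(1) by (simp add: primal_set_def)
  from variational_inequality[OF this]
  have "F uh + (1 / t) * F w - F u \<le> A (\<nabla> uh) + (1 / t) * A (\<nabla> w) - A (\<nabla> u)"
    unfolding v_def[abs_def] lincomb_Dirichlet[OF uh VD[OF w]] A_lincomb[OF uh(1) VD(1)[OF w]] .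
  then have "(1 / t) * residual w \<le> residual w0"
    unfolding residual_w0 by (simp add: residual_def algebra_simps diff_divide_distrib)
  then show ?thesis using t by (simp add: field_simps)
qed

text \<open>The rescaling breaks down at \<open>t = 0\<close>. Raising \<open>t\<close> by a small
  \<open>s\<close> preserves the hypothesis because \<open>uh\<close> itself is feasible, and costs
  only \<open>s * residual w0 \<le> e\<close>.\<close>

lemma residual_le:
  assumes w: "w \<in> V" and t: "t \<ge> 0" and le: "AE x in M. norm (t *\<^sub>R \<nabla> uh x + \<nabla> w x) \<le> t * \<zeta> x"
  shows "residual w \<le> t * residual w0"
proof (rule field_le_epsilon)
  fix e :: real assume "e > 0"
  define s where "s = e / (1 + residual w0)"
  have s: "s > 0" using \<open>e > 0\<close> residual_w0_nonneg by (simp add: s_def)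
  have "AE x in M. norm ((t + s) *\<^sub>R \<nabla> uh x + \<nabla> w x) \<le> (t + s) * \<zeta> x"
    using le zeta_uh
  proof eventually_elim
    case (elim x)
    have "(t + s) *\<^sub>R \<nabla> uh x + \<nabla> w x = (t *\<^sub>R \<nabla> uh x + \<nabla> w x) + s *\<^sub>R \<nabla> uh x" by (simp add: algebra_simps)
    also have "norm \<dots> \<le> norm (t *\<^sub>R \<nabla> uh x + \<nabla> w x) + s * norm (\<nabla> uh x)"
      using norm_triangle_ineq[of "t *\<^sub>R \<nabla> uh x + \<nabla> w x" "s *\<^sub>R \<nabla> uh x"] s by simp
    also have "\<dots> \<le> t * \<zeta> x + s * \<zeta> x" using elim s by (intro add_mono mult_left_mono) auto
    finally show ?case by (simp add: algebra_simps)
  qed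
  then have "residual w \<le> (t + s) * residual w0"
    using s t by (intro residual_le_pos[OF w]) auto
  also have "\<dots> \<le> t * residual w0 + e"
  proof -
    have "s * residual w0 \<le> s * (1 + residual w0)" using s by simp
    also have "\<dots> = e" using residual_w0_nonneg by (simp add: s_def)
    finally show ?thesis by (simp add: distrib_right)
  qed
  finally show "residual w \<le> t * residual w0 + e" .
qed

text \<open>The wanted \<open>T\<close> satisfies \<open>T p \<le> t * T (\<nabla> u)\<close>
  whenever the norm of \<open>p\<close> is at most \<open>t * \<zeta>\<close>. Write
  \<open>p\<close> as \<open>t\<close> times the gradient of \<open>uh\<close>, plus
  \<open>q\<close>, plus the gradient of some \<open>w \<in> V\<close>. Since \<open>T\<close> is to
  equal the residual on gradients from \<open>V\<close>, this is the constraint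
  \<open>T q \<le> t * residual w0 - residual w\<close>.\<close>

definition cone :: "(('a \<Rightarrow> 'a) \<times> real) set" where
  "cone = {(q, t * residual w0 - residual w) | q t w. q \<in> Linf \<Omega> \<and> t \<ge> 0 \<and> w \<in> V \<and>
     (AE x in M. norm (t *\<^sub>R \<nabla> uh x + q x + \<nabla> w x) \<le> t * \<zeta> x)}"

lemma coneI:
  assumes "q \<in> Linf \<Omega>" "t \<ge> 0" "w \<in> V" "AE x in M. norm (t *\<^sub>R \<nabla> uh x + q x + \<nabla> w x) \<le> t * \<zeta> x"
  shows "(q, t * residual w0 - residual w) \<in> cone"
  using assms unfolding cone_def by blast

lemma coneE:
  assumes "(q, r) \<in> cone"
  obtains t w where "q \<in> Linf \<Omega>" "t \<ge> 0" "w \<in> V" "AE x in M. norm (t *\<^sub>R \<nabla> uh x + q x + \<nabla> w x) \<le> t * \<zeta> x"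
    "r = t * residual w0 - residual w"
  using assms unfolding cone_def by blast

lemma V_zero: "(\<lambda>x. 0) \<in> V" "residual (\<lambda>x. 0) = 0"
  using V_lincomb[OF w0(1) w0(1), of "-1"] residual_lincomb[OF w0(1) w0(1), of "-1"] by simp_all

lemma V_scale:
  assumes "w \<in> V"
  shows "(\<lambda>x. c * w x) \<in> V" "AE x in M. \<nabla> (\<lambda>x. c * w x) x = c *\<^sub>R \<nabla> w x" "residual (\<lambda>x. c * w x) = c * residual w"
proof -
  show "(\<lambda>x. c * w x) \<in> V" using V_lincomb[OF V_zero(1) assms, of c] by simp
  show "residual (\<lambda>x. c * w x) = c * residual w"
    using residual_lincomb[OF V_zero(1) assms, of c] V_zero(2) by simp
  have "AE x in M. \<nabla> (\<lambda>x. c * w x) x = \<nabla> (\<lambda>x. 0) x + c *\<^sub>R \<nabla> w x"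
    using grad_lincomb_AE[OF V_zero(1) assms, of c] by simp
  then show "AE x in M. \<nabla> (\<lambda>x. c * w x) x = c *\<^sub>R \<nabla> w x"
    using W1inf_zero(2) by eventually_elim simp
qed

text \<open>Sums and multiples are convexity of the norm bound; the consistency condition at
  \<open>q = 0\<close> is exactly \<open>residual_le\<close>.\<close>

lemma cone_constraint_cone: "constraint_cone (Linf \<Omega>) cone"
  unfolding constraint_cone_def
proof (intro conjI allI impI)
  show "cone \<subseteq> Linf \<Omega> \<times> UNIV" by (auto simp: cone_def)
next
  fix q r q' r' assume "(q, r) \<in> cone" "(q', r') \<in> cone"
  then obtain t w t' w' where
    1: "q \<in> Linf \<Omega>" "t \<ge> 0" "w \<in> V" "AE x in M. norm (t *\<^sub>R \<nabla> uh x + q x + \<nabla> w x) \<le> t * \<zeta> x"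
      "r = t * residual w0 - residual w" and
    2: "q' \<in> Linf \<Omega>" "t' \<ge> 0" "w' \<in> V" "AE x in M. norm (t' *\<^sub>R \<nabla> uh x + q' x + \<nabla> w' x) \<le> t' * \<zeta> x"
      "r' = t' * residual w0 - residual w'"
    by (elim coneE)
  have gr: "AE x in M. \<nabla> (\<lambda>x. w x + 1 * w' x) x = \<nabla> w x + 1 *\<^sub>R \<nabla> w' x"
    by (rule grad_lincomb_AE[OF 1(3) 2(3)])
  have "AE x in M. norm ((t + t') *\<^sub>R \<nabla> uh x + (q x + q' x) + \<nabla> (\<lambda>x. w x + 1 * w' x) x) \<le> (t + t') * \<zeta> x"
    using 1(4) 2(4) gr
  proof eventually_elim
    case (elim x)
    have "(t + t') *\<^sub>R \<nabla> uh x + (q x + q' x) + \<nabla> (\<lambda>x. w x + 1 * w' x) x =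
      (t *\<^sub>R \<nabla> uh x + q x + \<nabla> w x) + (t' *\<^sub>R \<nabla> uh x + q' x + \<nabla> w' x)"
      unfolding elim(3) by (simp add: algebra_simps)
    also have "norm \<dots> \<le> t * \<zeta> x + t' * \<zeta> x" using elim(1,2) by (rule norm_triangle_mono)
    finally show ?case by (simp add: algebra_simps)
  qed
  then have "((\<lambda>x. q x + q' x), (t + t') * residual w0 - residual (\<lambda>x. w x + 1 * w' x)) \<in> cone"
    using 1 2 by (intro coneI Linf_add V_lincomb) auto
  then show "((\<lambda>x. q x + q' x), r + r') \<in> cone"
    unfolding residual_lincomb[OF 1(3) 2(3)] 1(5) 2(5) by (simp add: algebra_simps)
next
  fix q r and c :: real assume "(q, r) \<in> cone" and c: "0 \<le> c"
  then obtain t w where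
    1: "q \<in> Linf \<Omega>" "t \<ge> 0" "w \<in> V" "AE x in M. norm (t *\<^sub>R \<nabla> uh x + q x + \<nabla> w x) \<le> t * \<zeta> x"
      "r = t * residual w0 - residual w" by (elim coneE)
  have "AE x in M. norm ((c * t) *\<^sub>R \<nabla> uh x + c *\<^sub>R q x + \<nabla> (\<lambda>x. c * w x) x) \<le> (c * t) * \<zeta> x"
    using 1(4) V_scale(2)[OF 1(3), of c]
  proof eventually_elim
    case (elim x)
    have "(c * t) *\<^sub>R \<nabla> uh x + c *\<^sub>R q x + \<nabla> (\<lambda>x. c * w x) x = c *\<^sub>R (t *\<^sub>R \<nabla> uh x + q x + \<nabla> w x)"
      unfolding elim(2) by (simp add: algebra_simps)
    then show ?case using elim(1) c by (simp add: mult_left_mono mult.assoc)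
  qed
  then have "((\<lambda>x. c *\<^sub>R q x), (c * t) * residual w0 - residual (\<lambda>x. c * w x)) \<in> cone"
    using 1 c by (intro coneI Linf_scaleR V_scale) auto
  then show "((\<lambda>x. c *\<^sub>R q x), c * r) \<in> cone"
    unfolding V_scale(3)[OF 1(3)] 1(5) by (simp add: algebra_simps)
next
  fix r assume "((\<lambda>x. 0), r) \<in> cone"
  then obtain t w where
    1: "t \<ge> 0" "w \<in> V" "AE x in M. norm (t *\<^sub>R \<nabla> uh x + 0 + \<nabla> w x) \<le> t * \<zeta> x"
      "r = t * residual w0 - residual w" by (elim coneE)
  then show "0 \<le> r" using residual_le[of w t] by simp
qed

text \<open>Strict feasibility enters here. With \<open>w = 0\<close>, the scale \<open>t\<close>
  must leave room for a field of size \<open>c\<close> next to \<open>t\<close> times the gradient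
  of \<open>uh\<close>. The room is at least \<open>t * (1 - \<theta>) * z0\<close>, which
  determines \<open>t\<close>.\<close>

lemma cone_bound:
  assumes q: "q \<in> Linf \<Omega>" "c \<ge> 0" "AE x in M. norm (q x) \<le> c"
  shows "(q, residual w0 / ((1 - \<theta>) * z0) * c) \<in> cone"
proof -
  define t where "t = c / ((1 - \<theta>) * z0)"
  have t: "t \<ge> 0" using q(2) \<theta>(1) z0_pos by (simp add: t_def)
  have "AE x in M. norm (t *\<^sub>R \<nabla> uh x + q x + \<nabla> (\<lambda>x. 0) x) \<le> t * \<zeta> x"
    using q(3) \<theta>(2) zeta_ge W1inf_zero(2)
  proof eventually_elim
    case (elim x)
    have "norm (t *\<^sub>R \<nabla> uh x + q x + \<nabla> (\<lambda>x. 0) x) \<le> t * norm (\<nabla> uh x) + norm (q x)"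
      using norm_triangle_ineq[of "t *\<^sub>R \<nabla> uh x" "q x"] t elim(4) by simp
    also have "\<dots> \<le> t * (\<theta> * \<zeta> x) + c" using elim(1,2) t by (intro add_mono mult_left_mono) auto
    also have "c = t * (1 - \<theta>) * z0" using \<theta>(1) z0_pos by (simp add: t_def)
    also have "t * (1 - \<theta>) * z0 \<le> t * (1 - \<theta>) * \<zeta> x"
      using elim(3) t \<theta>(1) by (intro mult_left_mono) auto
    finally show ?case by (simp add: algebra_simps)
  qed
  from coneI[OF q(1) t V_zero(1) this] show ?thesis
    by (simp add: V_zero(2) t_def mult.commute)
qed

text \<open>Each property is read off from special constraints: boundedness from
  \<open>w = 0\<close>, the values on gradients from \<open>t = 0\<close>, and maximality at the
  gradient of \<open>u\<close> from \<open>t = 1\<close> and \<open>w = 0\<close>.\<close>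

lemma multiplier_exists:
  obtains T C where "Linf_functional \<Omega> T C" "\<And>w. w \<in> V \<Longrightarrow> T (\<nabla> w) = residual w"
    "\<And>q. q \<in> Linf \<Omega> \<Longrightarrow> AE x in M. norm (q x) \<le> \<zeta> x \<Longrightarrow> T q \<le> T (\<nabla> u)"
proof -
  have total: "\<exists>r. (q, r) \<in> cone" if "q \<in> Linf \<Omega>" for q
    using LinfE[OF that] cone_bound[OF that] by blast
  have lin: "(\<lambda>x. q x + c *\<^sub>R r x) \<in> Linf \<Omega>" if "q \<in> Linf \<Omega>" "r \<in> Linf \<Omega>" for q r :: "'a \<Rightarrow> 'a" and c
    using that by (intro Linf_add Linf_scaleR)
  obtain T where T: "\<And>q r c. q \<in> Linf \<Omega> \<Longrightarrow> r \<in> Linf \<Omega> \<Longrightarrow> T (\<lambda>x. q x + c *\<^sub>R r x) = T q + c * T r"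
    and le: "\<And>q r. (q, r) \<in> cone \<Longrightarrow> T q \<le> r"
    using Hahn_Banach_cone[OF lin Linf_const cone_constraint_cone total] by blast
  define C where "C = residual w0 / ((1 - \<theta>) * z0)"
  have TC: "Linf_functional \<Omega> T C"
    unfolding Linf_functional_def
  proof (intro conjI ballI allI impI)
    show "0 \<le> C" using residual_w0_nonneg \<theta>(1) z0_pos by (simp add: C_def)
    show "T (\<lambda>x. q x + c *\<^sub>R r x) = T q + c * T r" if "q \<in> Linf \<Omega>" "r \<in> Linf \<Omega>" for q r c
      using that by (rule T)
    fix q :: "'a \<Rightarrow> 'a" and c :: real assume q: "q \<in> Linf \<Omega>" "c \<ge> 0" "AE x in M. norm (q x) \<le> c"
    have 1: "T q \<le> C * c" unfolding C_def using cone_bound[OF q] by (rule le)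
    have "T (\<lambda>x. (-1) *\<^sub>R q x) \<le> C * c"
      unfolding C_def using q by (intro le cone_bound Linf_scaleR) auto
    \<comment> \<open>Only combinations \<open>q + c r\<close> are available so far; with
      \<open>r = q\<close> and \<open>c = -2\<close> they produce \<open>- q\<close>.\<close>
    moreover have "T (\<lambda>x. (-1) *\<^sub>R q x) = - T q"
      using T[OF q(1) q(1), of "-2"] by (simp add: scaleR_2)
    ultimately show "\<bar>T q\<bar> \<le> C * c" using 1 by simp
  qed
  have grad_le: "T (\<nabla> w) \<le> residual w" if w: "w \<in> V" for w
  proof -
    \<comment> \<open>At \<open>t = 0\<close> the norm bound demands that \<open>q\<close> be
      cancelled by a gradient; shifting by \<open>- w\<close> does this for \<open>q\<close> the
      gradient of \<open>w\<close>. The reverse inequality follows by passing to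
      \<open>- w\<close>.\<close>
    have "AE x in M. norm (0 *\<^sub>R \<nabla> uh x + \<nabla> w x + \<nabla> (\<lambda>x. (-1) * w x) x) \<le> 0 * \<zeta> x"
      using V_scale(2)[OF w, of "-1"] by eventually_elim simp
    from coneI[OF grad_Linf[OF VD(1)[OF w]] order_refl V_scale(1)[OF w] this]
    have "(\<nabla> w, residual w) \<in> cone" using V_scale(3)[OF w, of "-1"] by simp
    then show ?thesis by (rule le)
  qed
  have grad_eq: "T (\<nabla> w) = residual w" if w: "w \<in> V" for w
  proof (rule antisym[OF grad_le[OF w]])
    note wL = grad_Linf[OF VD(1)[OF w]]
    have "T (\<nabla> (\<lambda>x. (-1) * w x)) = T (\<lambda>x. (-1) *\<^sub>R \<nabla> w x)"
      using grad_Linf[OF VD(1)[OF V_scale(1)[OF w]]] Linf_scaleR[OF wL] V_scale(2)[OF w]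
      by (rule Linf_functional_AE_cong[OF TC])
    also have "\<dots> = - T (\<nabla> w)" using Linf_functional_scaleR[OF TC wL, of "-1"] by simp
    finally show "residual w \<le> T (\<nabla> w)"
      using grad_le[OF V_scale(1)[OF w, of "-1"]] V_scale(3)[OF w, of "-1"] by simp
  qed
  have "T q \<le> T (\<nabla> u)" if q: "q \<in> Linf \<Omega>" "AE x in M. norm (q x) \<le> \<zeta> x" for q
  proof -
    note L = grad_Linf[OF KD(1)[OF u]] grad_Linf[OF uh(1)]
    have "AE x in M. norm (1 *\<^sub>R \<nabla> uh x + (q x - \<nabla> uh x) + \<nabla> (\<lambda>x. 0) x) \<le> 1 * \<zeta> x"
      using q(2) W1inf_zero(2) by eventually_elim simp
    from coneI[OF Linf_diff[OF q(1) L(2)] zero_le_one V_zero(1) this]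
    have "T (\<lambda>x. q x - \<nabla> uh x) \<le> residual w0" using V_zero(2) by (intro le) simp
    also have "\<dots> = T (\<nabla> w0)" using grad_eq[OF w0(1)] by simp
    also have "\<dots> = T (\<lambda>x. \<nabla> u x - \<nabla> uh x)"
      by (rule Linf_functional_AE_cong[OF TC grad_Linf[OF VD(1)[OF w0(1)]] Linf_diff[OF L] w0(2)])
    finally show ?thesis
      using Linf_functional_diff[OF TC q(1) L(2)] Linf_functional_diff[OF TC L] by simp
  qed
  then show thesis using that TC grad_eq by blast
qed

section \<open>Weak and strong duality\<close>

lemma dual_energy_eq:
  assumes "\<nu> \<in> dual_set \<Omega> \<Gamma>D f g"
  shows "dual_energy \<Omega> \<Gamma>D \<zeta> uh f g \<nu> = ereal (ba_integral \<Omega> \<nu> (\<nabla> uh) - F uh -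
    ((LINT x|M. phi_star \<zeta> x (ac_part \<Omega> \<nu> x)) + tv (ba_density \<Omega> \<zeta> (sing_part \<Omega> \<nu>)) \<Omega>))"
proof -
  have nu: "\<nu> \<in> ba \<Omega>" using assms by (simp add: dual_set_def)
  have "sing_part \<Omega> \<nu> \<in> ba \<Omega>"
    using yosida_hewitt_parts[OF nu] by (simp add: yosida_hewitt_def)
  then have "total_variation \<Omega> (ba_density \<Omega> \<zeta> (sing_part \<Omega> \<nu>)) \<Omega> = ennreal (tv (ba_density \<Omega> \<zeta> (sing_part \<Omega> \<nu>)) \<Omega>)"
    by (intro total_variation_eq_tv ba_density_ba zeta_Linf) auto
  then show ?thesis using assms by (simp add: dual_energy_def enn2ereal_ennreal)
qed

text \<open>The dual constraint tested with \<open>w0\<close>. It trades the lift \<open>uh\<close>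
  in the dual functional for the minimiser \<open>u\<close>.\<close>

lemma dual_set_lift:
  assumes "\<nu> \<in> dual_set \<Omega> \<Gamma>D f g"
  shows "ba_integral \<Omega> \<nu> (\<nabla> u) - ba_integral \<Omega> \<nu> (\<nabla> uh) = F u - F uh"
proof -
  have nu: "\<nu> \<in> ba \<Omega>" using assms by (simp add: dual_set_def)
  note T = ba_integral_Linf_functional[OF nu] and L = grad_Linf[OF KD(1)[OF u]] grad_Linf[OF uh(1)]
  have "F u - F uh = ba_integral \<Omega> \<nu> (\<nabla> w0)"
    using assms w0(1,3) by (simp add: dual_set_def)
  also have "\<dots> = ba_integral \<Omega> \<nu> (\<lambda>x. \<nabla> u x - \<nabla> uh x)"
    by (rule Linf_functional_AE_cong[OF T grad_Linf[OF VD(1)[OF w0(1)]] Linf_diff[OF L] w0(2)])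
  finally show ?thesis using Linf_functional_diff[OF T L] by simp
qed

text \<open>The conjugate bound is applied to the gradient of \<open>u\<close>, which is admissible
  because \<open>u \<in> K\<close>; \<open>dual_set_lift\<close> then turns the terms in
  \<open>u\<close> into those in \<open>uh\<close>.\<close>

lemma weak_duality:
  "dual_energy \<Omega> \<Gamma>D \<zeta> uh f g \<nu> \<le> primal_energy \<Omega> \<Gamma>D \<zeta> uD f g u"
proof (cases "\<nu> \<in> dual_set \<Omega> \<Gamma>D f g")
  case True
  then have nu: "\<nu> \<in> ba \<Omega>" by (simp add: dual_set_def)
  have "(LINT x|M. (norm (\<nabla> u x))\<^sup>2) = A (\<nabla> u)" by (simp add: A_def power2_norm_eq_inner)
  then show ?thesis
    using ba_integral_energy_le[OF nu yosida_hewitt_parts[OF nu] grad_Linf[OF KD(1)[OF u]] KD(3)[OF u]]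
      dual_set_lift[OF True]
    unfolding u_energy dual_energy_eq[OF True] by simp
next
  case False
  then show ?thesis by (simp add: dual_energy_def)
qed

lemma strong_duality:
  "\<exists>\<nu>\<in>dual_set \<Omega> \<Gamma>D f g. primal_energy \<Omega> \<Gamma>D \<zeta> uD f g u \<le> dual_energy \<Omega> \<Gamma>D \<zeta> uh f g \<nu>"
proof -
  obtain T C where T: "Linf_functional \<Omega> T C" "\<And>w. w \<in> V \<Longrightarrow> T (\<nabla> w) = residual w"
    "\<And>q. q \<in> Linf \<Omega> \<Longrightarrow> AE x in M. norm (q x) \<le> \<zeta> x \<Longrightarrow> T q \<le> T (\<nabla> u)"
    using multiplier_exists by blast
  note S = Linf_functional_plus[OF A_functional T(1)]
  define \<nu> where "\<nu> = functional_measure (\<lambda>q. A q + T q)"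
  have nu: "\<nu> \<in> ba \<Omega>" unfolding \<nu>_def using S by (rule functional_measure_ba)
  have int: "ba_integral \<Omega> \<nu> q = A q + T q" if "q \<in> Linf \<Omega>" for q
    unfolding \<nu>_def using S that by (rule ba_integral_functional_measure)
  have "ba_integral \<Omega> \<nu> (\<nabla> w) = F w" if "w \<in> V" for w
    using int[OF grad_Linf[OF VD(1)[OF that]]] T(2)[OF that] by (simp add: residual_def)
  then have dual: "\<nu> \<in> dual_set \<Omega> \<Gamma>D f g" using nu by (simp add: dual_set_def)
  note uL = grad_Linf[OF KD(1)[OF u]]
  have "(LINT x|M. phi_star \<zeta> x (ac_part \<Omega> \<nu> x)) + tv (ba_density \<Omega> \<zeta> (sing_part \<Omega> \<nu>)) \<Omega>
      \<le> ba_integral \<Omega> \<nu> (\<nabla> u) - 1/2 * A (\<nabla> u)"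
  proof (rule energy_bound_imp_conjugate_le[OF nu yosida_hewitt_parts[OF nu]])
    fix q :: "'a \<Rightarrow> 'a" assume q: "q \<in> Linf \<Omega>" "AE x in M. norm (q x) \<le> \<zeta> x"
    have i: "integrable M (\<lambda>x. \<nabla> u x \<bullet> \<nabla> u x)" "integrable M (\<lambda>x. \<nabla> u x \<bullet> q x)" "integrable M (\<lambda>x. (norm (q x))\<^sup>2)"
      using uL q(1) by (auto intro!: integrable_Linf Linf_inner energy_integrable)
    \<comment> \<open>This square gives \<open>A q - 1/2 * (norm of q)^2\<close>, integrated, at
      most \<open>1/2 * A (\<nabla> u)\<close>. Together with
      \<open>T q \<le> T (\<nabla> u)\<close> it says that the gradient of \<open>u\<close>
      maximises the quadratic functional over the ball of radius \<open>\<zeta>\<close>.\<close>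
    have "0 \<le> (LINT x|M. (norm (\<nabla> u x - q x))\<^sup>2)" by simp
    also have "\<dots> = (LINT x|M. \<nabla> u x \<bullet> \<nabla> u x - 2 * (\<nabla> u x \<bullet> q x) + (norm (q x))\<^sup>2)"
      by (intro Bochner_Integration.integral_cong) (auto simp: power2_norm_eq_inner inner_diff inner_commute)
    also have "\<dots> = A (\<nabla> u) - 2 * A q + (LINT x|M. (norm (q x))\<^sup>2)"
      unfolding A_def using i by simp
    finally show "ba_integral \<Omega> \<nu> q - 1/2 * (LINT x|M. (norm (q x))\<^sup>2) \<le> ba_integral \<Omega> \<nu> (\<nabla> u) - 1/2 * A (\<nabla> u)"
      using T(3)[OF q] unfolding int[OF q(1)] int[OF uL] by simp
  qed
  then have "primal_energy \<Omega> \<Gamma>D \<zeta> uD f g u \<le> dual_energy \<Omega> \<Gamma>D \<zeta> uh f g \<nu>"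
    using dual_set_lift[OF dual] unfolding u_energy dual_energy_eq[OF dual] by simp
  then show ?thesis using dual by blast
qed

end

theorem theorem4p5:
  fixes \<Omega> \<Gamma>D \<Gamma>N :: "'a::euclidean_space set"
    and f \<zeta> uD uh u :: "'a \<Rightarrow> real"
    and g :: "('a \<Rightarrow> real) \<Rightarrow> real"
    and \<mu> :: "'a set \<Rightarrow> 'a"
  defines "I \<equiv> primal_energy \<Omega> \<Gamma>D \<zeta> uD f g"
    and "D \<equiv> dual_energy \<Omega> \<Gamma>D \<zeta> uh f g"
  assumes "simplicial_lipschitz_domain \<Omega>"
    and "boundary_partition \<Omega> \<Gamma>D \<Gamma>N" and "surface_measure \<Gamma>D > 0"
    and "integrable (lebesgue_on \<Omega>) f"
    and "g \<in> W1inf_bdry_dual \<Omega> \<Gamma>N"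
    and "\<zeta> \<in> Linf \<Omega>" and "Liminf (ae_filter (lebesgue_on \<Omega>)) (\<lambda>x. ereal (\<zeta> x)) > 0"
    and "uD \<in> W1inf_bdry \<Omega> \<Gamma>D"
    and "uh \<in> W1inf \<Omega>" and "trace_eq_on \<Omega> \<Gamma>D uh uD"
    and "Linf_norm \<Omega> (\<lambda>x. grad \<Omega> uh x /\<^sub>R \<zeta> x) < 1"
    and "u \<in> primal_set \<Omega> \<Gamma>D \<zeta> uD" and "\<forall>v\<in>W1inf \<Omega>. I u \<le> I v"
    and "\<mu> \<in> ba \<Omega>" and "\<forall>\<nu>\<in>ba \<Omega>. D \<nu> \<le> D \<mu>"
  shows "\<forall>v\<in>primal_set \<Omega> \<Gamma>D \<zeta> uD. \<forall>\<nu>\<in>dual_set \<Omega> \<Gamma>D f g.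
           total_error I D u \<mu> v \<nu> = gap_estimator I D v \<nu>"
proof (intro ballI)
  fix v \<nu> assume v: "v \<in> primal_set \<Omega> \<Gamma>D \<zeta> uD" and \<nu>: "\<nu> \<in> dual_set \<Omega> \<Gamma>D f g"
  interpret bounded_open \<Omega>
    using assms(3) by unfold_locales (auto simp: simplicial_lipschitz_domain_def lipschitz_domain_def)
  \<comment> \<open>Any number strictly between 0 and the essential infimum serves as the lower
    bound for \<open>\<zeta>\<close>.\<close>
  obtain z0 where z0: "0 < ereal z0" "ereal z0 < Liminf (ae_filter M) (\<lambda>x. ereal (\<zeta> x))"
    using ereal_dense2[OF assms(9)] by blast
  have zeta_ge: "AE x in M. z0 \<le> \<zeta> x"
    using less_LiminfD[OF z0(2)] by eventually_elim simp
  \<comment> \<open>Interpolating between the norm and 1 gives a real bound that is still strictly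
    below 1.\<close>
  obtain \<theta> where th: "Linf_norm \<Omega> (\<lambda>x. grad \<Omega> uh x /\<^sub>R \<zeta> x) < ereal \<theta>" "ereal \<theta> < 1"
    using ereal_dense2[OF assms(13)] by blast
  have [measurable]: "\<zeta> \<in> borel_measurable M" "grad \<Omega> uh \<in> borel_measurable M"
    using assms(8) W1inf_grad(2)[OF assms(11)] by (auto simp: Linf_measurable)
  have meas: "(\<lambda>x. grad \<Omega> uh x /\<^sub>R \<zeta> x) \<in> borel_measurable M" by measurable
  have "AE x in M. norm (grad \<Omega> uh x /\<^sub>R \<zeta> x) \<le> \<theta>"
    using th(1) by (subst Linf_norm_le_iff[OF meas, symmetric]) simp
  then have uh_le: "AE x in M. norm (grad \<Omega> uh x) \<le> \<theta> * \<zeta> x"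
    using zeta_ge
  proof eventually_elim
    case (elim x)
    then have "\<zeta> x > 0" using z0(1) by simp
    then show ?case using elim(1) by (simp add: field_simps)
  qed
  have \<Gamma>N: "\<Gamma>N \<subseteq> closure \<Omega>"
    using assms(4) openin_imp_subset unfolding boundary_partition_def frontier_def by blast
  interpret primal_problem \<Omega> \<zeta> z0 \<Gamma>D \<Gamma>N f uD uh u g \<theta>
    using z0(1) zeta_ge \<Gamma>N assms th(2) uh_le by unfold_locales (auto simp: I_def)
  \<comment> \<open>Strong duality yields some dual measure reaching \<open>I u\<close>; maximality
    of \<open>\<mu>\<close> passes this on to \<open>D \<mu>\<close>.\<close>
  obtain \<nu>0 where "\<nu>0 \<in> dual_set \<Omega> \<Gamma>D f g" "I u \<le> D \<nu>0"
    using strong_duality unfolding I_def D_def by blast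
  moreover have "\<nu>0 \<in> ba \<Omega>" using calculation(1) by (simp add: dual_set_def)
  ultimately have "I u \<le> D \<mu>" using assms(17) order_trans by blast
  then have D\<mu>: "D \<mu> = I u" using weak_duality[of \<mu>] unfolding I_def D_def by (rule antisym[rotated])
  \<comment> \<open>Cancellation in \<open>ereal\<close> is legitimate only for finite values, so
    all remaining energies are exhibited as reals.\<close>
  obtain a where a: "I u = ereal a" using u_energy unfolding I_def by blast
  obtain b where b: "I v = ereal b" using v unfolding I_def primal_energy_def by simp
  obtain c where c: "D \<nu> = ereal c" using dual_energy_eq[OF \<nu>] unfolding D_def by blast
  show "total_error I D u \<mu> v \<nu> = gap_estimator I D v \<nu>"
    unfolding total_error_def gap_estimator_def D\<mu> a b c by simp
qed

end
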